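(* A system of congruences has a solution in the sphere $S^2$ using sets with the property of Baire (possibly meager or empty), with the congruences witnessed by elements of some free group of rotations of $S^2$, if and only if the system has a subsystem, obtained by deleting zero or more (but not all) of the sets $A_1,\dots,A_r$ from all the congruences, which is weak and consistent.
   Context: Fix a positive integer $r$. A congruence is a pair $(L,R)$ of subsets of the index set $I=\{1,\dots,r\}$, written formally $\bigcup_{k\in L}A_k\cong\bigcup_{k\in R}A_k$; a system of congruences is a finite list of pairs $(L_i,R_i)$, $i\le m$. Deleting the sets $A_k$, $k\in D$ (with $D\subsetneq I$) produces the subsystem on the index set $I'=I\setminus D$ given by the pairs $(L_i\setminus D,R_i\setminus D)$, $i\le m$. The following notions apply to a system on any nonempty finite index set $I$, with $S^c=I\setminus S$. The congruences deducible from a system are those obtained from its members (read symmetrically, so $(L,R)$ also gives $(R,L)$) by taking complements ($(L,R)$ gives $(L^c,R^c)$) and transitivity ($(L,M)$ and $(M,R)$ give $(L,R)$). The system is weak if no congruence of the form $(L,L^c)$ is deducible from it. Let $\preceq$ be the smallest transitive relation on subsets of $I$ such that $L\preceq R$ whenever $L\subseteq R$, and $L_i\preceq R_i$, $R_i\preceq L_i$, $L_i^c\preceq R_i^c$, $R_i^c\preceq L_i^c$ for all $i\le m$. The system is consistent if there are no $L,R$ with $R$ a proper subset of $L$ and $L\preceq R$. A solution to a system in $S^2$ with witnesses in a group $G$ of rotations is a sequence of pairwise disjoint sets $A_1,\dots,A_r$ with union $S^2$ such that for each $i\le m$ there is $\sigma_i\in G$ with $\sigma_i(\bigcup_{k\in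 L_i}A_k)=\bigcup_{k\in R_i}A_k$. A set has the property of Baire if it differs from an open set by a meager set. *)

theory Defs
  imports "HOL-Analysis.Analysis" "HOL-Algebra.Generated_Groups"
begin

section \<open>Systems of congruences\<close>

text \<open>A pair \<open>(L, R)\<close> of index sets stands for the formal congruence between the union of the
  \<open>A k\<close> with \<open>k \<in> L\<close> and the union of the \<open>A k\<close> with \<open>k \<in> R\<close>.\<close>

type_synonym congruence = "nat set \<times> nat set"

definition congruence_system :: "nat set \<Rightarrow> congruence list \<Rightarrow> bool" where
  "congruence_system I C \<longleftrightarrow> (\<forall>(L, R) \<in> set C. L \<subseteq> I \<and> R \<subseteq> I)"

definition delete_sets :: "nat set \<Rightarrow> congruence list \<Rightarrow> congruence list" where
  "delete_sets D C = map (\<lambda>(L, R). (L - D, R - D)) C"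

text \<open>The index set is an explicit argument below because complements are taken in it.\<close>

inductive deducible :: "nat set \<Rightarrow> congruence list \<Rightarrow> nat set \<Rightarrow> nat set \<Rightarrow> bool"
  for I C where
  base: "(L, R) \<in> set C \<Longrightarrow> deducible I C L R"
| base_sym: "(L, R) \<in> set C \<Longrightarrow> deducible I C R L"
| compl: "deducible I C L R \<Longrightarrow> deducible I C (I - L) (I - R)"
| trans: "deducible I C L M \<Longrightarrow> deducible I C M R \<Longrightarrow> deducible I C L R"

definition weak_system :: "nat set \<Rightarrow> congruence list \<Rightarrow> bool" where
  "weak_system I C \<longleftrightarrow> \<not> (\<exists>L \<subseteq> I. deducible I C L (I - L))"

inductive cong_preceq :: "nat set \<Rightarrow> congruence list \<Rightarrow> nat set \<Rightarrow> nat set \<Rightarrow> bool"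
  for I C where
  subset: "L \<subseteq> R \<Longrightarrow> R \<subseteq> I \<Longrightarrow> cong_preceq I C L R"
| base: "(L, R) \<in> set C \<Longrightarrow> cong_preceq I C L R"
| base_sym: "(L, R) \<in> set C \<Longrightarrow> cong_preceq I C R L"
| compl: "(L, R) \<in> set C \<Longrightarrow> cong_preceq I C (I - L) (I - R)"
| compl_sym: "(L, R) \<in> set C \<Longrightarrow> cong_preceq I C (I - R) (I - L)"
| trans: "cong_preceq I C L M \<Longrightarrow> cong_preceq I C M R \<Longrightarrow> cong_preceq I C L R"

definition consistent_system :: "nat set \<Rightarrow> congruence list \<Rightarrow> bool" where
  "consistent_system I C \<longleftrightarrow> \<not> (\<exists>L R. L \<subseteq> I \<and> R \<subset> L \<and> cong_preceq I C L R)"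


section \<open>Free groups of rotations\<close>

text \<open>A word is a list of letters \<open>(x, b)\<close>, with \<open>(x, True)\<close> standing for \<open>x\<close> and \<open>(x, False)\<close>
  for its inverse.\<close>

primrec eval_word :: "('a, 'b) monoid_scheme \<Rightarrow> ('a \<times> bool) list \<Rightarrow> 'a" where
  "eval_word G [] = \<one>\<^bsub>G\<^esub>"
| "eval_word G (l # w) = (if snd l then fst l else inv\<^bsub>G\<^esub> (fst l)) \<otimes>\<^bsub>G\<^esub> eval_word G w"

definition reduced_word :: "('a \<times> bool) list \<Rightarrow> bool" where
  "reduced_word w \<longleftrightarrow>
    (\<forall>i. Suc i < length w \<longrightarrow> \<not> (fst (w ! i) = fst (w ! Suc i) \<and> snd (w ! i) \<noteq> snd (w ! Suc i)))"

definition free_basis :: "('a, 'b) monoid_scheme \<Rightarrow> 'a set \<Rightarrow> bool" where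
  "free_basis G X \<longleftrightarrow> X \<subseteq> carrier G \<and> generate G X = carrier G \<and>
    (\<forall>w. reduced_word w \<and> w \<noteq> [] \<and> fst ` set w \<subseteq> X \<longrightarrow> eval_word G w \<noteq> \<one>\<^bsub>G\<^esub>)"

definition free_group :: "('a, 'b) monoid_scheme \<Rightarrow> bool" where
  "free_group G \<longleftrightarrow> group G \<and> (\<exists>X. free_basis G X)"

definition SO3 :: "(real^3^3) monoid" where
  "SO3 = \<lparr>carrier = {Q. rotation_matrix Q}, mult = (**), one = mat 1\<rparr>"


section \<open>The property of Baire\<close>

definition nowhere_dense_in :: "'a topology \<Rightarrow> 'a set \<Rightarrow> bool" where
  "nowhere_dense_in X S \<longleftrightarrow> S \<subseteq> topspace X \<and> X interior_of (X closure_of S) = {}"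

definition meager_in :: "'a topology \<Rightarrow> 'a set \<Rightarrow> bool" where
  "meager_in X S \<longleftrightarrow> (\<exists>N :: nat \<Rightarrow> 'a set. (\<forall>n. nowhere_dense_in X (N n)) \<and> S = (\<Union>n. N n))"

definition baire_property_in :: "'a topology \<Rightarrow> 'a set \<Rightarrow> bool" where
  "baire_property_in X S \<longleftrightarrow>
    S \<subseteq> topspace X \<and> (\<exists>U. openin X U \<and> meager_in X ((S - U) \<union> (U - S)))"


section \<open>Solutions in the sphere\<close>

abbreviation S2 :: "(real^3) set" where
  "S2 \<equiv> sphere 0 1"

definition sphere_solution ::
  "nat set \<Rightarrow> congruence list \<Rightarrow> (real^3^3) set \<Rightarrow> (nat \<Rightarrow> (real^3) set) \<Rightarrow> bool" where
  "sphere_solution I C G A \<longleftrightarrow>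
    disjoint_family_on A I \<and> (\<Union>k\<in>I. A k) = S2 \<and>
    (\<forall>(L, R) \<in> set C. \<exists>\<sigma>\<in>G. (\<lambda>x. \<sigma> *v x) ` (\<Union>k\<in>L. A k) = (\<Union>k\<in>R. A k))"

end

theory Submission
  imports Defs "HOL-Library.Sublist"
begin

text \<open>Given a solution, discard the indices \<open>k\<close> with \<open>A k\<close> meager. Modulo meager sets, every deduced
  relation between \<open>L\<close> and \<open>R\<close> is then witnessed by a rotation \<open>\<sigma>\<close> of the group. Powers of \<open>\<sigma>\<close> return
  points arbitrarily close to themselves, even with odd exponents because a free group is torsion
  free, and a set that is comeager in a ball meets its image under such a power in a nonmeager set.
  This excludes both a congruence of a set with its complement and a relation \<open>L \<preceq> R \<subset> L\<close>.

  Conversely, choose a representative in each class of deducibly congruent index sets, and attach a free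
  generator to every other set of the class. A solution is then a colouring of the sphere by indices,
  constrained along the edges of the orbits, which are trees where the action is free. By consistency
  the colours at the two ends of a long path are independent: along a reduced path, the set of
  colours allowed by the initial one moves strictly up in \<open>\<preceq>\<close> at every other step, until it is everything. Hence
  a partial colouring can be extended past coloured pieces that are far apart, and one can colour
  translates of smaller and smaller balls, which are sparse in each orbit, until open dense sets are
  coloured consistently. The remaining meager set is coloured orbit by orbit with the axiom of choice;
  an orbit with nontrivial stabilizers contains a single cycle, which can be coloured by weakness.\<close>


section \<open>Words\<close>

text \<open>The obstacle on the constructive side: a colouring chosen orbit by orbit need not have
  the property of Baire, so whole open sets must receive one finite pattern at a time, and no gap
  between coloured points may become too short to be filled. Hence a new ball is coloured together
  with the finite subtree spanned by the coloured points near it; clusters of coloured points must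
  stay bounded to keep that subtree finite. Attaching generators to index sets, not to the given
  congruences, is what makes long paths mix. Each class of congruent sets becomes a star with centre
  \<open>rep L\<close>. A step that does not enlarge the set of allowed colours passes through such
  a centre, from leaf to leaf, and a reduced path cannot do so twice in a row. A set has at most
  \<open>2 ^ card I\<close> sets above it in \<preceq>, which explains \<open>bound\<close>.
  Weakness enters twice: it keeps complementary classes apart, so that one generator serves a set
  and its complement, and it yields colours for closed paths. Commutativity of point stabilizers,
  which are rotations about one axis, is what limits an orbit to a single cycle.\<close>

definition linv :: "'a \<times> bool \<Rightarrow> 'a \<times> bool" where
  "linv l = (fst l, \<not> snd l)"

definition winv :: "('a \<times> bool) list \<Rightarrow> ('a \<times> bool) list" where
  "winv w = rev (map linv w)"

lemma linv_simps [simp]: "linv (linv l) = l" "fst (linv l) = fst l" "snd (linv l) \<longleftrightarrow> \<not> snd l"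
  "linv l \<noteq> l" "l \<noteq> linv l" "linv l = linv m \<longleftrightarrow> l = m"
  by (auto simp: linv_def prod_eq_iff)

lemma linv_eq_iff: "l = linv m \<longleftrightarrow> m = linv l"
  by (metis linv_simps(1))

lemma winv_simps [simp]: "winv [] = []" "winv (winv w) = w" "winv (v @ w) = winv w @ winv v"
  "length (winv w) = length w" "winv w = [] \<longleftrightarrow> w = []" "winv (l # w) = winv w @ [linv l]"
  "fst ` set (winv w) = fst ` set w"
  by (auto simp: winv_def rev_map comp_def image_image)

lemma hd_winv: "w \<noteq> [] \<Longrightarrow> hd (winv w) = linv (last w)"
  by (simp add: winv_def hd_rev last_map)

lemma last_winv: "w \<noteq> [] \<Longrightarrow> last (winv w) = linv (hd w)"
  by (simp add: winv_def last_rev hd_map)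

lemma reduced_word_iff_successively:
  "reduced_word w \<longleftrightarrow> successively (\<lambda>l m. m \<noteq> linv l) w"
  by (auto simp: reduced_word_def successively_conv_nth linv_def prod_eq_iff)

lemma reduced_word_Nil [simp]: "reduced_word []"
  and reduced_word_single [simp]: "reduced_word [l]"
  and reduced_word_Cons: "reduced_word (l # w) \<longleftrightarrow> reduced_word w \<and> (w = [] \<or> hd w \<noteq> linv l)"
  by (auto simp: reduced_word_iff_successively successively_Cons)

lemma reduced_word_append:
  "reduced_word (v @ w) \<longleftrightarrow>
     reduced_word v \<and> reduced_word w \<and> (v = [] \<or> w = [] \<or> hd w \<noteq> linv (last v))"
  by (auto simp: reduced_word_iff_successively successively_append_iff)

lemma reduced_word_winv [simp]: "reduced_word (winv w) \<longleftrightarrow> reduced_word w"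
proof -
  have "successively (\<lambda>x y. linv x \<noteq> linv (linv y)) w = successively (\<lambda>l m. m \<noteq> linv l) w"
    by (rule arg_cong2[where f = successively]) (auto simp: linv_def fun_eq_iff prod_eq_iff)
  then show ?thesis
    unfolding reduced_word_iff_successively winv_def successively_rev successively_map by simp
qed

lemma not_reduced_word_split:
  assumes "\<not> reduced_word w"
  obtains p l q where "w = p @ l # linv l # q"
  using assms
proof (induction w arbitrary: thesis)
  case Nil
  then show ?case by simp
next
  case (Cons a w)
  show ?case
  proof (cases "reduced_word w")
    case True
    with Cons.prems(2) have "w \<noteq> []" "hd w = linv a"
      by (auto simp: reduced_word_Cons)
    then have "a # w = [] @ a # linv a # tl w"
      by (cases w) auto
    then show ?thesis by (rule Cons.prems(1))
  next
    case False
    then obtain p l q where "w = p @ l # linv l # q"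
      using Cons.IH by blast
    then have "a # w = (a # p) @ l # linv l # q" by simp
    then show ?thesis by (rule Cons.prems(1))
  qed
qed

text \<open>Cancelling pairs one at a time shortens the word. \<open>f\<close> is arbitrary because
  the lemma serves both words acting on points and words evaluated in a group. The last conclusion
  says that a word which loses no length was already reduced, as
  \<open>last_letter_of_return\<close> exploits.\<close>

lemma reduce_word:
  assumes inv: "\<And>p l q. fst l \<in> \<Lambda> \<Longrightarrow> fst ` set (p @ q) \<subseteq> \<Lambda> \<Longrightarrow> f (p @ l # linv l # q) = f (p @ q)"
    and "fst ` set w \<subseteq> \<Lambda>"
  obtains v where "reduced_word v" "f v = f w" "fst ` set v \<subseteq> \<Lambda>" "length v \<le> length w"
    "v = w \<or> length v < length w"
  using assms(2)
proof (induction "length w" arbitrary: w thesis rule: less_induct)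
  case less
  show ?case
  proof (cases "reduced_word w")
    case True
    then show ?thesis using less.prems by blast
  next
    case False
    then obtain p l q where w: "w = p @ l # linv l # q"
      by (rule not_reduced_word_split)
    have "length (p @ q) < length w" "fst ` set (p @ q) \<subseteq> \<Lambda>" "fst l \<in> \<Lambda>"
      using less.prems(2) by (auto simp: w)
    then obtain v where "reduced_word v" "f v = f (p @ q)" "fst ` set v \<subseteq> \<Lambda>"
      "length v \<le> length (p @ q)"
      using less.hyps[of "p @ q"] by metis
    moreover have "f (p @ q) = f w"
      using inv \<open>fst ` set (p @ q) \<subseteq> \<Lambda>\<close> \<open>fst l \<in> \<Lambda>\<close> by (simp add: w)
    ultimately show ?thesis
      using less.prems(1)[of v] by (simp add: w)
  qed
qed

text \<open>In the tree of words, \<open>w1\<close> is the vertex at which the paths to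
  \<open>w\<close> and to the reduced form of \<open>g @ w\<close> part.\<close>

lemma cancel_words:
  assumes "reduced_word g" "reduced_word w"
  obtains g1 r w1 where "g = g1 @ winv r" "w = r @ w1" "reduced_word (g1 @ w1)"
  using assms
proof (induction w arbitrary: g thesis)
  case Nil
  then show ?case by (metis append_Nil2 winv_simps(1))
next
  case (Cons a w)
  show ?case
  proof (cases "g = [] \<or> last g \<noteq> linv a")
    case True
    then have "reduced_word (g @ a # w)"
      using Cons.prems by (auto simp: reduced_word_append linv_eq_iff)
    then show ?thesis
      using Cons.prems(1)[of g "[]" "a # w"] by simp
  next
    case False
    then have g: "g = butlast g @ [linv a]" by (metis append_butlast_last_id)
    have "reduced_word (butlast g)" "reduced_word w"
      using Cons.prems g by (metis reduced_word_append, simp add: reduced_word_Cons)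
    then obtain g1 r w1 where "butlast g = g1 @ winv r" "w = r @ w1" "reduced_word (g1 @ w1)"
      using Cons.IH by metis
    then show ?thesis
      using Cons.prems(1)[of g1 "a # r" w1] g by simp
  qed
qed

lemma common_suffix:
  obtains g' h' q where "g = g' @ q" "h = h' @ q" "g' = [] \<or> h' = [] \<or> last g' \<noteq> last h'"
proof -
  obtain q gs hs where "rev g = q @ gs" "rev h = q @ hs" "gs = [] \<or> hs = [] \<or> hd gs \<noteq> hd hs"
    by (metis list.sel(1) longest_common_prefix neq_Nil_conv)
  then have "g = rev gs @ rev q" "h = rev hs @ rev q"
    by (metis rev_append rev_rev_ident)+
  moreover have "rev gs = [] \<or> rev hs = [] \<or> last (rev gs) \<noteq> last (rev hs)"
    using \<open>gs = [] \<or> hs = [] \<or> hd gs \<noteq> hd hs\<close> by (auto simp: last_rev)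
  ultimately show thesis by (rule that)
qed

lemma reduced_word_append_winv:
  assumes "reduced_word g" "reduced_word h" "g = [] \<or> h = [] \<or> last g \<noteq> last h"
  shows "reduced_word (g @ winv h)"
  using assms by (auto simp: reduced_word_append hd_winv)

lemma reduced_word_winv_append:
  assumes "reduced_word g" "reduced_word h" "g = [] \<or> h = [] \<or> hd g \<noteq> hd h"
  shows "reduced_word (winv g @ h)"
  using assms by (auto simp: reduced_word_append last_winv)

section \<open>Colourings along words\<close>

locale word_action =
  fixes \<Lambda> :: "'a set" and T :: "'a \<times> bool \<Rightarrow> 'p \<Rightarrow> 'p"
  assumes finite_letters: "finite \<Lambda>" and T_linv: "\<And>l x. T (linv l) (T l x) = x"
begin

definition words :: "('a \<times> bool) list set" where
  "words = {w. reduced_word w \<and> fst ` set w \<subseteq> \<Lambda>}"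

text \<open>The last letter acts first, so the suffixes of \<open>w\<close> name the points passed
  on the way from \<open>x\<close> to \<open>act w x\<close>, and the words form a tree under
  \<open>suffix\<close> with root \<open>[]\<close>.\<close>

definition act :: "('a \<times> bool) list \<Rightarrow> 'p \<Rightarrow> 'p" where
  "act w x = foldr T w x"

lemma act_simps [simp]: "act [] x = x" "act (l # w) x = T l (act w x)"
  "act (v @ w) x = act v (act w x)"
  by (simp_all add: act_def)

lemma T_linv' [simp]: "T (linv l) (T l x) = x" "T l (T (linv l) x) = x"
  using T_linv[of l] T_linv[of "linv l"] by simp_all

lemma act_winv [simp]: "act (winv w) (act w x) = x"
  by (induction w arbitrary: x) simp_all

lemma act_winv' [simp]: "act w (act (winv w) x) = x"
  using act_winv[of "winv w"] by simp

lemma T_inj [simp]: "T l x = T l y \<longleftrightarrow> x = y"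
  by (metis T_linv)

lemma act_inj [simp]: "act w x = act w y \<longleftrightarrow> x = y"
  by (metis act_winv)

lemma words_Nil [simp]: "[] \<in> words"
  by (simp add: words_def)

lemma words_ConsD: "l # w \<in> words \<Longrightarrow> w \<in> words"
  by (auto simp: words_def reduced_word_Cons)

lemma words_ConsD': "l # w \<in> words \<Longrightarrow> fst l \<in> \<Lambda>"
  by (auto simp: words_def)

lemma words_appendD: "v @ w \<in> words \<Longrightarrow> v \<in> words" "v @ w \<in> words \<Longrightarrow> w \<in> words"
  by (auto simp: words_def reduced_word_append)

lemma words_winv [simp]: "winv w \<in> words \<longleftrightarrow> w \<in> words"
  by (simp add: words_def)

lemma words_single [simp]: "[l] \<in> words \<longleftrightarrow> fst l \<in> \<Lambda>"
  by (simp add: words_def)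

lemma words_appendI:
  "v \<in> words \<Longrightarrow> w \<in> words \<Longrightarrow> v = [] \<or> w = [] \<or> hd w \<noteq> linv (last v) \<Longrightarrow> v @ w \<in> words"
  by (auto simp: words_def reduced_word_append)

lemma words_ConsI: "fst l \<in> \<Lambda> \<Longrightarrow> w \<in> words \<Longrightarrow> w = [] \<or> hd w \<noteq> linv l \<Longrightarrow> l # w \<in> words"
  by (auto simp: words_def reduced_word_Cons)

lemma words_suffix: "w \<in> words \<Longrightarrow> suffix p w \<Longrightarrow> p \<in> words"
  by (metis suffix_def words_appendD(2))

lemma finite_words_le: "finite {w \<in> words. length w \<le> n}"
proof (rule finite_subset)
  show "{w \<in> words. length w \<le> n} \<subseteq> {w. set w \<subseteq> \<Lambda> \<times> UNIV \<and> length w \<le> n}"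
    by (force simp: words_def)
  show "finite {w. set w \<subseteq> \<Lambda> \<times> (UNIV :: bool set) \<and> length w \<le> n}"
    by (rule finite_lists_length_le) (simp add: finite_letters)
qed

lemma reduce_act:
  assumes "fst ` set w \<subseteq> \<Lambda>"
  obtains v where "v \<in> words" "\<And>x. act v x = act w x" "length v \<le> length w"
    "v = w \<or> length v < length w"
  by (rule reduce_word[of \<Lambda> "act" w]) (use assms in \<open>auto simp: words_def fun_eq_iff\<close>)

text \<open>The orbit graph, with letters as edges, gives the distance in question.\<close>

definition near :: "nat \<Rightarrow> 'p \<Rightarrow> 'p \<Rightarrow> bool" where
  "near n x y \<longleftrightarrow> (\<exists>w\<in>words. length w \<le> n \<and> y = act w x)"

lemma nearI: "w \<in> words \<Longrightarrow> length w \<le> n \<Longrightarrow> near n x (act w x)"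
  by (auto simp: near_def)

lemma near_refl [simp]: "near n x x"
  using nearI[of "[]" n x] by simp

lemma near_sym: "near n x y \<Longrightarrow> near n y x"
  unfolding near_def by (metis act_winv words_winv winv_simps(4))

lemma near_mono: "near m x y \<Longrightarrow> m \<le> n \<Longrightarrow> near n x y"
  unfolding near_def by (meson order_trans)

lemma near_trans:
  assumes "near m x y" "near n y z"
  shows "near (m + n) x z"
proof -
  obtain v w where vw: "v \<in> words" "w \<in> words" "length v \<le> m" "length w \<le> n"
    and "y = act v x" "z = act w y"
    using assms by (auto simp: near_def)
  from vw have "fst ` set (w @ v) \<subseteq> \<Lambda>" by (auto simp: words_def)
  then obtain u where "u \<in> words" "\<And>x. act u x = act (w @ v) x" "length u \<le> length (w @ v)"
    using reduce_act[of "w @ v"] by blast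
  then have "z = act u x" "length u \<le> m + n"
    using vw \<open>y = act v x\<close> \<open>z = act w y\<close> by simp_all
  then show ?thesis using \<open>u \<in> words\<close> by (auto simp: near_def)
qed

definition free_points :: "'p set" where
  "free_points = {x. \<forall>w\<in>words. act w x = x \<longrightarrow> w = []}"

text \<open>Cancelling the common prefix leaves a reduced closed word at \<open>x\<close>. The
  length bound is for points about which only short closed words are excluded.\<close>

lemma act_same:
  assumes "v \<in> words" "w \<in> words" "act v x = act w x"
  shows "v = w \<or> (\<exists>g\<in>words. g \<noteq> [] \<and> act g x = x \<and> length g \<le> length v + length w)"
proof -
  obtain p v' w' where "v = p @ v'" "w = p @ w'" and *: "v' = [] \<or> w' = [] \<or> hd v' \<noteq> hd w'"
    by (metis list.sel(1) longest_common_prefix neq_Nil_conv)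
  then have "act v' x = act w' x" using assms by simp
  moreover have "winv v' @ w' \<in> words"
    using * reduced_word_winv_append[of v' w'] assms \<open>v = p @ v'\<close> \<open>w = p @ w'\<close>
    by (auto simp: words_def reduced_word_append image_Un)
  ultimately show ?thesis
    using \<open>v = p @ v'\<close> \<open>w = p @ w'\<close> \<open>act v' x = act w' x\<close>[symmetric]
    by (cases "winv v' @ w' = []") (simp, intro disjI2 bexI[of _ "winv v' @ w'"], simp_all)
qed

lemma act_inj_word:
  assumes "x \<in> free_points" "v \<in> words" "w \<in> words" "act v x = act w x"
  shows "v = w"
  using act_same[OF assms(2-4)] assms(1) by (auto simp: free_points_def)

lemma T_free_points:
  assumes "x \<in> free_points" "fst l \<in> \<Lambda>"
  shows "T l x \<in> free_points"
  unfolding free_points_def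
proof (intro CollectI ballI impI)
  fix w assume w: "w \<in> words" "act w (T l x) = T l x"
  have "fst ` set (linv l # w @ [l]) \<subseteq> \<Lambda>"
    using w(1) assms(2) by (auto simp: words_def)
  then obtain v where v: "v \<in> words" "\<And>x. act v x = act (linv l # w @ [l]) x"
    using reduce_act by blast
  have "act v x = x" using w by (simp add: v)
  then have "v = []" using assms v by (simp add: free_points_def)
  \<comment> \<open>The conjugate of \<open>w\<close> may fail to be reduced, so its reduced form
    \<open>v = []\<close> does not show directly that \<open>w\<close> is empty. It shows that
    \<open>w\<close> acts as the identity everywhere, in particular at \<open>x\<close>.\<close>
  then have "act w y = y" for y
    using v(2)[of "T (linv l) y"] by (simp add: v)
  then show "w = []" using assms w by (simp add: free_points_def)
qed

end

locale colouring_action = word_action \<Lambda> T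
  for \<Lambda> :: "'a set" and T :: "'a \<times> bool \<Rightarrow> 'p \<Rightarrow> 'p" +
  fixes I :: "'c set" and E :: "'a \<times> bool \<Rightarrow> 'c \<Rightarrow> 'c \<Rightarrow> bool" and N :: nat
  assumes E_linv: "\<And>l a b. E (linv l) b a \<longleftrightarrow> E l a b"
    and E_total: "\<And>l a. fst l \<in> \<Lambda> \<Longrightarrow> a \<in> I \<Longrightarrow> \<exists>b\<in>I. E l a b"
    and I_nonempty: "I \<noteq> {}" and N_pos: "N \<ge> 1"
begin

primrec joins :: "('a \<times> bool) list \<Rightarrow> 'c \<Rightarrow> 'c \<Rightarrow> bool" where
  "joins [] a b \<longleftrightarrow> a = b"
| "joins (l # w) a b \<longleftrightarrow> (\<exists>e\<in>I. joins w a e \<and> E l e b)"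

lemma joins_append:
  "a \<in> I \<Longrightarrow> joins (v @ w) a b \<longleftrightarrow> (\<exists>e\<in>I. joins w a e \<and> joins v e b)" if "b \<in> I"
  using that by (induction v arbitrary: b) auto

lemma joins_snoc:
  "a \<in> I \<Longrightarrow> b \<in> I \<Longrightarrow> joins (v @ [l]) a b \<longleftrightarrow> (\<exists>e\<in>I. E l a e \<and> joins v e b)"
  by (subst joins_append) auto

lemma joins_total_back:
  assumes "fst ` set w \<subseteq> \<Lambda>" "b \<in> I"
  shows "\<exists>a\<in>I. joins w a b"
  using assms
proof (induction w arbitrary: b)
  case (Cons l w)
  then obtain e where "e \<in> I" "E (linv l) b e" using E_total[of "linv l" b] by auto
  moreover obtain a where "a \<in> I" "joins w a e" using Cons.IH[of e] Cons.prems \<open>e \<in> I\<close> by auto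
  ultimately show ?case by (auto simp: E_linv)
qed auto

text \<open>From distance \<open>N\<close> on, the colours at the two ends of a reduced path are
  independent.\<close>

definition mixing :: bool where
  "mixing \<longleftrightarrow> (\<forall>w\<in>words. N \<le> length w \<longrightarrow> (\<forall>a\<in>I. \<forall>b\<in>I. joins w a b))"

definition valid_colouring :: "('p \<Rightarrow> 'c option) \<Rightarrow> 'p set \<Rightarrow> bool" where
  "valid_colouring u X \<longleftrightarrow> (\<forall>x\<in>X. \<forall>a. u x = Some a \<longrightarrow> a \<in> I \<and>
     (\<forall>l b. fst l \<in> \<Lambda> \<longrightarrow> u (T l x) = Some b \<longrightarrow> E l a b))"

text \<open>If the coloured set is locally convex, an uncoloured point sees coloured points within distance
  \<open>N\<close> in at most one direction, so an extension never meets two nearby constraints.\<close>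

definition loc_convex :: "'p set \<Rightarrow> 'p set \<Rightarrow> bool" where
  "loc_convex S X \<longleftrightarrow> (\<forall>x\<in>X \<inter> S. \<forall>g\<in>words. length g \<le> 2 * N \<longrightarrow> act g x \<in> S \<longrightarrow>
     (\<forall>p. suffix p g \<longrightarrow> act p x \<in> S))"

text \<open>Colours are chosen outwards from the root of the tree of words. A new colour has to keep
  one promise only: the next coloured point ahead, if within \<open>N\<close> steps, must remain
  reachable. When that point first comes within \<open>N\<close> steps, it is \<open>N + 1\<close>
  steps from the previous vertex, and mixing makes the promise possible whatever the previous colour
  was.\<close>

lemma extend_colouring:
  assumes mixing and valid: "valid_colouring u X" and convex: "loc_convex (dom u) X"
    and X: "\<And>x l. x \<in> X \<Longrightarrow> fst l \<in> \<Lambda> \<Longrightarrow> T l x \<in> X" and y: "y \<in> X"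
  obtains c where "\<And>w. w \<in> words \<Longrightarrow> c w \<in> I"
    "\<And>w a. w \<in> words \<Longrightarrow> u (act w y) = Some a \<Longrightarrow> c w = a"
    "\<And>l w. l # w \<in> words \<Longrightarrow> E l (c w) (c (l # w))"
proof -
  have actX: "act w y \<in> X" if "w \<in> words" for w
    using that
  proof (induction w)
    case (Cons l w)
    then show ?case using X words_ConsD[of l w] words_ConsD'[of l w] by simp
  qed (simp add: y)
  have convexD: "act (p @ w) y \<in> dom u"
    if "w \<in> words" "g \<in> words" "length g \<le> 2 * N" "act w y \<in> dom u" "act (g @ w) y \<in> dom u"
      "suffix p g" for w g p
    using convex that actX[of w] unfolding loc_convex_def by simp
  \<comment> \<open>\<open>g\<close> leads away from the root to the first coloured point
    ahead.\<close>
  define hit where "hit w g \<longleftrightarrow> g \<noteq> [] \<and> g @ w \<in> words \<and> length g \<le> N \<and> act (g @ w) y \<in> dom u \<and>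
      (\<forall>p. suffix p g \<longrightarrow> p \<noteq> [] \<longrightarrow> p \<noteq> g \<longrightarrow> act (p @ w) y \<notin> dom u)" for w g
  \<comment> \<open>Two such routes share \<open>q\<close> and then part. The path between their
    ends has at most \<open>2 * N\<close> letters, so convexity colours the parting point, although
    neither route may meet a coloured point before its end.\<close>
  have hit_unique: "g = h" if "hit w g" "hit w h" "act w y \<notin> dom u" for w g h
  proof -
    obtain g' h' q where g: "g = g' @ q" and h: "h = h' @ q"
      and *: "g' = [] \<or> h' = [] \<or> last g' \<noteq> last h'"
      by (rule common_suffix)
    show "g = h"
    proof (cases "g' = [] \<or> h' = []")
      case True
      then show ?thesis using that unfolding hit_def g h by (auto simp: suffix_def)
    next
      case False
      have w: "g' @ q @ w \<in> words" "h' @ q @ w \<in> words" using that by (auto simp: hit_def g h)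
      then have red: "g' \<in> words" "h' \<in> words" "q @ w \<in> words" "h' @ q @ w \<in> words"
        by (auto dest: words_appendD)
      then have "g' @ winv h' \<in> words"
        using * reduced_word_append_winv[of g' h'] by (auto simp: words_def image_Un)
      moreover have "length (g' @ winv h') \<le> 2 * N"
        using that by (auto simp: hit_def g h)
      moreover have "act (h' @ q @ w) y \<in> dom u" "act ((g' @ winv h') @ h' @ q @ w) y \<in> dom u"
        using that by (auto simp: hit_def g h)
      ultimately have "act (winv h' @ h' @ q @ w) y \<in> dom u"
        using convexD[of "h' @ q @ w" "g' @ winv h'" "winv h'"] red by (auto simp: suffix_def)
      then have "act (q @ w) y \<in> dom u" by simp
      then have "q \<noteq> []" using that by auto
      then show ?thesis using \<open>act (q @ w) y \<in> dom u\<close> that False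
        unfolding hit_def g h by (auto simp: suffix_def)
    qed
  qed
  define safe where "safe w a \<longleftrightarrow> a \<in> I \<and> (act w y \<in> dom u \<longrightarrow> u (act w y) = Some a) \<and>
      (act w y \<notin> dom u \<longrightarrow> (\<forall>g. hit w g \<longrightarrow> joins g a (the (u (act (g @ w) y)))))" for w a
  have inI: "the (u (act w y)) \<in> I" if "w \<in> words" "act w y \<in> dom u" for w
    using valid that actX[of w] unfolding valid_colouring_def by auto
  have root: "\<exists>a. safe [] a"
  proof (cases "act [] y \<in> dom u")
    case True
    then show ?thesis using inI[of "[]"] by (auto simp: safe_def)
  next
    case False
    show ?thesis
    proof (cases "\<exists>g. hit [] g")
      case True
      then obtain g where g: "hit [] g" by blast
      then have "the (u (act g y)) \<in> I" "fst ` set g \<subseteq> \<Lambda>"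
        using inI[of g] by (auto simp: hit_def words_def)
      then obtain a where "a \<in> I" "joins g a (the (u (act g y)))"
        using joins_total_back by blast
      moreover have "h = g" if "hit [] h" for h
        using hit_unique that g False by blast
      ultimately show ?thesis using False by (auto simp: safe_def)
    next
      case no_hit: False
      then show ?thesis using False I_nonempty by (auto simp: safe_def)
    qed
  qed
  have step: "\<exists>b. E l a b \<and> safe (l # w) b" if a: "safe w a" and lw: "l # w \<in> words" for l w a
  proof -
    have w: "w \<in> words" and l: "fst l \<in> \<Lambda>" using lw by (auto dest: words_ConsD words_ConsD')
    have aI: "a \<in> I" using a by (simp add: safe_def)
    then obtain b0 where b0: "b0 \<in> I" "E l a b0" using E_total l by blast
    show ?thesis
    proof (cases "act (l # w) y \<in> dom u")
      case True
      define b where "b = the (u (act (l # w) y))"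
      have b: "b \<in> I" "u (T l (act w y)) = Some b" using True inI[OF lw True] by (auto simp: b_def)
      have "E l a b"
      proof (cases "act w y \<in> dom u")
        case True
        then show ?thesis
          using a valid actX[OF w] b l unfolding safe_def valid_colouring_def by blast
      next
        case False
        then have "hit w [l]"
          using b N_pos lw by (auto simp: hit_def suffix_Cons)
        then have "joins [l] a b" using a False by (auto simp: safe_def b_def)
        then show ?thesis by auto
      qed
      then show ?thesis using b by (auto simp: safe_def)
    next
      case outside: False
      show ?thesis
      proof (cases "\<exists>g. hit (l # w) g")
        case True
        then obtain g where g: "hit (l # w) g" by blast
        then have gw: "(g @ [l]) @ w \<in> words" "act ((g @ [l]) @ w) y \<in> dom u" and len: "length g \<le> N"
          by (auto simp: hit_def)
        define d where "d = the (u (act (g @ l # w) y))"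
        have d: "d \<in> I" using g inI[of "g @ l # w"] by (auto simp: hit_def d_def)
        \<comment> \<open>Otherwise the path from \<open>act w y\<close> to the hit, of length at
          most \<open>N + 1 \<le> 2 * N\<close> by \<open>N_pos\<close>, would force the uncoloured
          vertex \<open>l # w\<close> to be coloured.\<close>
        have "act w y \<notin> dom u"
        proof
          assume "act w y \<in> dom u"
          moreover have "g @ [l] \<in> words" using gw words_appendD by blast
          ultimately have "act ([l] @ w) y \<in> dom u"
            using convexD[of w "g @ [l]" "[l]"] w gw len N_pos by (auto simp: suffix_def)
          then show False using outside by simp
        qed
        have "joins (g @ [l]) a d"
        proof (cases "length g < N")
          case True
          have "act (p @ w) y \<notin> dom u" if p: "suffix p (g @ [l])" "p \<noteq> []" "p \<noteq> g @ [l]" for p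
          proof -
            obtain p' where p': "p = p' @ [l]" "suffix p' g"
              using p(1,2) by (auto simp: suffix_snoc)
            then show ?thesis using g outside p(3) by (cases "p' = []") (auto simp: hit_def)
          qed
          then have "hit w (g @ [l])"
            using True gw by (auto simp: hit_def)
          then show ?thesis using a \<open>act w y \<notin> dom u\<close> by (auto simp: safe_def d_def)
        next
          case False
          then show ?thesis
            using \<open>mixing\<close> aI d gw words_appendD(1)[of "g @ [l]" w] by (auto simp: mixing_def)
        qed
        then obtain b where b: "b \<in> I" "E l a b" "joins g b d" using joins_snoc aI d by blast
        moreover have "h = g" if "hit (l # w) h" for h
          using hit_unique that g outside by blast
        ultimately have "safe (l # w) b"
          using outside by (auto simp: safe_def d_def)
        then show ?thesis using b by blast
      next
        case False
        then show ?thesis using b0 outside by (auto simp: safe_def)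
      qed
    qed
  qed
  define c where "c = rec_list (SOME a. safe [] a) (\<lambda>l w a. SOME b. E l a b \<and> safe (l # w) b)"
  have c_simps: "c [] = (SOME a. safe [] a)" "c (l # w) = (SOME b. E l (c w) b \<and> safe (l # w) b)" for l w
    by (simp_all add: c_def)
  have safe_c: "safe w (c w)" if "w \<in> words" for w
    using that
  proof (induction w)
    case Nil
    then show ?case using someI_ex[OF root] by (simp add: c_simps)
  next
    case (Cons l w)
    then show ?case using someI_ex[OF step[of w "c w" l]] words_ConsD by (simp add: c_simps)
  qed
  have "c w \<in> I" if "w \<in> words" for w
    using safe_c[OF that] by (simp add: safe_def)
  moreover have "c w = a" if "w \<in> words" "u (act w y) = Some a" for w a
    using safe_c[OF that(1)] that(2) by (auto simp: safe_def)
  moreover have "E l (c w) (c (l # w))" if "l # w \<in> words" for l w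
    using someI_ex[OF step[OF safe_c[OF words_ConsD[OF that]] that]] by (simp add: c_simps)
  ultimately show thesis by (rule that)
qed

end

section \<open>Adding one sparse family of finite subtrees to a partial colouring\<close>

context colouring_action
begin

text \<open>The threshold \<open>4 * N\<close> reproduces itself: a point on a path between linked
  points is within \<open>2 * N\<close> of an end, and a coloured point within \<open>2 * N\<close>
  of it is then linked to that end.\<close>

definition link :: "'p set \<Rightarrow> 'p \<Rightarrow> 'p \<Rightarrow> bool" where
  "link S x z \<longleftrightarrow> x \<in> S \<and> z \<in> S \<and> near (4 * N) x z"

text \<open>A uniform bound on the clusters of coloured points. It keeps the subtree of
  \<open>cluster_tree\<close> finite, and \<open>colouring_step\<close> restores it with a larger
  radius.\<close>

definition bounded_chains :: "'p set \<Rightarrow> 'p set \<Rightarrow> nat \<Rightarrow> bool" where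
  "bounded_chains S X R \<longleftrightarrow> (\<forall>x\<in>X \<inter> S. \<forall>z. (link S)\<^sup>*\<^sup>* x z \<longrightarrow> near R x z)"

lemma link_sym: "link S x z \<Longrightarrow> link S z x"
  by (auto simp: link_def near_sym)

lemma link_rtranclp_sym: "(link S)\<^sup>*\<^sup>* x z \<Longrightarrow> (link S)\<^sup>*\<^sup>* z x"
  by (metis link_sym sympD sympI symp_rtranclp)

lemma link_rtranclp_in: "(link S)\<^sup>*\<^sup>* x z \<Longrightarrow> x \<in> S \<Longrightarrow> z \<in> S"
  by (induction rule: rtranclp_induct) (auto simp: link_def)

text \<open>The finite subtree \<open>\<Gamma>\<close> spans \<open>y\<close> and all coloured points that can be reached from \<open>y\<close> by
  jumps of length at most \<open>4 N\<close>; each of its points is within \<open>2 N\<close> of one of those.\<close>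

lemma cluster_tree:
  assumes mixing and XF: "X \<subseteq> free_points" and X: "\<And>x l. x \<in> X \<Longrightarrow> fst l \<in> \<Lambda> \<Longrightarrow> T l x \<in> X"
    and valid: "valid_colouring u X" and convex: "loc_convex (dom u) X"
    and bounded: "bounded_chains (dom u) X R" and y: "y \<in> X"
  obtains \<Gamma> c where "\<Gamma> \<subseteq> words" "[] \<in> \<Gamma>" "\<And>w p. w \<in> \<Gamma> \<Longrightarrow> suffix p w \<Longrightarrow> p \<in> \<Gamma>"
    "\<And>w. w \<in> \<Gamma> \<Longrightarrow> length w \<le> R + 4 * N"
    "\<And>w v. w \<in> \<Gamma> \<Longrightarrow> v \<in> words \<Longrightarrow> u (act v y) \<noteq> None \<Longrightarrow> near (2 * N) (act w y) (act v y) \<Longrightarrow> v \<in> \<Gamma>"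
    "\<And>w. w \<in> \<Gamma> \<Longrightarrow> c w \<in> I" "\<And>w a. w \<in> \<Gamma> \<Longrightarrow> u (act w y) = Some a \<Longrightarrow> c w = a"
    "\<And>l w. l # w \<in> \<Gamma> \<Longrightarrow> E l (c w) (c (l # w))"
proof -
  define Q where "Q = {q \<in> words. q = [] \<or>
    (\<exists>s. near (4 * N) y s \<and> s \<in> dom u \<and> (link (dom u))\<^sup>*\<^sup>* s (act q y))}"
  define \<Gamma> where "\<Gamma> = {w. \<exists>q\<in>Q. suffix w q}"
  obtain c where c: "\<And>w. w \<in> words \<Longrightarrow> c w \<in> I"
    "\<And>w a. w \<in> words \<Longrightarrow> u (act w y) = Some a \<Longrightarrow> c w = a"
    "\<And>l w. l # w \<in> words \<Longrightarrow> E l (c w) (c (l # w))"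
    using extend_colouring[OF \<open>mixing\<close> valid convex X y] by metis
  have yF: "y \<in> free_points" using XF y by blast
  have nearX: "z \<in> X" if "near n x z" "x \<in> X" for n x z
  proof -
    have "act w x \<in> X" if "fst ` set w \<subseteq> \<Lambda>" for w
      using that by (induction w) (use X \<open>x \<in> X\<close> in auto)
    then show ?thesis using that by (auto simp: near_def words_def)
  qed
  have \<Gamma>words: "\<Gamma> \<subseteq> words"
    by (auto simp: \<Gamma>_def Q_def intro: words_suffix)
  have cover: "\<exists>q\<in>Q. near (2 * N) (act w y) (act q y)" if "w \<in> \<Gamma>" for w
  proof -
    \<comment> \<open>Either \<open>w\<close> lies already on the way to \<open>q\<close>, or it
      lies on the path of length at most \<open>4 * N\<close> from \<open>q\<close> to
      \<open>q'\<close>, hence within \<open>2 * N\<close> of one of its ends.\<close>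
    have near_step: "\<exists>q\<in>Q. near (2 * N) (act w y) (act q y)"
      if st: "near (4 * N) (act q y) (act q' y)" "q \<in> Q" "q' \<in> Q" "suffix w q'"
        "\<And>p. suffix p q \<Longrightarrow> \<exists>q\<in>Q. near (2 * N) (act p y) (act q y)" for q q' w
    proof -
      obtain g where g: "g \<in> words" "length g \<le> 4 * N" "act q' y = act g (act q y)"
        using st(1) by (auto simp: near_def)
      moreover have q: "q \<in> words" "q' \<in> words" using st by (auto simp: Q_def)
      ultimately obtain g1 r q1 where d: "g = g1 @ winv r" "q = r @ q1" "reduced_word (g1 @ q1)"
        by (metis (no_types, lifting) cancel_words mem_Collect_eq words_def)
      then have "g1 @ q1 \<in> words" using g q by (auto simp: words_def)
      then have q': "q' = g1 @ q1"
        using g q yF act_inj_word d by simp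
      show ?thesis
      proof (cases "suffix w q1")
        case True
        then show ?thesis using st(5)[of w] d(2) by (meson suffix_appendI)
      next
        case False
        then obtain g2 where "w = g2 @ q1" "suffix g2 g1"
          using \<open>suffix w q'\<close> unfolding q' suffix_append by blast
        then obtain g3 where w: "w = g2 @ q1" "g1 = g3 @ g2"
          by (auto simp: suffix_def)
        have "act w y = act (g2 @ winv r) (act q y)" by (simp add: w d(2))
        moreover have gr: "g2 @ winv r \<in> words" "g3 \<in> words"
          using g(1) unfolding d w by (auto intro: words_appendD)
        ultimately have 1: "near (length (g2 @ winv r)) (act q y) (act w y)"
          using nearI[OF gr(1) order_refl, of "act q y"] by (simp only:)
        have 2: "near (length g3) (act w y) (act q' y)"
          using nearI[OF gr(2), of "length g3" "act w y"] by (simp add: q' w)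
        have "length (g2 @ winv r) \<le> 2 * N \<or> length g3 \<le> 2 * N"
          using g(2) by (auto simp: d w)
        then show ?thesis using 1 2 near_sym near_mono st(2,3) by blast
      qed
    qed
    have all: "\<exists>q\<in>Q. near (2 * N) (act w y) (act q y)"
      if "(link (dom u))\<^sup>*\<^sup>* s z" "near (4 * N) y s" "s \<in> dom u" "q \<in> words" "z = act q y" "suffix w q"
      for s z q w
      using that
    proof (induction z arbitrary: q w rule: rtranclp_induct)
      case base
      show ?case
      proof (rule near_step[of "[]" q w])
        show nil: "[] \<in> Q" by (simp add: Q_def)
        show "q \<in> Q" using base by (auto simp: Q_def)
        show "\<exists>q\<in>Q. near (2 * N) (act p y) (act q y)" if "suffix p []" for p
          using that nil by (intro bexI[of _ "[]"]) auto
      qed (use base in auto)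
    next
      case (step z' z)
      obtain v where v: "v \<in> words" "z' = act v y"
      proof -
        have "s \<in> X \<inter> dom u" using step.prems nearX y by auto
        then have "near R s z'" using bounded step.hyps by (auto simp: bounded_chains_def)
        then have "near (4 * N + R) y z'" using near_trans step.prems by blast
        then show thesis using that by (auto simp: near_def)
      qed
      show ?case
      proof (rule near_step[of v q w])
        show "near (4 * N) (act v y) (act q y)" using step v by (auto simp: link_def)
        show "v \<in> Q" using v step by (auto simp: Q_def)
        show "q \<in> Q" using step.prems rtranclp.rtrancl_into_rtrancl[OF step.hyps]
          by (auto simp: Q_def)
        show "\<exists>q\<in>Q. near (2 * N) (act p y) (act q y)" if "suffix p v" for p
          using step.IH that v step.prems by blast
      qed (rule step.prems)
    qed
    obtain q where q: "q \<in> Q" "suffix w q" using \<open>w \<in> \<Gamma>\<close> by (auto simp: \<Gamma>_def)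
    show ?thesis
    proof (cases "q = []")
      case True
      then show ?thesis using q by (auto intro!: bexI[of _ "[]"])
    next
      case False
      then obtain s where "near (4 * N) y s" "s \<in> dom u" "(link (dom u))\<^sup>*\<^sup>* s (act q y)"
        using q by (auto simp: Q_def)
      moreover have "q \<in> words" using q by (simp add: Q_def)
      ultimately show ?thesis using all q(2) by blast
    qed
  qed
  show thesis
  proof (rule that[of \<Gamma> c])
    have "[] \<in> Q" by (simp add: Q_def)
    then show "[] \<in> \<Gamma>" by (auto simp: \<Gamma>_def)
    show "p \<in> \<Gamma>" if "w \<in> \<Gamma>" "suffix p w" for w p
      using that suffix_order.order_trans by (auto simp: \<Gamma>_def)
    show "length w \<le> R + 4 * N" if "w \<in> \<Gamma>" for w
    proof -
      obtain q where q: "q \<in> Q" "suffix w q" using \<open>w \<in> \<Gamma>\<close> by (auto simp: \<Gamma>_def)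
      have "length q \<le> R + 4 * N"
      proof (cases "q = []")
        case False
        then obtain s where s: "near (4 * N) y s" "s \<in> dom u" "(link (dom u))\<^sup>*\<^sup>* s (act q y)"
          using q by (auto simp: Q_def)
        then have "near R s (act q y)"
          using bounded nearX y by (auto simp: bounded_chains_def)
        then obtain v where "v \<in> words" "length v \<le> 4 * N + R" "act q y = act v y"
          using near_trans[OF s(1)] by (auto simp: near_def)
        moreover have "q \<in> words" using q by (simp add: Q_def)
        ultimately show ?thesis using act_inj_word[OF yF, of q v] by simp
      qed simp
      then show ?thesis using suffix_length_le[OF q(2)] by simp
    qed
    show "v \<in> \<Gamma>" if "w \<in> \<Gamma>" "v \<in> words" "u (act v y) \<noteq> None" "near (2 * N) (act w y) (act v y)" for w v
    proof -
      obtain q where q: "q \<in> Q" "near (2 * N) (act w y) (act q y)" using cover \<open>w \<in> \<Gamma>\<close> by blast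
      then have near: "near (4 * N) (act q y) (act v y)"
        using near_trans[OF near_sym[OF q(2)] \<open>near (2 * N) (act w y) (act v y)\<close>] by simp
      have "v \<in> Q"
      proof (cases "q = []")
        case True
        then show ?thesis using that near by (auto simp: Q_def)
      next
        case False
        then obtain s where s: "near (4 * N) y s" "s \<in> dom u" "(link (dom u))\<^sup>*\<^sup>* s (act q y)"
          using q by (auto simp: Q_def)
        then have "link (dom u) (act q y) (act v y)"
          using that near link_rtranclp_in[OF s(3,2)] by (auto simp: link_def)
        then have "(link (dom u))\<^sup>*\<^sup>* s (act v y)" using s by simp
        then show ?thesis using s that by (auto simp: Q_def)
      qed
      then show ?thesis by (auto simp: \<Gamma>_def)
    qed
    show "c w \<in> I" if "w \<in> \<Gamma>" for w using c(1) that \<Gamma>words by blast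
    show "c w = a" if "w \<in> \<Gamma>" "u (act w y) = Some a" for w a using c(2) that \<Gamma>words by blast
    show "E l (c w) (c (l # w))" if "l # w \<in> \<Gamma>" for l w using c(3) that \<Gamma>words by blast
  qed (rule \<Gamma>words)
qed

text \<open>The pattern \<open>c\<close> found at the single point \<open>y\<close> is copied to all
  points of \<open>B\<close> at once; with an open \<open>B\<close> this colours open sets. It
  suffices that the points of \<open>B\<close> see the same colours as \<open>y\<close> up to
  distance \<open>D\<close> and that \<open>B\<close> is sparse: no nonempty word of length at most
  \<open>D\<close> fixes a point of \<open>B\<close> or leads from one to another.\<close>

lemma colouring_step:
  assumes mixing and XF: "X \<subseteq> free_points" and X: "\<And>x l. x \<in> X \<Longrightarrow> fst l \<in> \<Lambda> \<Longrightarrow> T l x \<in> X"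
    and valid: "valid_colouring u X" and convex: "loc_convex (dom u) X"
    and bounded: "bounded_chains (dom u) X R" and y: "y \<in> X"
  obtains \<Gamma> c D R' where "finite \<Gamma>" "\<Gamma> \<subseteq> words" "[] \<in> \<Gamma>"
    "\<And>B. \<lbrakk>\<And>b w. b \<in> B \<Longrightarrow> w \<in> words \<Longrightarrow> length w \<le> D \<Longrightarrow> u (act w b) = u (act w y);
       \<And>b w. b \<in> B \<Longrightarrow> w \<in> words \<Longrightarrow> length w \<le> D \<Longrightarrow> act w b \<in> B \<Longrightarrow> w = []\<rbrakk> \<Longrightarrow>
      \<exists>u'. (\<forall>b\<in>B. \<forall>w\<in>\<Gamma>. u' (act w b) = Some (c w)) \<and> (\<forall>x. x \<notin> (\<Union>w\<in>\<Gamma>. act w ` B) \<longrightarrow> u' x = u x) \<and>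
        u \<subseteq>\<^sub>m u' \<and> valid_colouring u' X \<and> loc_convex (dom u') X \<and> bounded_chains (dom u') X R'"
proof (rule cluster_tree[OF \<open>mixing\<close> XF _ valid convex bounded y])
  show "T l x \<in> X" if "x \<in> X" "fst l \<in> \<Lambda>" for x l using X that .
next
  fix \<Gamma> c assume \<Gamma>: "\<Gamma> \<subseteq> words" "[] \<in> \<Gamma>" "\<And>w p. w \<in> \<Gamma> \<Longrightarrow> suffix p w \<Longrightarrow> p \<in> \<Gamma>"
    and len: "\<And>w. w \<in> \<Gamma> \<Longrightarrow> length w \<le> R + 4 * N"
    and close: "\<And>w v. w \<in> \<Gamma> \<Longrightarrow> v \<in> words \<Longrightarrow> u (act v y) \<noteq> None \<Longrightarrow>
      near (2 * N) (act w y) (act v y) \<Longrightarrow> v \<in> \<Gamma>"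
    and c: "\<And>w. w \<in> \<Gamma> \<Longrightarrow> c w \<in> I" "\<And>w a. w \<in> \<Gamma> \<Longrightarrow> u (act w y) = Some a \<Longrightarrow> c w = a"
      "\<And>l w. l # w \<in> \<Gamma> \<Longrightarrow> E l (c w) (c (l # w))"
  \<comment> \<open>\<open>M = (R + 4 * N) + 4 * N + R\<close>: across a copy of \<Gamma>, one jump,
    and through an old cluster. So \<open>M\<close> bounds the distance from \<open>b\<close> to the
    points of the cluster created around it, and \<open>2 * M\<close> the distance between two of
    them.\<close>
  define M where "M = 2 * R + 8 * N"
  have fin: "finite \<Gamma>"
    by (rule finite_subset[OF _ finite_words_le[of "R + 4 * N"]]) (use \<Gamma>(1) len in auto)
  have step: "\<exists>u'. (\<forall>b\<in>B. \<forall>w\<in>\<Gamma>. u' (act w b) = Some (c w)) \<and> (\<forall>x. x \<notin> (\<Union>w\<in>\<Gamma>. act w ` B) \<longrightarrow> u' x = u x) \<and>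
        u \<subseteq>\<^sub>m u' \<and> valid_colouring u' X \<and> loc_convex (dom u') X \<and> bounded_chains (dom u') X (2 * M)"
    if pattern: "\<And>b w. b \<in> B \<Longrightarrow> w \<in> words \<Longrightarrow> length w \<le> 4 * M \<Longrightarrow> u (act w b) = u (act w y)"
      and disjoint: "\<And>b w. b \<in> B \<Longrightarrow> w \<in> words \<Longrightarrow> length w \<le> 4 * M \<Longrightarrow> act w b \<in> B \<Longrightarrow> w = []" for B
  proof -
    have nearB: "b = b'" if "b \<in> B" "b' \<in> B" "near n b b'" "n \<le> 4 * M" for b b' n
    proof -
      obtain w where "w \<in> words" "length w \<le> n" "b' = act w b"
        using \<open>near n b b'\<close> by (auto simp: near_def)
      then have "w = []" using disjoint[of b w] that by simp
      then show ?thesis using \<open>b' = act w b\<close> by simp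
    qed
    have word_eq: "v = w" if "b \<in> B" "act v b = act w b" "v \<in> words" "w \<in> words"
      "length v + length w \<le> 4 * M" for b v w
      using act_same[OF that(3,4,2)] disjoint[of b] that(1,5) by (metis order_trans)
    have near\<Gamma>: "near (R + 4 * N) b (act w b)" if "w \<in> \<Gamma>" for w b
      using that \<Gamma>(1) len nearI by blast
    have \<Gamma>eq: "b = b' \<and> v = w" if "b \<in> B" "b' \<in> B" "v \<in> \<Gamma>" "w \<in> \<Gamma>" "act v b = act w b'" for b b' v w
    proof -
      have "near ((R + 4 * N) + (R + 4 * N)) b b'"
        using near_trans[OF near\<Gamma>[OF that(3), of b]] near_sym[OF near\<Gamma>[OF that(4), of b']] that(5)
        by metis
      then have "b = b'" using nearB that by (auto simp: M_def)
      then show ?thesis using word_eq[of b v w] that \<Gamma>(1) len[of v] len[of w]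
        by (auto simp: M_def)
    qed
    define u' where "u' x = (if \<exists>b\<in>B. \<exists>w\<in>\<Gamma>. x = act w b
      then Some (c (SOME w. w \<in> \<Gamma> \<and> (\<exists>b\<in>B. x = act w b))) else u x)" for x
    have u'\<Gamma>: "u' (act w b) = Some (c w)" if "b \<in> B" "w \<in> \<Gamma>" for b w
    proof -
      have "(SOME v. v \<in> \<Gamma> \<and> (\<exists>b'\<in>B. act w b = act v b')) = w"
        by (rule some_equality) (use that \<Gamma>eq in blast)+
      then show ?thesis using that by (auto simp: u'_def)
    qed
    have u'u: "u' x = u x" if "x \<notin> (\<Union>w\<in>\<Gamma>. act w ` B)" for x
      using that by (auto simp: u'_def)
    have u\<Gamma>: "u (act w b) = Some a \<Longrightarrow> c w = a" if "b \<in> B" "w \<in> \<Gamma>" for b w a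
      using pattern[of b w] c(2)[of w] that \<Gamma>(1) len[of w] by (auto simp: M_def)
    have le: "u \<subseteq>\<^sub>m u'"
      unfolding map_le_def
    proof
      fix x assume "x \<in> dom u"
      then show "u x = u' x"
        using u\<Gamma> u'\<Gamma> u'u by (cases "x \<in> (\<Union>w\<in>\<Gamma>. act w ` B)") (auto 4 4)
    qed
    have close': "\<exists>v\<in>\<Gamma>. z = act v b"
      if "b \<in> B" "w \<in> \<Gamma>" "z \<in> dom u" "near (2 * N) (act w b) z" for b w z
    proof -
      obtain g where g: "g \<in> words" "length g \<le> 2 * N" "z = act g (act w b)"
        using \<open>near (2 * N) (act w b) z\<close> by (auto simp: near_def)
      then have "fst ` set (g @ w) \<subseteq> \<Lambda>" using that \<Gamma>(1) by (auto simp: words_def)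
      then obtain v where v: "v \<in> words" "\<And>x. act v x = act (g @ w) x" "length v \<le> length (g @ w)"
        using reduce_act by blast
      have "length v \<le> 4 * M" using v g len[OF that(2)] by (simp add: M_def)
      then have "u (act v y) = u (act v b)" using pattern[OF \<open>b \<in> B\<close> v(1)] by metis
      then have "u (act v y) \<noteq> None" using that g v(2)[of b] by auto
      moreover have "near (2 * N) (act w y) (act v y)"
        using v(2)[of y] g nearI by simp
      ultimately have "v \<in> \<Gamma>" using close that v by blast
      then show ?thesis using v(2)[of b] g by (metis act_simps(3))
    qed
    have cases: "z \<in> dom u \<or> (\<exists>b\<in>B. \<exists>w\<in>\<Gamma>. z = act w b)" if "z \<in> dom u'" for z
      using that u'u by (cases "z \<in> (\<Union>w\<in>\<Gamma>. act w ` B)") auto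
    have \<Gamma>dom: "act w b \<in> dom u'" if "b \<in> B" "w \<in> \<Gamma>" for b w
      using u'\<Gamma> that by auto
    \<comment> \<open>Nearby coloured points are never mixed: an old point close to a copy of
      \<Gamma> belongs to that copy, and different copies are too far apart. Validity and convexity
      thus have to be checked only inside one copy or inside the old set.\<close>
    have tree: "(\<exists>b\<in>B. \<exists>w\<in>\<Gamma>. \<exists>v\<in>\<Gamma>. x = act w b \<and> z = act v b) \<or> x \<in> dom u \<and> z \<in> dom u"
      if "x \<in> dom u'" "z \<in> dom u'" "near (2 * N) x z" for x z
      using cases[OF that(1)]
    proof (elim disjE bexE)
      fix b w assume b: "b \<in> B" "w \<in> \<Gamma>" "x = act w b"
      show ?thesis
        using cases[OF that(2)]
      proof (elim disjE bexE)
        assume "z \<in> dom u"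
        then show ?thesis using close' b that(3) by blast
      next
        fix b' v assume b': "b' \<in> B" "v \<in> \<Gamma>" "z = act v b'"
        have "near ((R + 4 * N) + 2 * N + (R + 4 * N)) b b'"
          using near_trans[OF near_trans[OF near\<Gamma>[OF b(2), of b]] near_sym[OF near\<Gamma>[OF b'(2), of b']]]
            that(3) b b' by blast
        then have "b = b'" using nearB b b' by (auto simp: M_def)
        then show ?thesis using b b' by blast
      qed
    next
      assume "x \<in> dom u"
      then show ?thesis
        using cases[OF that(2)] close' near_sym[OF that(3)] by blast
    qed
    have valid': "valid_colouring u' X"
      unfolding valid_colouring_def
    proof (intro ballI allI impI conjI)
      fix x a assume x: "x \<in> X" "u' x = Some a"
      then have cases_x: "x \<in> dom u \<or> (\<exists>b\<in>B. \<exists>w\<in>\<Gamma>. x = act w b)" using cases by blast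
      then show "a \<in> I"
        using x valid le c(1) u'\<Gamma> unfolding valid_colouring_def map_le_def
        by (metis domD option.sel)
      fix l b assume l: "fst l \<in> \<Lambda>" "u' (T l x) = Some b"
      have "near (2 * N) x (T l x)"
        using nearI[of "[l]" "2 * N" x] l N_pos by simp
      then consider b' w v where "b' \<in> B" "w \<in> \<Gamma>" "v \<in> \<Gamma>" "x = act w b'" "T l x = act v b'"
        | "x \<in> dom u" "T l x \<in> dom u"
        using tree[of x "T l x"] x l by blast
      then show "E l a b"
      proof cases
        case 1
        then have ab: "a = c w" "b = c v" using x l u'\<Gamma>[of b' w] u'\<Gamma>[of b' v] by auto
        show ?thesis
        proof (cases "w = [] \<or> hd w \<noteq> linv l")
          case True
          then have lw: "l # w \<in> words" using words_ConsI l \<Gamma>(1) 1 by blast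
          have "v = l # w"
            using 1 lw \<Gamma>(1) len[of v] len[of w] N_pos by (intro word_eq[of b']) (auto simp: M_def)
          then show ?thesis using c(3) 1 ab by blast
        next
          case False
          then obtain w' where w': "w = linv l # w'" by (cases w) auto
          then have "w' \<in> \<Gamma>" using \<Gamma>(3)[of w w'] 1 by (auto simp: suffix_Cons)
          have "v = w'"
            using 1 \<Gamma>(1) \<open>w' \<in> \<Gamma>\<close> len[of v] len[of w'] w' by (intro word_eq[of b']) (auto simp: M_def)
          then have "E (linv l) b a" using c(3) 1 ab w' by blast
          then show ?thesis by (simp add: E_linv)
        qed
      next
        case 2
        then have "u x = Some a" "u (T l x) = Some b"
          using le x l unfolding map_le_def by metis+
        then show ?thesis using valid x l unfolding valid_colouring_def by blast
      qed
    qed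
    have convex': "loc_convex (dom u') X"
      unfolding loc_convex_def
    proof (intro ballI allI impI)
      fix x g p assume x: "x \<in> X \<inter> dom u'" and g: "g \<in> words" "length g \<le> 2 * N" "act g x \<in> dom u'"
        and p: "suffix p g"
      have "near (2 * N) x (act g x)" using g nearI by blast
      then consider b w v where "b \<in> B" "w \<in> \<Gamma>" "v \<in> \<Gamma>" "x = act w b" "act g x = act v b"
        | "x \<in> dom u" "act g x \<in> dom u"
        using tree[of x "act g x"] x g by blast
      then show "act p x \<in> dom u'"
      proof cases
        case 1
        have "w \<in> words" using 1 \<Gamma>(1) by blast
        \<comment> \<open>The path from \<open>w\<close> to \<open>v\<close> goes back towards the
          root as far as \<open>w1\<close> and then out along \<open>v\<close>; as \<Gamma> is
          closed under suffixes, both parts stay in it.\<close>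
        then obtain g1 r w1 where d: "g = g1 @ winv r" "w = r @ w1" "reduced_word (g1 @ w1)"
          using g(1) by (metis (no_types, lifting) cancel_words mem_Collect_eq words_def)
        have gw: "g1 @ w1 \<in> words" using d g \<open>w \<in> words\<close> by (auto simp: words_def)
        have v: "v = g1 @ w1"
          using 1 \<Gamma>(1) gw len[of v] len[of w] g(2) d by (intro word_eq[of b]) (auto simp: M_def)
        show ?thesis
        proof (cases "suffix p (winv r)")
          case True
          then obtain s where "winv r = s @ p" by (auto simp: suffix_def)
          then have "r = winv p @ winv s" by (metis winv_simps(2,3))
          then have "act p x = act (winv s @ w1) b" "suffix (winv s @ w1) w"
            using 1 d by (auto simp: suffix_def)
          then show ?thesis using \<Gamma>dom \<Gamma>(3) 1 by metis
        next
          case False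
          then obtain g2 where "p = g2 @ winv r" "suffix g2 g1"
            using p d(1) by (auto simp: suffix_append)
          then have "act p x = act (g2 @ w1) b" "suffix (g2 @ w1) v"
            using 1 d v by (auto simp: suffix_def)
          then show ?thesis using \<Gamma>dom \<Gamma>(3) 1 by metis
        qed
      next
        case 2
        then have "act p x \<in> dom u" using convex x g p unfolding loc_convex_def by blast
        then show ?thesis using map_le_implies_dom_le[OF le] by blast
      qed
    qed
    \<comment> \<open>The copy at \<open>b\<close> together with all old clusters within one jump of
      it. \<open>Zstep\<close> shows that no link of the new coloured set leads out of it.\<close>
    define Z where "Z b = {z. (\<exists>w\<in>\<Gamma>. z = act w b) \<or>
      (\<exists>w\<in>\<Gamma>. \<exists>s\<in>dom u. near (4 * N) (act w b) s \<and> (link (dom u))\<^sup>*\<^sup>* s z)}" for b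
    have actX: "act w x \<in> X \<longleftrightarrow> x \<in> X" if "w \<in> words" for w x
    proof -
      have "act w x \<in> X" if "x \<in> X" "fst ` set w \<subseteq> \<Lambda>" for w x
        using that by (induction w) (use X in auto)
      from this[of x w] this[of "act w x" "winv w"] show ?thesis
        using that by (auto simp: words_def)
    qed
    have nearX: "near n x z \<Longrightarrow> x \<in> X \<Longrightarrow> z \<in> X" for n x z
      using actX by (auto simp: near_def)
    have Znear: "near M b z" if "z \<in> Z b" "b \<in> X" for z b
      using that(1) unfolding Z_def
    proof (elim CollectE disjE bexE conjE)
      fix w assume "w \<in> \<Gamma>" "z = act w b"
      then show ?thesis using near\<Gamma>[of w b] near_mono by (auto simp: M_def)
    next
      fix w s assume w: "w \<in> \<Gamma>" "s \<in> dom u" "near (4 * N) (act w b) s" "(link (dom u))\<^sup>*\<^sup>* s z"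
      have s: "near (R + 4 * N + 4 * N) b s" using near_trans[OF near\<Gamma> w(3)] w by blast
      then have "near R s z"
        using bounded w nearX[OF s] that(2) unfolding bounded_chains_def by blast
      then have "near (R + 4 * N + 4 * N + R) b z" using near_trans s by blast
      then show ?thesis by (rule near_mono) (simp add: M_def)
    qed
    have Zstep: "z' \<in> Z b" if "b \<in> B" "b \<in> X" "z \<in> Z b" "link (dom u') z z'" for b z z'
    proof -
      have l: "z \<in> dom u'" "z' \<in> dom u'" "near (4 * N) z z'" using that by (auto simp: link_def)
      from cases[OF l(2)] show ?thesis
      proof (elim disjE bexE)
        assume z': "z' \<in> dom u"
        show ?thesis
          using \<open>z \<in> Z b\<close> unfolding Z_def
        proof (elim CollectE disjE bexE conjE)
          fix w assume "w \<in> \<Gamma>" "z = act w b"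
          then show "z' \<in> {z. (\<exists>w\<in>\<Gamma>. z = act w b) \<or>
              (\<exists>w\<in>\<Gamma>. \<exists>s\<in>dom u. near (4 * N) (act w b) s \<and> (link (dom u))\<^sup>*\<^sup>* s z)}"
            using l z' by blast
        next
          fix w s assume w: "w \<in> \<Gamma>" "s \<in> dom u" "near (4 * N) (act w b) s" "(link (dom u))\<^sup>*\<^sup>* s z"
          then have "link (dom u) z z'"
            using link_rtranclp_in z' l by (auto simp: link_def)
          then have "(link (dom u))\<^sup>*\<^sup>* s z'" using w by simp
          then show "z' \<in> {z. (\<exists>w\<in>\<Gamma>. z = act w b) \<or>
              (\<exists>w\<in>\<Gamma>. \<exists>s\<in>dom u. near (4 * N) (act w b) s \<and> (link (dom u))\<^sup>*\<^sup>* s z)}"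
            using w by blast
        qed
      next
        fix b' w assume b': "b' \<in> B" "w \<in> \<Gamma>" "z' = act w b'"
        have "near (M + 4 * N + (R + 4 * N)) b b'"
          using near_trans[OF near_trans[OF Znear[OF that(3,2)] l(3)] near_sym] near\<Gamma>[OF b'(2), of b'] b'(3)
          by blast
        then have "b = b'" using nearB that b' by (auto simp: M_def)
        then show ?thesis using b' by (auto simp: Z_def)
      qed
    qed
    have Zchain: "z' \<in> Z b" if "(link (dom u'))\<^sup>*\<^sup>* z z'" "b \<in> B" "b \<in> X" "z \<in> Z b" for b z z'
      using that by (induction rule: rtranclp_induct) (auto intro: Zstep)
    have bounded': "bounded_chains (dom u') X (2 * M)"
      unfolding bounded_chains_def
    proof (intro ballI allI impI)
      fix x z assume x: "x \<in> X \<inter> dom u'" and chain: "(link (dom u'))\<^sup>*\<^sup>* x z"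
      have "(x \<in> dom u \<and> (link (dom u))\<^sup>*\<^sup>* x z) \<or> (\<exists>b\<in>B \<inter> X. x \<in> Z b \<and> z \<in> Z b)"
        using chain
      proof (induction rule: rtranclp_induct)
        case base
        have "x \<in> dom u'" using x by blast
        from cases[OF this] show ?case
        proof (elim disjE bexE)
          fix b w assume "b \<in> B" "w \<in> \<Gamma>" "x = act w b"
          then have "b \<in> X" "x \<in> Z b" using actX[of w b] \<Gamma>(1) x by (auto simp: Z_def)
          then show ?case using \<open>b \<in> B\<close> by blast
        qed auto
      next
        case (step z z')
        from step.IH show ?case
        proof (elim disjE conjE bexE)
          fix b assume "b \<in> B \<inter> X" "x \<in> Z b" "z \<in> Z b"
          then show ?thesis using Zstep step.hyps by blast
        next
          assume xz: "x \<in> dom u" "(link (dom u))\<^sup>*\<^sup>* x z"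
          have "z' \<in> dom u'" using step.hyps by (auto simp: link_def)
          from cases[OF this] show ?thesis
          proof (elim disjE bexE)
            assume "z' \<in> dom u"
            then have "link (dom u) z z'"
              using link_rtranclp_in[OF xz(2,1)] step.hyps by (auto simp: link_def)
            then have "(link (dom u))\<^sup>*\<^sup>* x z'" using xz(2) by simp
            then show ?thesis using xz by blast
          next
            fix b w assume b: "b \<in> B" "w \<in> \<Gamma>" "z' = act w b"
            have "(link (dom u'))\<^sup>*\<^sup>* x z'" using step.hyps by simp
            have "near R x z" using xz bounded x by (auto simp: bounded_chains_def)
            then have "near (R + 4 * N) x z'"
              using step.hyps near_trans by (auto simp: link_def)
            then have "b \<in> X" using nearX x actX[of w b] b \<Gamma>(1) by blast
            have "z' \<in> Z b" using b by (auto simp: Z_def)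
            then have "x \<in> Z b"
              using Zchain[OF link_rtranclp_sym[OF \<open>(link (dom u'))\<^sup>*\<^sup>* x z'\<close>] b(1) \<open>b \<in> X\<close>] by blast
            then show ?thesis using b \<open>b \<in> X\<close> \<open>z' \<in> Z b\<close> by blast
          qed
        qed
      qed
      then show "near (2 * M) x z"
      proof (elim disjE conjE bexE)
        assume "x \<in> dom u" "(link (dom u))\<^sup>*\<^sup>* x z"
        then have "near R x z" using bounded x by (auto simp: bounded_chains_def)
        then show ?thesis by (rule near_mono) (simp add: M_def)
      next
        fix b assume "b \<in> B \<inter> X" "x \<in> Z b" "z \<in> Z b"
        then have "near (M + M) x z" using near_trans[OF near_sym] Znear by blast
        then show ?thesis by (simp add: mult_2)
      qed
    qed
    show ?thesis
      using u'\<Gamma> u'u le valid' convex' bounded' by (intro exI[of _ u']) blast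
  qed
  show thesis
    by (rule that[of \<Gamma> "4 * M" c "2 * M", OF fin \<Gamma>(1,2)]) (rule step, blast, blast)
qed

end

section \<open>Meager sets\<close>

lemma nowhere_dense_in_subset:
  assumes "nowhere_dense_in X S" "T \<subseteq> S"
  shows "nowhere_dense_in X T"
  using assms closure_of_mono[of T S X] interior_of_mono[of "X closure_of T" "X closure_of S" X]
  unfolding nowhere_dense_in_def by blast

lemma nowhere_dense_in_closedI:
  assumes "closedin X S" "\<And>U. openin X U \<Longrightarrow> U \<subseteq> S \<Longrightarrow> U = {}"
  shows "nowhere_dense_in X S"
  unfolding nowhere_dense_in_def
proof
  show "S \<subseteq> topspace X" using assms(1) closedin_subset by blast
  have "X closure_of S = S" using assms(1) by (simp add: closure_of_closedin)
  then show "X interior_of (X closure_of S) = {}"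
    using assms(2)[OF openin_interior_of] interior_of_subset by metis
qed

lemma meager_in_countable_Union:
  assumes "countable \<N>" "\<And>A. A \<in> \<N> \<Longrightarrow> nowhere_dense_in X A" "S \<subseteq> \<Union>\<N>"
  shows "meager_in X S"
proof -
  define N where "N n = (if \<N> = {} then {} else from_nat_into \<N> n \<inter> S)" for n
  have "nowhere_dense_in X {}" by (simp add: nowhere_dense_in_def)
  then have "nowhere_dense_in X (N n)" for n
    using nowhere_dense_in_subset[OF assms(2)[OF from_nat_into[of \<N> n]], of "from_nat_into \<N> n \<inter> S"]
    by (simp add: N_def)
  moreover have "S = (\<Union>n. N n)"
  proof (cases "\<N> = {}")
    case False
    then have "\<Union>\<N> = (\<Union>n. from_nat_into \<N> n)"
      using assms(1) range_from_nat_into by metis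
    then show ?thesis using assms(3) False by (auto simp: N_def)
  qed (use assms(3) in \<open>auto simp: N_def\<close>)
  ultimately show ?thesis unfolding meager_in_def by blast
qed

lemma meager_in_subset:
  assumes "meager_in X S" "T \<subseteq> S"
  shows "meager_in X T"
proof -
  obtain N :: "nat \<Rightarrow> _" where "\<And>n. nowhere_dense_in X (N n)" "S = (\<Union>n. N n)"
    using assms(1) unfolding meager_in_def by blast
  then show ?thesis
    using assms(2) by (intro meager_in_countable_Union[of "range N"]) auto
qed

lemma meager_in_countable_UN:
  assumes "countable J" "\<And>j. j \<in> J \<Longrightarrow> meager_in X (S j)"
  shows "meager_in X (\<Union>j\<in>J. S j)"
proof -
  obtain N :: "_ \<Rightarrow> nat \<Rightarrow> _"
    where N: "\<And>j. j \<in> J \<Longrightarrow> (\<forall>n. nowhere_dense_in X (N j n)) \<and> S j = (\<Union>n. N j n)"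
    using assms(2) unfolding meager_in_def by metis
  show ?thesis
  proof (rule meager_in_countable_Union[of "(\<lambda>(j, n). N j n) ` (J \<times> UNIV)"])
    show "\<Union> (S ` J) \<subseteq> \<Union> ((\<lambda>(j, n). N j n) ` (J \<times> UNIV))"
      using N by fastforce
  qed (use N assms(1) in auto)
qed

lemma meager_in_Un:
  assumes "meager_in X S" "meager_in X T"
  shows "meager_in X (S \<union> T)"
  using meager_in_countable_UN[of "{True, False}" X "\<lambda>b. if b then S else T"] assms
  by (simp add: Un_commute)

lemma meager_in_empty [simp]: "meager_in X {}"
  by (rule meager_in_countable_Union[of "{}"]) auto

lemma meager_in_homeomorphic_image:
  assumes h: "homeomorphic_map X X f" and "meager_in X S"
  shows "meager_in X (f ` S)"
proof -
  obtain N :: "nat \<Rightarrow> _" where N: "\<And>n. nowhere_dense_in X (N n)" "S = (\<Union>n. N n)"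
    using assms(2) unfolding meager_in_def by blast
  have "nowhere_dense_in X (f ` N n)" for n
  proof -
    have sub: "N n \<subseteq> topspace X" "X closure_of N n \<subseteq> topspace X"
      using N(1)[of n] closure_of_subset_topspace[of X "N n"]
      by (simp_all add: nowhere_dense_in_def)
    have "X interior_of (X closure_of (f ` N n)) = f ` (X interior_of (X closure_of N n))"
      using homeomorphic_map_closure_of[OF h sub(1)] homeomorphic_map_interior_of[OF h sub(2)] by simp
    moreover have "f ` N n \<subseteq> topspace X"
      using sub(1) h homeomorphic_imp_surjective_map by blast
    ultimately show ?thesis using N(1)[of n] by (simp add: nowhere_dense_in_def)
  qed
  moreover have "f ` S = (\<Union>n. f ` N n)" using N(2) by auto
  ultimately show ?thesis
    unfolding meager_in_def by (intro exI[of _ "\<lambda>n. f ` N n"]) simp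
qed

definition dense_in :: "'a topology \<Rightarrow> 'a set \<Rightarrow> bool" where
  "dense_in X D \<longleftrightarrow> (\<forall>U. openin X U \<longrightarrow> U \<noteq> {} \<longrightarrow> U \<inter> D \<noteq> {})"

lemma nowhere_dense_in_compl:
  assumes "openin X D" "dense_in X D"
  shows "nowhere_dense_in X (topspace X - D)"
  by (rule nowhere_dense_in_closedI) (use assms in \<open>auto simp: dense_in_def\<close>)

lemma Baire_dense_in:
  fixes P :: "'a::euclidean_space set"
  assumes "closed P" "countable \<D>"
    and "\<And>D. D \<in> \<D> \<Longrightarrow> openin (top_of_set P) D \<and> dense_in (top_of_set P) D"
  shows "dense_in (top_of_set P) (\<Inter>\<D>)"
  unfolding dense_in_def
proof (intro allI impI)
  fix U assume U: "openin (top_of_set P) U" "U \<noteq> {}"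
  \<comment> \<open>Inserting \<open>P\<close> keeps the intersection inside \<open>P\<close>, even
    for an empty family.\<close>
  have "P \<subseteq> closure (\<Inter>(insert P \<D>))"
  proof (rule Baire)
    fix D assume "D \<in> insert P \<D>"
    then have D: "openin (top_of_set P) D \<and> dense_in (top_of_set P) D"
      using assms(3) openin_subset by (fastforce simp: dense_in_def)
    have "x \<in> closure D" if "x \<in> P" for x
      unfolding closure_iff_nhds_not_empty
    proof (intro allI impI)
      fix A V :: "'a set" assume "V \<subseteq> A" "open V" "x \<in> V"
      then have "openin (top_of_set P) (P \<inter> V)" "P \<inter> V \<noteq> {}" using that by auto
      then show "D \<inter> A \<noteq> {}" using D \<open>V \<subseteq> A\<close> unfolding dense_in_def by blast
    qed
    then show "openin (top_of_set P) D \<and> P \<subseteq> closure D" using D by blast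
  qed (use assms in auto)
  moreover obtain V where V: "open V" "U = P \<inter> V" using U(1) by (auto simp: openin_open)
  ultimately show "U \<inter> \<Inter>\<D> \<noteq> {}"
    using U(2) open_Int_closure_eq_empty[OF V(1), of "\<Inter>(insert P \<D>)"] by auto
qed

lemma not_meager_in_open:
  fixes P :: "'a::euclidean_space set"
  assumes "closed P" "openin (top_of_set P) U" "U \<noteq> {}"
  shows "\<not> meager_in (top_of_set P) U"
proof
  assume "meager_in (top_of_set P) U"
  then obtain N :: "nat \<Rightarrow> _"
    where N: "\<And>n. nowhere_dense_in (top_of_set P) (N n)" "U = (\<Union>n. N n)"
    unfolding meager_in_def by blast
  define D where "D n = P - top_of_set P closure_of N n" for n
  have "openin (top_of_set P) (D n) \<and> dense_in (top_of_set P) (D n)" for n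
  proof
    show "openin (top_of_set P) (D n)"
      unfolding D_def by (metis closedin_closure_of openin_diff openin_topspace topspace_euclidean_subtopology)
    show "dense_in (top_of_set P) (D n)"
      unfolding dense_in_def
    proof (intro allI impI notI)
      fix V assume V: "openin (top_of_set P) V" "V \<noteq> {}" "V \<inter> D n = {}"
      then have "V \<subseteq> top_of_set P closure_of N n"
        using openin_imp_subset[OF V(1)] by (auto simp: D_def)
      then show False
        using N(1)[of n] V(2) interior_of_maximal[OF _ V(1)]
        by (metis nowhere_dense_in_def subset_empty)
    qed
  qed
  then have "dense_in (top_of_set P) (\<Inter>(range D))"
    using Baire_dense_in[OF assms(1), of "range D"] by auto
  then have "U \<inter> \<Inter>(range D) \<noteq> {}"
    using assms(2,3) by (simp add: dense_in_def)
  then obtain x where x: "x \<in> U" "\<And>n. x \<in> D n" by auto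
  then obtain n where "x \<in> N n" using N(2) by blast
  then show False
    using x(2)[of n] N(1)[of n] closure_of_subset[of "N n" "top_of_set P"]
    by (auto simp: D_def nowhere_dense_in_def)
qed

section \<open>Generic colourings\<close>

locale generic_action = colouring_action \<Lambda> T I E N
  for \<Lambda> :: "'a set" and T :: "'a \<times> bool \<Rightarrow> 'p::euclidean_space \<Rightarrow> 'p"
    and I :: "'c set" and E :: "'a \<times> bool \<Rightarrow> 'c \<Rightarrow> 'c \<Rightarrow> bool" and N :: nat +
  fixes P :: "'p set"
  assumes mixing_act: mixing and closed_P: "closed P"
    and T_P: "\<And>l x. x \<in> P \<Longrightarrow> T l x \<in> P"
    and T_continuous: "\<And>l. continuous_on P (T l)"
    and fixed_points: "\<And>w U. \<lbrakk>w \<in> words; w \<noteq> []; openin (top_of_set P) U; U \<noteq> {}\<rbrakk> \<Longrightarrow> \<exists>x\<in>U. act w x \<noteq> x"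
begin

abbreviation "\<tau> \<equiv> top_of_set P"

definition domain :: "'p set" where
  "domain = free_points \<inter> P"

lemma act_P: "act w x \<in> P \<longleftrightarrow> x \<in> P"
proof -
  have "act w x \<in> P" if "x \<in> P" for w x
    using that by (induction w) (auto intro: T_P)
  from this[of x w] this[of "act w x" "winv w"] show ?thesis by auto
qed

lemma act_continuous: "continuous_on P (act w)"
proof (induction w)
  case Nil
  then show ?case by (simp add: act_def)
next
  case (Cons l w)
  have "continuous_on P (T l \<circ> act w)"
    using Cons T_continuous[of l] continuous_on_subset act_P
    by (intro continuous_on_compose) (auto intro: continuous_on_subset)
  then show ?case by (simp add: comp_def)
qed

lemma openin_vimage_act:
  assumes "openin \<tau> U"
  shows "openin \<tau> {x \<in> P. act w x \<in> U}"
proof -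
  have "openin \<tau> (P \<inter> act w -` U)"
    using continuous_openin_preimage[OF act_continuous _ assms] act_P by blast
  then show ?thesis by (simp add: Int_def)
qed

lemma act_image: "U \<subseteq> P \<Longrightarrow> act w ` U = {x \<in> P. act (winv w) x \<in> U}"
  by (auto simp: act_P image_iff) (metis act_winv')

lemma openin_act_image: "openin \<tau> U \<Longrightarrow> openin \<tau> (act w ` U)"
  using openin_vimage_act[of U "winv w"] act_image[of U w] openin_imp_subset by metis

lemma dense_vimage_act:
  assumes "dense_in \<tau> D"
  shows "dense_in \<tau> {x \<in> P. act w x \<in> D}"
  unfolding dense_in_def
proof (intro allI impI)
  fix U assume U: "openin \<tau> U" "U \<noteq> {}"
  then have "openin \<tau> (act w ` U)" "act w ` U \<noteq> {}" by (auto intro: openin_act_image)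
  then have "act w ` U \<inter> D \<noteq> {}" using assms by (simp add: dense_in_def)
  then show "U \<inter> {x \<in> P. act w x \<in> D} \<noteq> {}"
    using openin_imp_subset[OF U(1)] by blast
qed

lemma moved_open:
  shows "openin \<tau> {x \<in> P. act w x \<noteq> x}"
proof -
  have "closed {x \<in> P. act w x = x}"
    using continuous_closed_preimage_constant[of P "\<lambda>x. act w x - x" 0] closed_P
    by (simp add: continuous_on_diff act_continuous)
  then have "openin \<tau> (P \<inter> - {x \<in> P. act w x = x})" by (intro openin_open_Int) auto
  moreover have "P \<inter> - {x \<in> P. act w x = x} = {x \<in> P. act w x \<noteq> x}" by auto
  ultimately show ?thesis by simp
qed

lemma countable_words: "countable words"
proof (rule countable_subset)
  show "words \<subseteq> lists (\<Lambda> \<times> UNIV)" by (force simp: words_def)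
  show "countable (lists (\<Lambda> \<times> (UNIV :: bool set)))"
    by (simp add: countable_finite finite_letters)
qed

lemma domain_eq: "domain = P \<inter> \<Inter>((\<lambda>w. {x \<in> P. act w x \<noteq> x}) ` (words - {[]}))"
  by (auto simp: domain_def free_points_def)

lemma dense_moved: "w \<in> words \<Longrightarrow> w \<noteq> [] \<Longrightarrow> dense_in \<tau> {x \<in> P. act w x \<noteq> x}"
  unfolding dense_in_def
proof (intro allI impI)
  fix U assume "w \<in> words" "w \<noteq> []" and U: "openin \<tau> U" "U \<noteq> {}"
  then obtain x where "x \<in> U" "act w x \<noteq> x" using fixed_points by blast
  then show "U \<inter> {x \<in> P. act w x \<noteq> x} \<noteq> {}" using openin_imp_subset[OF U(1)] by blast
qed

lemma T_domain: "x \<in> domain \<Longrightarrow> fst l \<in> \<Lambda> \<Longrightarrow> T l x \<in> domain"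
  by (simp add: domain_def T_free_points T_P)

text \<open>The constant may be \<open>None\<close>. The sets on which \<open>u\<close> is constant
  then have a dense open union, so that a generic point sees the same finite pattern of colours and
  gaps as all points near it.\<close>

definition gen_const :: "('p \<Rightarrow> 'c option) \<Rightarrow> bool" where
  "gen_const u \<longleftrightarrow> (\<forall>U. openin \<tau> U \<longrightarrow> U \<noteq> {} \<longrightarrow>
     (\<exists>V\<subseteq>U. openin \<tau> V \<and> V \<noteq> {} \<and> (\<exists>v. \<forall>x\<in>V. u x = v)))"

definition good :: "('p \<Rightarrow> 'c option) \<Rightarrow> bool" where
  "good u \<longleftrightarrow> valid_colouring u domain \<and> loc_convex (dom u) domain \<and>
     (\<exists>R. bounded_chains (dom u) domain R) \<and> gen_const u"

lemma good_empty: "good Map.empty"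
  by (auto simp: good_def valid_colouring_def loc_convex_def bounded_chains_def gen_const_def)

text \<open>\<open>y\<close> is a generic point of \<open>U\<close>: free, with its whole orbit in
  the region where \<open>u\<close> is locally constant. Only the finitely many words of length at
  most \<open>D\<close> matter, so a small neighbourhood of \<open>y\<close> meets the requirements
  of \<open>colouring_step\<close> on \<open>B\<close>.\<close>

lemma good_step:
  assumes "good u" and U: "openin \<tau> U" "U \<noteq> {}"
  obtains u' V a where "good u'" "u \<subseteq>\<^sub>m u'" "V \<subseteq> U" "openin \<tau> V" "V \<noteq> {}" "\<And>x. x \<in> V \<Longrightarrow> u' x = Some a"
proof -
  note result = that
  obtain R where u: "valid_colouring u domain" "loc_convex (dom u) domain" "bounded_chains (dom u) domain R"
    and gen: "gen_const u"
    using assms(1) by (auto simp: good_def)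
  define LC where "LC = \<Union>{V. openin \<tau> V \<and> (\<exists>v. \<forall>x\<in>V. u x = v)}"
  have LC: "openin \<tau> LC" "dense_in \<tau> LC"
  proof -
    show "openin \<tau> LC" unfolding LC_def by blast
    show "dense_in \<tau> LC"
      unfolding dense_in_def
    proof (intro allI impI)
      fix O1 assume "openin \<tau> O1" "O1 \<noteq> {}"
      then obtain V v where "V \<subseteq> O1" "openin \<tau> V" "V \<noteq> {}" "\<forall>x\<in>V. u x = v"
        using gen unfolding gen_const_def by metis
      then show "O1 \<inter> LC \<noteq> {}" unfolding LC_def by blast
    qed
  qed
  have LC_nhd: "\<exists>V. openin \<tau> V \<and> x \<in> V \<and> (\<forall>z\<in>V. u z = u x)" if "x \<in> LC" for x
    using that unfolding LC_def by auto
  have "dense_in \<tau> (\<Inter>((\<lambda>w. {x \<in> P. act w x \<in> LC}) ` words \<union>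
      (\<lambda>w. {x \<in> P. act w x \<noteq> x}) ` (words - {[]})))"
    using countable_words moved_open dense_moved LC openin_vimage_act dense_vimage_act
    by (intro Baire_dense_in[OF closed_P]) auto
  then have "U \<inter> \<Inter>((\<lambda>w. {x \<in> P. act w x \<in> LC}) ` words \<union>
      (\<lambda>w. {x \<in> P. act w x \<noteq> x}) ` (words - {[]})) \<noteq> {}"
    using U by (simp add: dense_in_def)
  then obtain y where "y \<in> U" "\<forall>w\<in>words. act w y \<in> LC" "\<forall>w\<in>words - {[]}. act w y \<noteq> y"
    by auto
  then have y: "y \<in> U" "\<And>w. w \<in> words \<Longrightarrow> act w y \<in> LC"
    "\<And>w. w \<in> words \<Longrightarrow> w \<noteq> [] \<Longrightarrow> act w y \<noteq> y"
    by blast+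
  have yP: "y \<in> P" using y(1) openin_imp_subset[OF U(1)] by blast
  then have "y \<in> domain" using y by (auto simp: domain_def free_points_def)
  show thesis
  proof (rule colouring_step[OF mixing_act _ _ u \<open>y \<in> domain\<close>])
    show "domain \<subseteq> free_points" by (simp add: domain_def)
    show "T l x \<in> domain" if "x \<in> domain" "fst l \<in> \<Lambda>" for x l using T_domain that .
    fix \<Gamma> c D R'
    assume \<Gamma>: "finite \<Gamma>" "\<Gamma> \<subseteq> words" "[] \<in> \<Gamma>" and step: "\<And>B.
      \<lbrakk>\<And>b w. b \<in> B \<Longrightarrow> w \<in> words \<Longrightarrow> length w \<le> D \<Longrightarrow> u (act w b) = u (act w y);
       \<And>b w. b \<in> B \<Longrightarrow> w \<in> words \<Longrightarrow> length w \<le> D \<Longrightarrow> act w b \<in> B \<Longrightarrow> w = []\<rbrakk> \<Longrightarrow>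
      \<exists>u'. (\<forall>b\<in>B. \<forall>w\<in>\<Gamma>. u' (act w b) = Some (c w)) \<and> (\<forall>x. x \<notin> (\<Union>w\<in>\<Gamma>. act w ` B) \<longrightarrow> u' x = u x) \<and>
        u \<subseteq>\<^sub>m u' \<and> valid_colouring u' domain \<and> loc_convex (dom u') domain \<and>
        bounded_chains (dom u') domain R'"
    define W where "W = {w \<in> words. length w \<le> D}"
    have "finite W" unfolding W_def by (rule finite_words_le)
    have "\<exists>V. openin \<tau> V \<and> y \<in> V \<and> (\<forall>b\<in>V. u (act w b) = u (act w y)) \<and>
        (w \<noteq> [] \<longrightarrow> (\<forall>b\<in>V. act w b \<notin> V))" if "w \<in> W" for w
    proof -
      obtain V1 where V1: "openin \<tau> V1" "act w y \<in> V1" "\<forall>z\<in>V1. u z = u (act w y)"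
        using LC_nhd[of "act w y"] y(2)[of w] \<open>w \<in> W\<close> by (auto simp: W_def)
      show ?thesis
      proof (cases "w = []")
        case True
        then have "openin \<tau> V1 \<and> y \<in> V1 \<and> (\<forall>b\<in>V1. u (act w b) = u (act w y))"
          using V1 by (metis act_simps(1))
        then show ?thesis using True by blast
      next
        case False
        then have "act w y \<noteq> y" using y(3) \<open>w \<in> W\<close> by (auto simp: W_def)
        then obtain A B where AB: "open A" "open B" "act w y \<in> A" "y \<in> B" "A \<inter> B = {}"
          by (metis hausdorff)
        define V where "V = {x \<in> P. act w x \<in> V1} \<inter> {x \<in> P. act w x \<in> P \<inter> A} \<inter> (P \<inter> B)"
        have "openin \<tau> V"
          unfolding V_def by (intro openin_Int openin_vimage_act openin_open_Int AB V1)
        moreover have "y \<in> V" using V1(2) AB yP by (simp add: V_def act_P)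
        moreover have "u (act w b) = u (act w y)" if "b \<in> V" for b
          using V1(3)[rule_format, of "act w b"] that by (simp add: V_def)
        moreover have "act w b \<notin> V" if "b \<in> V" for b using that AB(5) by (auto simp: V_def)
        ultimately show ?thesis by blast
      qed
    qed
    then obtain V where V: "\<And>w. w \<in> W \<Longrightarrow> openin \<tau> (V w) \<and> y \<in> V w \<and>
        (\<forall>b\<in>V w. u (act w b) = u (act w y)) \<and> (w \<noteq> [] \<longrightarrow> (\<forall>b\<in>V w. act w b \<notin> V w))"
      by metis
    define B where "B = U \<inter> \<Inter>(V ` W)"
    have "W \<noteq> {}" by (auto simp: W_def intro: exI[of _ "[]"])
    then have B: "openin \<tau> B" "y \<in> B" "B \<subseteq> U"
      using V y(1) U(1) \<open>finite W\<close> unfolding B_def by (auto intro!: openin_Int openin_INT)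
    have "\<exists>u'. (\<forall>b\<in>B. \<forall>w\<in>\<Gamma>. u' (act w b) = Some (c w)) \<and> (\<forall>x. x \<notin> (\<Union>w\<in>\<Gamma>. act w ` B) \<longrightarrow> u' x = u x) \<and>
        u \<subseteq>\<^sub>m u' \<and> valid_colouring u' domain \<and> loc_convex (dom u') domain \<and>
        bounded_chains (dom u') domain R'"
    proof (rule step)
      fix b w assume w: "b \<in> B" "w \<in> words" "length w \<le> D"
      then have "w \<in> W" "b \<in> V w" by (auto simp: W_def B_def)
      then show "u (act w b) = u (act w y)" using V by blast
      show "w = []" if "act w b \<in> B"
        using V[OF \<open>w \<in> W\<close>] \<open>b \<in> V w\<close> that \<open>w \<in> W\<close> by (auto simp: B_def)
    qed
    then obtain u' where u': "\<And>b w. b \<in> B \<Longrightarrow> w \<in> \<Gamma> \<Longrightarrow> u' (act w b) = Some (c w)"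
      "\<And>x. x \<notin> (\<Union>w\<in>\<Gamma>. act w ` B) \<Longrightarrow> u' x = u x" "u \<subseteq>\<^sub>m u'" "valid_colouring u' domain"
      "loc_convex (dom u') domain" "bounded_chains (dom u') domain R'"
      by blast
    have "gen_const u'"
      unfolding gen_const_def
    proof (intro allI impI)
      fix O1 assume "openin \<tau> O1" "O1 \<noteq> {}"
      then obtain O2 v where O2: "O2 \<subseteq> O1" "openin \<tau> O2" "O2 \<noteq> {}" "\<forall>x\<in>O2. u x = v"
        using gen unfolding gen_const_def by blast
      show "\<exists>V\<subseteq>O1. openin \<tau> V \<and> V \<noteq> {} \<and> (\<exists>v. \<forall>x\<in>V. u' x = v)"
      proof (cases "\<exists>w\<in>\<Gamma>. O2 \<inter> act w ` B \<noteq> {}")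
        case True
        then obtain w where w: "w \<in> \<Gamma>" "O2 \<inter> act w ` B \<noteq> {}" by blast
        then show ?thesis
          using O2 openin_act_image[OF B(1), of w] u'(1)
          by (intro exI[of _ "O2 \<inter> act w ` B"]) auto
      next
        case False
        have "u' x = v" if "x \<in> O2" for x
        proof -
          have "x \<notin> (\<Union>w\<in>\<Gamma>. act w ` B)" using False that by blast
          then show ?thesis using u'(2) O2(4) that by simp
        qed
        then show ?thesis using O2 by (intro exI[of _ O2]) auto
      qed
    qed
    then have "good u'" using u' by (auto simp: good_def)
    show thesis
      by (rule result[OF \<open>good u'\<close> u'(3) B(3,1)]) (use B(2) u'(1)[OF _ \<Gamma>(3)] in auto)
  qed
qed

text \<open>One stage per basic open set. Colours once given never change, so the stages have a
  limit, and \<open>U a\<close> collects the open sets that receive colour \<open>a\<close> at some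
  stage. \<open>Y\<close> consists of the free orbits that stay inside the union of the
  \<open>U a\<close>: it is invariant and comeager, and the colour classes are relatively open in
  it.\<close>

theorem generic_colouring:
  obtains Y c U where "Y \<subseteq> P" "meager_in \<tau> (P - Y)" "\<And>x l. x \<in> Y \<Longrightarrow> fst l \<in> \<Lambda> \<Longrightarrow> T l x \<in> Y"
    "\<And>x. x \<in> Y \<Longrightarrow> c x \<in> I" "\<And>x l. x \<in> Y \<Longrightarrow> fst l \<in> \<Lambda> \<Longrightarrow> E l (c x) (c (T l x))"
    "\<And>a. openin \<tau> (U a)" "\<And>a. {x \<in> Y. c x = a} = Y \<inter> U a"
proof -
  obtain \<B> :: "'p set set" where \<B>: "countable \<B>" "\<And>B. B \<in> \<B> \<Longrightarrow> open B"
    "\<And>V. open V \<Longrightarrow> \<exists>\<U>\<subseteq>\<B>. V = \<Union>\<U>"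
    using univ_second_countable by metis
  \<comment> \<open>\<open>UNIV\<close> makes the enumerated family nonempty.\<close>
  define base where "base n = P \<inter> from_nat_into (insert UNIV \<B>) n" for n
  have base_open: "openin \<tau> (base n)" for n
    using \<B>(2) from_nat_into[of "insert UNIV \<B>" n] unfolding base_def
    by (intro openin_open_Int) auto
  have base_refine: "\<exists>n. base n \<subseteq> V \<and> base n \<noteq> {}" if V: "openin \<tau> V" "V \<noteq> {}" for V
  proof -
    obtain V' where V': "open V'" "V = P \<inter> V'" using V(1) by (auto simp: openin_open)
    then obtain \<U> where "\<U> \<subseteq> \<B>" "V' = \<Union>\<U>" using \<B>(3) by blast
    then obtain B where B: "B \<in> \<B>" "P \<inter> B \<subseteq> V" "P \<inter> B \<noteq> {}" using V V' by blast
    then obtain n where "from_nat_into (insert UNIV \<B>) n = B"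
      using from_nat_into_surj[of "insert UNIV \<B>" B] \<B>(1) by auto
    then show ?thesis using B by (auto simp: base_def)
  qed
  have "\<exists>f. \<forall>n. good (f n) \<and> (f n \<subseteq>\<^sub>m f (Suc n) \<and> (base n \<noteq> {} \<longrightarrow>
      (\<exists>V\<subseteq>base n. openin \<tau> V \<and> V \<noteq> {} \<and> (\<exists>a. \<forall>x\<in>V. f (Suc n) x = Some a))))"
  proof (rule dependent_nat_choice)
    show "\<exists>u. good u" using good_empty by blast
    show "\<exists>u'. good u' \<and> (u \<subseteq>\<^sub>m u' \<and> (base n \<noteq> {} \<longrightarrow>
      (\<exists>V\<subseteq>base n. openin \<tau> V \<and> V \<noteq> {} \<and> (\<exists>a. \<forall>x\<in>V. u' x = Some a))))" if "good u" for u n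
    proof (cases "base n = {}")
      case True
      then show ?thesis using that by auto
    next
      case False
      obtain u' V a where "good u'" "u \<subseteq>\<^sub>m u'" "V \<subseteq> base n" "openin \<tau> V" "V \<noteq> {}"
        "\<And>x. x \<in> V \<Longrightarrow> u' x = Some a"
        using good_step[OF \<open>good u\<close> base_open False] by metis
      then show ?thesis by (intro exI[of _ u'] conjI impI exI[of _ V] exI[of _ a] ballI)
    qed
  qed
  then obtain f where good: "\<And>n. good (f n)" and le: "\<And>n. f n \<subseteq>\<^sub>m f (Suc n)"
    and dense: "\<And>n. base n \<noteq> {} \<Longrightarrow>
      \<exists>V\<subseteq>base n. openin \<tau> V \<and> V \<noteq> {} \<and> (\<exists>a. \<forall>x\<in>V. f (Suc n) x = Some a)"
    by metis
  have mono: "f m \<subseteq>\<^sub>m f n" if "m \<le> n" for m n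
    using that by (induction n rule: dec_induct) (auto intro: map_le_trans le)
  have mono': "f n x = Some a" if "f m x = Some a" "m \<le> n" for m n x a
    using mono[OF that(2)] that(1) by (auto simp: map_le_def dom_def)
  have unique: "a = b" if "f m x = Some a" "f n x = Some b" for m n x a b
    using mono'[OF that(1), of "max m n"] mono'[OF that(2), of "max m n"] by simp
  define c where "c x = (SOME a. \<exists>n. f n x = Some a)" for x
  have c: "c x = a" if "f n x = Some a" for n x a
    unfolding c_def using that unique by (intro some_equality) blast+
  define U where "U a = \<Union>{V. openin \<tau> V \<and> (\<exists>n. \<forall>x\<in>V. f n x = Some a)}" for a
  have U_open: "openin \<tau> (U a)" for a unfolding U_def by blast
  have U_f: "\<exists>n. f n x = Some a" if "x \<in> U a" for x a
    using that unfolding U_def by blast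
  define G where "G = (\<Union>a. U a)"
  have G: "openin \<tau> G" "dense_in \<tau> G"
  proof -
    show "openin \<tau> G" unfolding G_def using U_open by blast
    show "dense_in \<tau> G"
      unfolding dense_in_def
    proof (intro allI impI)
      fix O1 assume "openin \<tau> O1" "O1 \<noteq> {}"
      then obtain n where n: "base n \<subseteq> O1" "base n \<noteq> {}" using base_refine by blast
      then obtain V a where V: "V \<subseteq> base n" "openin \<tau> V" "V \<noteq> {}" "\<forall>x\<in>V. f (Suc n) x = Some a"
        using dense by metis
      then have "V \<subseteq> U a" unfolding U_def by blast
      then show "O1 \<inter> G \<noteq> {}" using V n unfolding G_def by blast
    qed
  qed
  define Y where "Y = {x \<in> domain. \<forall>w\<in>words. act w x \<in> G}"
  show thesis
  proof (rule that[of Y c U])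
    show "Y \<subseteq> P" by (auto simp: Y_def domain_def)
    show "meager_in \<tau> (P - Y)"
    proof (rule meager_in_countable_Union)
      let ?N = "(\<lambda>w. P - {x \<in> P. act w x \<in> G}) ` words \<union>
        (\<lambda>w. P - {x \<in> P. act w x \<noteq> x}) ` (words - {[]})"
      show "countable ?N" using countable_words by auto
      show "nowhere_dense_in \<tau> A" if "A \<in> ?N" for A
        using that nowhere_dense_in_compl[of \<tau>] openin_vimage_act[OF G(1)] dense_vimage_act[OF G(2)]
          moved_open dense_moved by auto
      show "P - Y \<subseteq> \<Union>?N" by (auto simp: Y_def domain_eq)
    qed
    show inv: "T l x \<in> Y" if "x \<in> Y" "fst l \<in> \<Lambda>" for x l
    proof -
      have "act w (T l x) \<in> G" if "w \<in> words" for w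
      proof -
        have "fst ` set (w @ [l]) \<subseteq> \<Lambda>" using \<open>w \<in> words\<close> \<open>fst l \<in> \<Lambda>\<close> by (auto simp: words_def)
        then obtain v where "v \<in> words" "\<And>x. act v x = act (w @ [l]) x" using reduce_act by blast
        then show ?thesis using \<open>x \<in> Y\<close> unfolding Y_def by (metis (lifting) act_simps mem_Collect_eq)
      qed
      then show ?thesis using that by (auto simp: Y_def T_domain)
    qed
    have cU: "x \<in> U (c x) \<and> (\<exists>n. f n x = Some (c x))" if "x \<in> Y" for x
    proof -
      have "x \<in> G" using that words_Nil unfolding Y_def by (metis (lifting) act_simps(1) mem_Collect_eq)
      then obtain a where a: "x \<in> U a" by (auto simp: G_def)
      then obtain n where n: "f n x = Some a" using U_f by blast
      then have "c x = a" by (rule c)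
      then show ?thesis using a n by blast
    qed
    have dom: "x \<in> domain" if "x \<in> Y" for x using that by (simp add: Y_def)
    have valid: "valid_colouring (f n) domain" for n using good by (simp add: good_def)
    show "c x \<in> I" if "x \<in> Y" for x
      using cU[OF that] dom[OF that] valid unfolding valid_colouring_def by blast
    show "E l (c x) (c (T l x))" if xl: "x \<in> Y" "fst l \<in> \<Lambda>" for x l
    proof -
      obtain m n where "f m x = Some (c x)" "f n (T l x) = Some (c (T l x))"
        using cU[OF xl(1)] cU[OF inv[OF xl]] by blast
      then have "f (max m n) x = Some (c x)" "f (max m n) (T l x) = Some (c (T l x))"
        using mono' by (meson max.cobounded1 max.cobounded2)+
      then show ?thesis
        using valid[of "max m n"] dom[OF xl(1)] xl(2) unfolding valid_colouring_def by blast
    qed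
    show "openin \<tau> (U a)" for a by (rule U_open)
    show "{x \<in> Y. c x = a} = Y \<inter> U a" for a
    proof (intro equalityI subsetI)
      fix x assume "x \<in> {x \<in> Y. c x = a}"
      then show "x \<in> Y \<inter> U a" using cU[of x] by auto
    next
      fix x assume "x \<in> Y \<inter> U a"
      then show "x \<in> {x \<in> Y. c x = a}" using U_f[of x a] c by auto
    qed
  qed
qed

end

section \<open>Colouring all orbits\<close>

context colouring_action
begin

definition orbit :: "'p \<Rightarrow> 'p set" where
  "orbit x = {z. \<exists>n. near n x z}"

lemma orbit_self: "x \<in> orbit x"
  by (auto simp: orbit_def)

lemma orbit_eq: "z \<in> orbit x \<Longrightarrow> orbit z = orbit x"
  unfolding orbit_def using near_sym near_trans by blast

lemma T_orbit: "fst l \<in> \<Lambda> \<Longrightarrow> T l x \<in> orbit x"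
  unfolding orbit_def using nearI[of "[l]" 1 x] by auto

text \<open>By \<open>no_return\<close>, a path that leaves \<open>K\<close> with its first letter
  never comes back. So the rest of the orbit consists of trees hanging off \<open>K\<close>: every
  point has a unique normal form \<open>nf\<close>, a start in \<open>K\<close> with a word that is
  empty or leaves \<open>K\<close> at once. Colours spread along these trees by
  \<open>E_total\<close>.\<close>

lemma colour_from_core:
  assumes K: "K \<subseteq> orbit y" "K \<noteq> {}" and c0: "\<And>x. x \<in> K \<Longrightarrow> c0 x \<in> I"
    and edges: "\<And>x l. x \<in> K \<Longrightarrow> fst l \<in> \<Lambda> \<Longrightarrow> T l x \<in> K \<Longrightarrow> E l (c0 x) (c0 (T l x))"
    and no_return: "\<And>x g. x \<in> K \<Longrightarrow> g \<in> words \<Longrightarrow> g \<noteq> [] \<Longrightarrow> act g x \<in> K \<Longrightarrow> T (last g) x \<in> K"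
  obtains c where "\<And>x. x \<in> orbit y \<Longrightarrow> c x \<in> I"
    "\<And>x l. x \<in> orbit y \<Longrightarrow> fst l \<in> \<Lambda> \<Longrightarrow> E l (c x) (c (T l x))"
proof -
  define nf where "nf x h \<longleftrightarrow> x \<in> K \<and> h \<in> words \<and> (h = [] \<or> T (last h) x \<notin> K)" for x h
  have ex: "\<exists>x h. nf x h \<and> act h x = z" if "z \<in> orbit y" for z
  proof -
    have "\<exists>x h. x \<in> K \<and> h \<in> words \<and> act h x = z"
    proof -
      obtain x where "x \<in> K" using K by blast
      then have "orbit x = orbit y" using K orbit_eq by blast
      then have "z \<in> orbit x" using \<open>z \<in> orbit y\<close> by simp
      then show ?thesis using \<open>x \<in> K\<close> by (auto simp: orbit_def near_def)
    qed
    then have "\<exists>n x h. length h = n \<and> x \<in> K \<and> h \<in> words \<and> act h x = z" by blast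
    then have "\<exists>n. (\<exists>x h. length h = n \<and> x \<in> K \<and> h \<in> words \<and> act h x = z) \<and>
        (\<forall>m<n. \<not> (\<exists>x h. length h = m \<and> x \<in> K \<and> h \<in> words \<and> act h x = z))"
      by (rule exists_least_iff[THEN iffD1])
    then obtain x h where h: "x \<in> K" "h \<in> words" "act h x = z"
      and least: "\<forall>m<length h. \<not> (\<exists>x h. length h = m \<and> x \<in> K \<and> h \<in> words \<and> act h x = z)"
      by blast
    have "T (last h) x \<notin> K" if "h \<noteq> []"
    proof
      assume "T (last h) x \<in> K"
      moreover have split: "h = butlast h @ [last h]" using that by simp
      moreover have "act (butlast h) (T (last h) x) = z"
        using h(3) by (subst (asm) split) simp
      moreover have "butlast h \<in> words" using h(2) split words_appendD(1) by metis
      moreover have "length (butlast h) < length h" using that by simp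
      ultimately show False using least by blast
    qed
    then show ?thesis using h unfolding nf_def by blast
  qed
  have unique: "x = x' \<and> h = h'" if "nf x h" "nf x' h'" "act h x = act h' x'" for x h x' h'
    using that
  proof (induction h arbitrary: h')
    case Nil
    show ?case
    proof (cases "h' = []")
      case False
      then show ?thesis using Nil no_return[of x' h'] by (auto simp: nf_def)
    qed (use Nil in auto)
  next
    case (Cons l h)
    show ?case
    proof (cases h')
      case Nil
      then show ?thesis using Cons.prems no_return[of x "l # h"] by (auto simp: nf_def)
    next
      case (Cons l' k)
      show ?thesis
      proof (cases "l = l'")
        case True
        have "nf x h" "nf x' k"
          using Cons.prems(1,2) unfolding Cons nf_def by (auto dest: words_ConsD split: if_splits)
        then show ?thesis using Cons.IH[of k] Cons.prems(3) by (simp add: True Cons)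
      next
        case False
        \<comment> \<open>The two paths arrive through different letters, so going out along one and
          back along the other is a reduced path from \<open>K\<close> to \<open>K\<close>.\<close>
        have "winv (l' # k) @ (l # h) \<in> words"
          using reduced_word_winv_append[of "l' # k" "l # h"] False Cons.prems
          unfolding Cons nf_def words_def by (auto simp: image_Un)
        moreover have "act (winv (l' # k) @ (l # h)) x = x'"
          using Cons.prems(3) unfolding Cons by simp
        ultimately have "T (last (l # h)) x \<in> K"
          using no_return[of x "winv (l' # k) @ (l # h)"] Cons.prems by (auto simp: nf_def)
        then show ?thesis using Cons.prems(1) by (auto simp: nf_def)
      qed
    qed
  qed
  define cc where "cc x = rec_list (c0 x) (\<lambda>l w a. SOME b. b \<in> I \<and> E l a b)" for x
  have cc_simps: "cc x [] = c0 x" "cc x (l # w) = (SOME b. b \<in> I \<and> E l (cc x w) b)" for x l w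
    by (simp_all add: cc_def)
  have cc_step: "cc x (l # w) \<in> I \<and> E l (cc x w) (cc x (l # w))" if "cc x w \<in> I" "fst l \<in> \<Lambda>" for x l w
    using someI_ex[of "\<lambda>b. b \<in> I \<and> E l (cc x w) b"] E_total[OF that(2,1)]
    unfolding cc_simps by blast
  have cc_I: "cc x w \<in> I" if "x \<in> K" "w \<in> words" for x w
    using that(2)
  proof (induction w)
    case (Cons l w)
    then show ?case using cc_step[of x w l] words_ConsD[of l w] words_ConsD'[of l w] by blast
  qed (simp add: cc_simps c0 that)
  define c where "c z = (THE a. \<exists>x h. nf x h \<and> act h x = z \<and> a = cc x h)" for z
  have c: "c (act h x) = cc x h" if "nf x h" for x h
    unfolding c_def
  proof (rule the_equality)
    show "\<exists>x' h'. nf x' h' \<and> act h' x' = act h x \<and> cc x h = cc x' h'" using that by blast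
    show "a = cc x h" if "\<exists>x' h'. nf x' h' \<and> act h' x' = act h x \<and> a = cc x' h'" for a
      using that unique \<open>nf x h\<close> by metis
  qed
  show thesis
  proof (rule that[of c])
    show "c z \<in> I" if "z \<in> orbit y" for z
      using ex[OF that] c cc_I unfolding nf_def by metis
    show "E l (c z) (c (T l z))" if z: "z \<in> orbit y" and l: "fst l \<in> \<Lambda>" for z l
    proof -
      obtain x h where h: "nf x h" "act h x = z" using ex[OF z] by blast
      then have x: "x \<in> K" "h \<in> words" by (auto simp: nf_def)
      have cz: "c z = cc x h" using c h by blast
      show ?thesis
      proof (cases "h = [] \<and> T l x \<in> K")
        case True
        then have "nf (T l x) []" by (simp add: nf_def)
        then have "c (T l x) = c0 (T l x)" using c cc_simps by fastforce
        then show ?thesis using True h cz edges x l by (simp add: cc_simps)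
      next
        case outside: False
        show ?thesis
        proof (cases "h = [] \<or> hd h \<noteq> linv l")
          case True
          then have "nf x (l # h)"
            using outside h(1) x l words_ConsI[OF l x(2)] by (auto simp: nf_def)
          then have "c (T l z) = cc x (l # h)" using c[of x "l # h"] h by simp
          then show ?thesis using cc_step cc_I x l cz by simp
        next
          case False
          then obtain k where k: "h = linv l # k" by (cases h) auto
          then have "nf x k" using h(1) words_ConsD[of "linv l" k] by (auto simp: nf_def k split: if_splits)
          moreover have "act k x = T l z" using h(2) k by auto
          ultimately have "c (T l z) = cc x k" using c[of x k] by simp
          moreover have "E (linv l) (cc x k) (cc x h)"
            using cc_step[of x k "linv l"] cc_I[of x k] \<open>nf x k\<close> l k by (auto simp: nf_def)
          ultimately show ?thesis using cz by (simp add: E_linv)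
        qed
      qed
    qed
  qed
qed

section \<open>The core of an orbit with nontrivial stabilizers\<close>

lemma joins_path:
  assumes "joins w a b" "a \<in> I" "b \<in> I"
  obtains e where "e [] = a" "e w = b" "\<And>p. e p \<in> I"
    "\<And>l p. suffix (l # p) w \<Longrightarrow> E l (e p) (e (l # p))"
  using assms
proof (induction w arbitrary: b thesis)
  case Nil
  then show ?case by (auto intro: Nil(1)[of "\<lambda>_. a"])
next
  case (Cons l w)
  then obtain d where d: "d \<in> I" "joins w a d" "E l d b" by auto
  then obtain e where e: "e [] = a" "e w = d" "\<And>p. e p \<in> I"
    "\<And>l p. suffix (l # p) w \<Longrightarrow> E l (e p) (e (l # p))"
    using Cons.IH Cons.prems by metis
  show ?case
  proof (rule Cons.prems(1)[of "e(l # w := b)"])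
    show "E m ((e(l # w := b)) p) ((e(l # w := b)) (m # p))" if "suffix (m # p) (l # w)" for m p
    proof -
      have p: "p \<noteq> l # w" using suffix_length_le[OF that] by auto
      show ?thesis
      proof (cases "m # p = l # w")
        case True
        then show ?thesis using e(2) d(3) by simp
      next
        case False
        then have "suffix (m # p) w" using that by (auto simp: suffix_Cons)
        then have "E m (e p) (e (m # p))" by (rule e(4))
        then show ?thesis using p False by (metis fun_upd_other)
      qed
    qed
  qed (use e Cons.prems in auto)
qed

text \<open>If \<open>g\<close> left \<open>x\<close> by any other letter, it could be completed to
  a closed word \<open>u\<close> at \<open>x\<close> with the same first step and with
  \<open>u @ v\<close> reduced. Stabilizers commute, so \<open>v @ u\<close> acts in the same way;
  its reduced form is \<open>u @ v\<close> by faithfulness, and as no length is lost,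
  \<open>v @ u = u @ v\<close>. Then \<open>u\<close> and \<open>v\<close> end in the same letter, a
  contradiction.\<close>

lemma last_letter_of_return:
  assumes faithful: "\<And>w. w \<in> words \<Longrightarrow> (\<And>z. act w z = z) \<Longrightarrow> w = []"
    and commute: "\<And>v w z. \<lbrakk>v \<in> words; w \<in> words; act v x = x; act w x = x\<rbrakk> \<Longrightarrow> act (v @ w) z = act (w @ v) z"
    and v: "v \<in> words" "v \<noteq> []" "act v x = x"
    and s: "suffix s v" and g: "g \<in> words" "g \<noteq> []" "act g x = act s x"
  shows "last g = last v \<or> last g = linv (hd v)"
proof (rule ccontr)
  assume contra: "\<not> ?thesis"
  \<comment> \<open>For \<open>s = v\<close> the end point is \<open>x\<close> itself, and
    \<open>s\<close> is replaced by \<open>[]\<close> to make \<open>r\<close> nonempty.\<close>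
  obtain s r where s: "v = r @ s" "r \<noteq> []" "act g x = act s x"
  proof (cases "s = v")
    case True
    then show ?thesis using that[of v "[]"] v g by simp
  next
    case False
    then show ?thesis using that s g(3) by (auto simp: suffix_def)
  qed
  have rs: "r \<in> words" "s \<in> words" using v s words_appendD by blast+
  \<comment> \<open>\<open>g\<close> can be closed up forwards along \<open>r\<close> or backwards
    along \<open>s\<close>; since \<open>v\<close> is reduced, at most one of the two cancels
    against \<open>g\<close>.\<close>
  have "\<exists>u\<in>words. u \<noteq> [] \<and> last u = last g \<and> act u x = x"
  proof (cases "hd g = linv (last r)")
    case False
    then have "r @ g \<in> words" using rs g words_appendI by blast
    moreover have "act (r @ g) x = x" using s v by simp
    ultimately show ?thesis using g(2) by (intro bexI[of _ "r @ g"]) auto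
  next
    case True
    have "s = [] \<or> hd s \<noteq> linv (last r)"
      using v(1) s by (auto simp: words_def reduced_word_append)
    then have "winv s @ g \<in> words"
      using rs g True by (intro words_appendI) (auto simp: last_winv)
    moreover have "act (winv s @ g) x = x" using s by simp
    ultimately show ?thesis using g(2) by (intro bexI[of _ "winv s @ g"]) auto
  qed
  then obtain u where u: "u \<in> words" "u \<noteq> []" "last u = last g" "act u x = x" by blast
  have uv: "u @ v \<in> words"
    using u v contra by (intro words_appendI) (auto simp: linv_eq_iff)
  have "fst ` set (v @ u) \<subseteq> \<Lambda>" using u v by (auto simp: words_def)
  then obtain t where t: "t \<in> words" "\<And>z. act t z = act (v @ u) z" "t = v @ u \<or> length t < length (v @ u)"
    using reduce_act by blast
  have same: "act t z = act (u @ v) z" for z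
    using t(2) commute[OF v(1) u(1) v(3) u(4)] by simp
  have "t = u @ v"
  proof (rule ccontr)
    assume "t \<noteq> u @ v"
    obtain p t' w' where d: "t = p @ t'" "u @ v = p @ w'" and *: "t' = [] \<or> w' = [] \<or> hd t' \<noteq> hd w'"
      by (metis list.sel(1) longest_common_prefix neq_Nil_conv)
    have "act t' z = act w' z" for z
      using same[of z] unfolding d by simp
    then have "act (winv w' @ t') z = z" for z by simp
    moreover have "winv w' @ t' \<in> words"
      using * reduced_word_winv_append[of w' t'] t(1) uv d
      by (auto simp: words_def reduced_word_append image_Un)
    ultimately have "winv w' @ t' = []" using faithful by blast
    then show False using \<open>t \<noteq> u @ v\<close> d by auto
  qed
  then have "v @ u = u @ v" using t(3) by auto
  then have "last u = last v" using u v by (metis last_appendR)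
  then show False using contra u by simp
qed

text \<open>The core is one point of a free orbit, or else the cycle of a shortest nonempty closed
  word based anywhere in the orbit. \<open>loops\<close> colours the cycle, and
  \<open>last_letter_of_return\<close> supplies the hypothesis that no path returns to it from
  outside.\<close>

lemma colour_orbit:
  assumes faithful: "\<And>w. w \<in> words \<Longrightarrow> (\<And>z. act w z = z) \<Longrightarrow> w = []"
    and commute: "\<And>v w x z. \<lbrakk>x \<in> orbit y; v \<in> words; w \<in> words; act v x = x; act w x = x\<rbrakk> \<Longrightarrow>
      act (v @ w) z = act (w @ v) z"
    and loops: "\<And>w. w \<in> words \<Longrightarrow> w \<noteq> [] \<Longrightarrow> \<exists>a\<in>I. joins w a a"
  shows "\<exists>c. \<forall>x\<in>orbit y. c x \<in> I \<and> (\<forall>l. fst l \<in> \<Lambda> \<longrightarrow> E l (c x) (c (T l x)))"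
proof (cases "\<exists>x\<in>orbit y. \<exists>w\<in>words. w \<noteq> [] \<and> act w x = x")
  case False
  obtain a where a: "a \<in> I" using I_nonempty by blast
  have free: "w = []" if "w \<in> words" "act w y = y" for w using False that orbit_self by blast
  show ?thesis
  proof (rule colour_from_core[of "{y}" y "\<lambda>_. a"])
    \<comment> \<open>Vacuous: in a free orbit no letter fixes \<open>y\<close>.\<close>
    show "E l a a" if "x \<in> {y}" "fst l \<in> \<Lambda>" "T l x \<in> {y}" for x l
      using free[of "[l]"] that by auto
    show "T (last g) x \<in> {y}" if "x \<in> {y}" "g \<in> words" "g \<noteq> []" "act g x \<in> {y}" for x g
      using free[of g] that by auto
  qed (use a orbit_self in blast)+
next
  case True
  define cyc where "cyc x w \<longleftrightarrow> x \<in> orbit y \<and> w \<in> words \<and> w \<noteq> [] \<and> act w x = x" for x w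
  have "\<exists>n x w. length w = n \<and> cyc x w" using True unfolding cyc_def by blast
  then have "\<exists>n. (\<exists>x w. length w = n \<and> cyc x w) \<and> (\<forall>m<n. \<not> (\<exists>x w. length w = m \<and> cyc x w))"
    by (rule exists_least_iff[THEN iffD1])
  then obtain z w where w: "cyc z w" and least': "\<forall>m<length w. \<not> (\<exists>x w. length w = m \<and> cyc x w)"
    by blast
  have least: "length w \<le> length w'" if "cyc x' w'" for x' w'
    using least' that not_less by blast
  have wz: "z \<in> orbit y" "w \<in> words" "w \<noteq> []" "act w z = z" using w by (auto simp: cyc_def)
  have orb: "act p x \<in> orbit y" if "x \<in> orbit y" "p \<in> words" for p x
    using that orbit_eq[OF that(1)] nearI[OF that(2) order_refl, of x] by (auto simp: orbit_def)
  \<comment> \<open>A closed word \<open>linv l # w' @ [l]\<close> at \<open>z\<close> would give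
    the shorter closed word \<open>w'\<close> at \<open>T l z\<close>.\<close>
  have cyc_red: "hd w \<noteq> linv (last w)"
  proof
    assume *: "hd w = linv (last w)"
    define l where "l = last w"
    have "tl w \<noteq> []" using * wz(3) by (cases w) auto
    then obtain w' where w': "w = linv l # w' @ [l]"
      using * wz(3) unfolding l_def by (metis append_butlast_last_id last_tl list.collapse)
    then have "w' \<noteq> []" using wz(2) by (auto simp: words_def reduced_word_Cons)
    moreover have "act w' (T l z) = T l z" using wz(4) unfolding w' by (metis T_linv'(2) act_simps)
    moreover have "w' \<in> words" "[l] \<in> words"
      using wz(2) unfolding w' by (metis append_Cons append_Nil words_appendD)+
    ultimately have "cyc (T l z) w'" using orb[OF wz(1), of "[l]"] by (simp add: cyc_def)
    then show False using least w' by fastforce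
  qed
  define K where "K = {act p z |p. suffix p w}"
  have K_ex: "\<exists>p q. w = q @ p \<and> q \<noteq> [] \<and> x = act p z" if "x \<in> K" for x
  proof -
    obtain p q where pq: "w = q @ p" "x = act p z" using \<open>x \<in> K\<close> by (auto simp: K_def suffix_def)
    show ?thesis
    proof (cases "q = []")
      case True
      then have "x = act [] z" "w = w @ []" using pq wz(4) by simp_all
      then show ?thesis using wz(3) by blast
    qed (use pq in blast)
  qed
  have distinct_le: "p = p'" if eq: "act p z = act p' z" and p: "suffix p w" "suffix p' w" "p' \<noteq> w"
    and len: "length p \<le> length p'" for p p'
  proof -
    obtain q where q: "p' = q @ p"
      using suffix_length_suffix[OF p(1,2) len] by (auto simp: suffix_def)
    have p'w: "length p' < length w" using p by (auto simp: suffix_def)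
    have words: "p \<in> words" "q \<in> words"
      using p wz(2) words_suffix q words_appendD(1) by blast+
    have "act q (act p z) = act p z" using eq q by simp
    then have "q = []"
      using least[of "act p z" q] q p'w orb[OF wz(1) words(1)] words(2) by (auto simp: cyc_def)
    then show ?thesis using q by simp
  qed
  \<comment> \<open>Minimality makes the points of the cycle distinct, so that \<open>c0\<close>
    below is determined by the colouring \<open>e\<close> of the path.\<close>
  have distinct: "p = p'"
    if "act p z = act p' z" "suffix p w" "p \<noteq> w" "suffix p' w" "p' \<noteq> w" for p p'
    using distinct_le[of p p'] distinct_le[of p' p] that by (metis nat_le_linear)
  obtain a where "a \<in> I" "joins w a a" using loops wz by blast
  then obtain e where e: "e [] = a" "e w = a" "\<And>p. e p \<in> I"
    "\<And>l p. suffix (l # p) w \<Longrightarrow> E l (e p) (e (l # p))"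
    by (metis joins_path)
  define c0 where "c0 x = e (SOME p. suffix p w \<and> p \<noteq> w \<and> x = act p z)" for x
  have c0': "c0 (act p z) = e p" if "suffix p w" "p \<noteq> w" for p
  proof -
    have "(SOME p'. suffix p' w \<and> p' \<noteq> w \<and> act p z = act p' z) = p"
      by (rule some_equality) (use that distinct in auto)
    then show ?thesis by (simp add: c0_def)
  qed
  have c0: "c0 (act p z) = e p" if "suffix p w" for p
    using c0'[OF that] c0'[of "[]"] wz e by (cases "p = w") auto
  \<comment> \<open>Any point of \<open>K\<close> can serve as base point: \<open>p @ q\<close> is
    the same cycle read from \<open>act p z\<close>.\<close>
  have rotate: "p @ q \<in> words \<and> act (p @ q) (act p z) = act p z \<and>
      (\<forall>x'. x' \<in> K \<longleftrightarrow> (\<exists>s. suffix s (p @ q) \<and> x' = act s (act p z)))"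
    if pq: "w = q @ p" "q \<noteq> []" for p q
  proof (intro conjI allI iffI)
    show "p @ q \<in> words"
      using wz(2,3) cyc_red pq by (cases "p = []") (auto simp: words_def reduced_word_append)
    show "act (p @ q) (act p z) = act p z" using wz(4) pq by simp
    have q_back: "act q (act p z) = z" using wz(4) pq by simp
    fix x'
    show "\<exists>s. suffix s (p @ q) \<and> x' = act s (act p z)" if "x' \<in> K"
    proof -
      obtain p' where p': "suffix p' w" "x' = act p' z" using \<open>x' \<in> K\<close> by (auto simp: K_def)
      show ?thesis
      proof (cases "suffix p' p")
        case True
        then have "suffix (p' @ q) (p @ q)" by (auto simp: suffix_def)
        moreover have "x' = act (p' @ q) (act p z)" using p' q_back by simp
        ultimately show ?thesis by blast
      next
        case False
        then obtain s where "p' = s @ p" "suffix s q" using p'(1) pq(1) by (auto simp: suffix_append)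
        then show ?thesis using p' by (intro exI[of _ s]) (auto simp: suffix_append)
      qed
    qed
    show "x' \<in> K" if ex_s: "\<exists>s. suffix s (p @ q) \<and> x' = act s (act p z)"
    proof -
      obtain s where s: "suffix s (p @ q)" "x' = act s (act p z)" using ex_s by blast
      show ?thesis
      proof (cases "suffix s q")
        case True
        then have "suffix (s @ p) w" using pq by (auto simp: suffix_def)
        then show ?thesis using s by (auto simp: K_def intro!: exI[of _ "s @ p"])
      next
        case False
        then obtain s' where "s = s' @ q" "suffix s' p" using s(1) by (auto simp: suffix_append)
        then have "x' = act s' z" "suffix s' w" using s q_back pq by (auto simp: suffix_append)
        then show ?thesis by (auto simp: K_def)
      qed
    qed
  qed
  have letters: "last g = last (p @ q) \<or> last g = linv (hd (p @ q))"
    if pq: "w = q @ p" "q \<noteq> []" and g: "g \<in> words" "g \<noteq> []" "act g (act p z) \<in> K" for p q g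
  proof -
    note rot = rotate[OF pq]
    obtain s where s: "suffix s (p @ q)" "act g (act p z) = act s (act p z)"
      using rot g(3) by blast
    have "p \<in> words" using wz(2) pq words_appendD by blast
    show ?thesis
    proof (rule last_letter_of_return[OF faithful, of "act p z" "p @ q" s g])
      show "act (v @ u) x = act (u @ v) x"
        if "v \<in> words" "u \<in> words" "act v (act p z) = act p z" "act u (act p z) = act p z" for v u x
        by (rule commute[OF orb[OF wz(1) \<open>p \<in> words\<close>] that])
    qed (use rot pq g s in auto)
  qed
  show ?thesis
  proof (rule colour_from_core[of K y c0])
    show "K \<subseteq> orbit y" using orb[OF wz(1)] words_suffix[OF wz(2)] by (auto simp: K_def)
    show "K \<noteq> {}" by (auto simp: K_def)
    show "c0 x \<in> I" for x using e by (simp add: c0_def)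
    show "T (last g) x \<in> K" if x: "x \<in> K" and g: "g \<in> words" "g \<noteq> []" "act g x \<in> K" for x g
    proof -
      obtain p q where pq: "w = q @ p" "q \<noteq> []" "x = act p z" using K_ex[OF x] by blast
      note rot = rotate[OF pq(1,2)]
      from letters[OF pq(1,2) g(1,2)] g(3) pq(3)
      have "last g = last (p @ q) \<or> last g = linv (hd (p @ q))" by simp
      then show ?thesis
      proof
        assume "last g = last (p @ q)"
        moreover have "suffix [last (p @ q)] (p @ q)"
          using pq(2) by (metis append_butlast_last_id append_is_Nil_conv suffixI)
        ultimately have "\<exists>s. suffix s (p @ q) \<and> T (last g) x = act s (act p z)"
          using pq(3) by (intro exI[of _ "[last (p @ q)]"]) simp
        then show ?thesis using rot by blast
      next
        assume l: "last g = linv (hd (p @ q))"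
        have "p @ q = hd (p @ q) # tl (p @ q)" using pq(2) by simp
        then have "act (hd (p @ q) # tl (p @ q)) x = x" using rot pq(3) by metis
        then have "T (last g) x = act (tl (p @ q)) x" unfolding l by (metis T_linv act_simps(2))
        moreover have "suffix (tl (p @ q)) (p @ q)" by (rule suffix_tl)
        ultimately have "\<exists>s. suffix s (p @ q) \<and> T (last g) x = act s (act p z)"
          using pq(3) by blast
        then show ?thesis using rot by blast
      qed
    qed
    show "E l (c0 x) (c0 (T l x))" if x: "x \<in> K" and l: "fst l \<in> \<Lambda>" "T l x \<in> K" for x l
    proof -
      obtain p q where pq: "w = q @ p" "q \<noteq> []" "x = act p z" using K_ex[OF x] by blast
      have "l = last (p @ q) \<or> l = linv (hd (p @ q))"
        using letters[OF pq(1,2), of "[l]"] l pq(3) by simp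
      then show ?thesis
      proof
        assume "l = last (p @ q)"
        then have "q = butlast q @ [l]" using pq(2) by simp
        then have suf: "suffix (l # p) w" using pq(1) by (metis append.assoc append_Cons append_Nil suffixI)
        then have "c0 (T l x) = e (l # p)" using c0[of "l # p"] pq(3) by simp
        moreover have "c0 x = e p" using c0 pq by (auto simp: suffix_def)
        ultimately show ?thesis using e(4)[OF suf] by simp
      next
        assume lh: "l = linv (hd (p @ q))"
        show ?thesis
        proof (cases p)
          case Nil
          then obtain w2 where w2: "w = linv l # w2" using pq lh by (cases w) auto
          then have "T (linv l) (act w2 z) = x" using wz(4) pq(3) Nil by simp
          then have "T l x = act w2 z" by auto
          then have "c0 (T l x) = e w2" using c0[of w2] w2 by (simp add: suffix_Cons)
          moreover have "c0 x = e w" using c0[of "[]"] pq Nil e by simp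
          moreover have "E (linv l) (e w2) (e w)" using e(4)[of "linv l" w2] w2 by simp
          ultimately show ?thesis by (simp add: E_linv)
        next
          case (Cons l2 p2)
          then have l2: "l2 = linv l" using lh by simp
          have suf: "suffix (l2 # p2) w" "suffix p2 w" using pq Cons by (auto simp: suffix_def)
          have "T l x = act p2 z" using pq(3) Cons l2 by simp
          then have "c0 (T l x) = e p2" using c0[OF suf(2)] by simp
          moreover have "c0 x = e (l2 # p2)" using c0[OF suf(1)] pq(3) Cons by metis
          ultimately show ?thesis using e(4)[OF suf(1)] l2 by (simp add: E_linv)
        qed
      qed
    qed
  qed blast
qed

theorem total_colouring:
  assumes faithful: "\<And>w. w \<in> words \<Longrightarrow> (\<And>z. act w z = z) \<Longrightarrow> w = []"
    and T_P: "\<And>l x. x \<in> P \<Longrightarrow> T l x \<in> P"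
    and commute: "\<And>v w x z. \<lbrakk>x \<in> P; v \<in> words; w \<in> words; act v x = x; act w x = x\<rbrakk> \<Longrightarrow>
      act (v @ w) z = act (w @ v) z"
    and loops: "\<And>w. w \<in> words \<Longrightarrow> w \<noteq> [] \<Longrightarrow> \<exists>a\<in>I. joins w a a"
  obtains c where "\<And>x. x \<in> P \<Longrightarrow> c x \<in> I" "\<And>x l. x \<in> P \<Longrightarrow> fst l \<in> \<Lambda> \<Longrightarrow> E l (c x) (c (T l x))"
proof -
  define ok where "ok Q c \<longleftrightarrow> (\<forall>x\<in>Q. c x \<in> I \<and> (\<forall>l. fst l \<in> \<Lambda> \<longrightarrow> E l (c x) (c (T l x))))" for Q c
  \<comment> \<open>The choice depends on the orbit as a set, so both ends of an edge use the same
    colouring.\<close>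
  define F where "F Q = (SOME c. ok Q c)" for Q
  have ok: "ok (orbit y) (F (orbit y))" if "y \<in> P" for y
    unfolding F_def
  proof (rule someI_ex[of "ok (orbit y)"])
    have "act w y \<in> P" for w using that by (induction w) (auto intro: T_P)
    then have orb: "x \<in> P" if "x \<in> orbit y" for x using that by (auto simp: orbit_def near_def)
    show "\<exists>c. ok (orbit y) c"
      unfolding ok_def
      by (rule colour_orbit[OF faithful _ loops]) (use commute orb in blast)+
  qed
  show thesis
  proof (rule that[of "\<lambda>x. F (orbit x) x"])
    show "F (orbit x) x \<in> I" if "x \<in> P" for x
      using ok[OF that] orbit_self unfolding ok_def by blast
    show "E l (F (orbit x) x) (F (orbit (T l x)) (T l x))" if "x \<in> P" "fst l \<in> \<Lambda>" for x l
    proof -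
      have "E l (F (orbit x) x) (F (orbit x) (T l x))"
        using ok[OF that(1)] orbit_self that(2) unfolding ok_def by blast
      then show ?thesis using orbit_eq[OF T_orbit[OF that(2), of x]] by simp
    qed
  qed
qed

end

section \<open>Rotations\<close>

declare transpose_matrix_vector [simp del]

lemma rotation_matrix_mult: "rotation_matrix A \<Longrightarrow> rotation_matrix B \<Longrightarrow> rotation_matrix (A ** B)"
  for A B :: "real^'n^'n"
  by (simp add: rotation_matrix_def orthogonal_matrix_mul det_mul)

lemma rotation_matrix_transpose: "rotation_matrix A \<Longrightarrow> rotation_matrix (transpose A)"
  by (simp add: rotation_matrix_def orthogonal_matrix_transpose)

lemma rotation_matrix_one: "rotation_matrix (mat 1)"
  by (simp add: rotation_matrix_def orthogonal_matrix_id)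

lemma rotation_matrix_cancel:
  fixes A :: "real^'n^'n"
  assumes "rotation_matrix A"
  shows "transpose A ** A = mat 1" "A ** transpose A = mat 1"
    "transpose A *v (A *v x) = x" "A *v (transpose A *v x) = x"
  using assms by (simp_all add: rotation_matrix_def orthogonal_matrix_def matrix_vector_mul_assoc)

lemma norm_rotation: "rotation_matrix A \<Longrightarrow> norm (A *v x) = norm x" for A :: "real^'n^'n"
  using orthogonal_transformation_matrix[of "(*v) A"]
  by (simp add: rotation_matrix_def orthogonal_transformation_norm)

lemma dist_rotation: "rotation_matrix A \<Longrightarrow> dist (A *v x) (A *v y) = dist x y" for A :: "real^'n^'n"
  by (simp add: dist_norm norm_rotation flip: matrix_vector_mult_diff_distrib)

lemma rotation_sphere: "rotation_matrix A \<Longrightarrow> A *v x \<in> S2 \<longleftrightarrow> x \<in> S2"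
  by (simp add: norm_rotation)

lemma rotation_image_eqI:
  fixes Q :: "real^'n^'n"
  assumes "rotation_matrix Q" "\<And>x. x \<in> A \<longleftrightarrow> Q *v x \<in> B"
  shows "(*v) Q ` A = B"
proof (intro equalityI subsetI)
  fix x assume "x \<in> B"
  then have "Q *v (transpose Q *v x) \<in> B" by (simp add: rotation_matrix_cancel[OF assms(1)])
  then have "transpose Q *v x \<in> A" using assms(2) by blast
  then show "x \<in> (*v) Q ` A"
    using rotation_matrix_cancel(4)[OF assms(1), of x] by (metis image_eqI)
qed (use assms(2) in blast)

lemma SO3_simps [simp]: "carrier SO3 = {Q. rotation_matrix Q}" "\<one>\<^bsub>SO3\<^esub> = mat 1"
  "x \<otimes>\<^bsub>SO3\<^esub> y = x ** y"
  by (simp_all add: SO3_def)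

lemma group_SO3: "group SO3"
proof (rule groupI)
  show "\<exists>y\<in>carrier SO3. y \<otimes>\<^bsub>SO3\<^esub> x = \<one>\<^bsub>SO3\<^esub>" if "x \<in> carrier SO3" for x
    using that rotation_matrix_cancel(1) rotation_matrix_transpose by auto
qed (auto simp: rotation_matrix_mult rotation_matrix_one matrix_mul_assoc)

lemma inv_SO3: "rotation_matrix A \<Longrightarrow> inv\<^bsub>SO3\<^esub> A = transpose A"
  by (rule group.inv_equality[OF group_SO3])
    (simp_all add: rotation_matrix_cancel rotation_matrix_transpose)

lemma homeomorphic_map_rotation:
  assumes "rotation_matrix A"
  shows "homeomorphic_map (top_of_set S2) (top_of_set S2) ((*v) A)"
proof -
  have cont: "continuous_on S2 ((*v) B)" for B :: "real^3^3"
    by (intro linear_continuous_on linear_conv_bounded_linear[THEN iffD1] matrix_vector_mul_linear)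
  have "homeomorphic_maps (top_of_set S2) (top_of_set S2) ((*v) A) ((*v) (transpose A))"
    using assms rotation_matrix_transpose[OF assms] unfolding homeomorphic_maps_def
    by (auto simp: cont rotation_matrix_cancel norm_rotation)
  then show ?thesis using homeomorphic_map_maps by blast
qed

section \<open>Rotations about a common axis\<close>

definition rot_z :: "real \<Rightarrow> real^3^3" where
  "rot_z t = vector [vector [cos t, - sin t, 0], vector [sin t, cos t, 0], vector [0, 0, 1]]"

lemma rot_z_entries [simp]:
  "rot_z t $ 1 $ 1 = cos t" "rot_z t $ 1 $ 2 = - sin t" "rot_z t $ 1 $ 3 = 0"
  "rot_z t $ 2 $ 1 = sin t" "rot_z t $ 2 $ 2 = cos t" "rot_z t $ 2 $ 3 = 0"
  "rot_z t $ 3 $ 1 = 0" "rot_z t $ 3 $ 2 = 0" "rot_z t $ 3 $ 3 = 1"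
  by (simp_all add: rot_z_def vector_3)

lemma rot_z_mult: "rot_z s ** rot_z t = rot_z (s + t)"
  by (simp add: vec_eq_iff forall_3 matrix_matrix_mult_def sum_3 cos_add sin_add)

lemma rot_z_0: "rot_z 0 = mat 1"
  by (simp add: vec_eq_iff forall_3 mat_def)

lemma rotation_fixing_axis:
  fixes Q :: "real^3^3"
  assumes Q: "rotation_matrix Q" and fix3: "Q *v axis 3 1 = axis 3 1"
  obtains t where "Q = rot_z t"
proof -
  have col: "Q $ 1 $ 3 = 0" "Q $ 2 $ 3 = 0" "Q $ 3 $ 3 = 1"
    using fix3 by (simp_all add: vec_eq_iff forall_3 matrix_vector_mult_def sum_3 axis_def)
  have "transpose Q *v axis 3 1 = axis 3 1"
    using rotation_matrix_cancel(3)[OF Q, of "axis 3 1"] fix3 by simp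
  then have row: "Q $ 3 $ 1 = 0" "Q $ 3 $ 2 = 0"
    by (simp_all add: vec_eq_iff forall_3 matrix_vector_mult_def sum_3 axis_def transpose_def)
  have orth: "(Q $ 1 $ 1)\<^sup>2 + (Q $ 2 $ 1)\<^sup>2 = 1" "(Q $ 1 $ 2)\<^sup>2 + (Q $ 2 $ 2)\<^sup>2 = 1"
    using rotation_matrix_cancel(1)[OF Q] row
    by (simp_all add: vec_eq_iff forall_3 matrix_matrix_mult_def sum_3 transpose_def mat_def power2_eq_square)
  have "det Q = 1" using Q by (simp add: rotation_matrix_def)
  then have det: "Q $ 1 $ 1 * Q $ 2 $ 2 - Q $ 1 $ 2 * Q $ 2 $ 1 = 1"
    using col row by (simp add: det_3)
  \<comment> \<open>The two columns contribute 1 each, and the cross terms are -2 times the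
    determinant of the block.\<close>
  have "(Q $ 1 $ 1 - Q $ 2 $ 2)\<^sup>2 + (Q $ 1 $ 2 + Q $ 2 $ 1)\<^sup>2 = 0"
    using orth det by (simp add: power2_eq_square algebra_simps)
  then have eq: "Q $ 2 $ 2 = Q $ 1 $ 1" "Q $ 1 $ 2 = - Q $ 2 $ 1"
    by (simp_all add: sum_power2_eq_zero_iff)
  obtain t where t: "Q $ 1 $ 1 = cos t" "Q $ 2 $ 1 = sin t"
    using sincos_total_2pi orth(1) by metis
  have "Q = rot_z t"
    using t eq col row by (simp add: vec_eq_iff forall_3)
  then show thesis by (rule that)
qed

lemma rotation_about:
  fixes x :: "real^3"
  assumes "norm x = 1"
  obtains P where "rotation_matrix P"
    "\<And>Q. rotation_matrix Q \<Longrightarrow> Q *v x = x \<Longrightarrow> \<exists>t. Q = P ** rot_z t ** transpose P"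
proof -
  obtain P where P: "rotation_matrix P" "P *v axis 3 1 = x"
    using rotation_matrix_exists_basis[of x 3] assms by auto
  have "\<exists>t. Q = P ** rot_z t ** transpose P" if Q: "rotation_matrix Q" "Q *v x = x" for Q
  proof -
    have "rotation_matrix (transpose P ** Q ** P)"
      using P Q by (intro rotation_matrix_mult rotation_matrix_transpose)
    moreover have "(transpose P ** Q ** P) *v axis 3 1 = axis 3 1"
      using P Q rotation_matrix_cancel(3)[OF P(1), of "axis 3 1"]
      by (simp flip: matrix_vector_mul_assoc)
    ultimately obtain t where "transpose P ** Q ** P = rot_z t"
      using rotation_fixing_axis by blast
    then have "P ** rot_z t ** transpose P = (P ** transpose P) ** Q ** (P ** transpose P)"
      by (metis matrix_mul_assoc)
    then show ?thesis using rotation_matrix_cancel(2)[OF P(1)] by auto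
  qed
  with P(1) show thesis by (rule that)
qed

lemma rotations_fixing_point_commute:
  fixes x :: "real^3"
  assumes "norm x = 1" "rotation_matrix Q" "rotation_matrix R" "Q *v x = x" "R *v x = x"
  shows "Q ** R = R ** Q"
proof -
  obtain P where P: "rotation_matrix P"
    "\<And>Q. rotation_matrix Q \<Longrightarrow> Q *v x = x \<Longrightarrow> \<exists>t. Q = P ** rot_z t ** transpose P"
    using rotation_about[OF assms(1)] by metis
  obtain s t where st: "Q = P ** rot_z s ** transpose P" "R = P ** rot_z t ** transpose P"
    using P assms by meson
  have "(P ** rot_z s ** transpose P) ** (P ** rot_z t ** transpose P) = P ** rot_z (s + t) ** transpose P" for s t
  proof -
    have "(P ** rot_z s ** transpose P) ** (P ** rot_z t ** transpose P)
        = P ** rot_z s ** (transpose P ** P) ** rot_z t ** transpose P"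
      by (simp add: matrix_mul_assoc)
    then show ?thesis
      using rotation_matrix_cancel(1)[OF P(1)] by (simp add: rot_z_mult flip: matrix_mul_assoc)
  qed
  then show ?thesis unfolding st by (simp add: add.commute)
qed

text \<open>If \<open>Q\<close> fixed \<open>U\<close> pointwise: moving from a point
  \<open>x\<close> of \<open>U\<close> slightly in any direction \<open>y\<close> stays in
  \<open>U\<close> after normalization, so \<open>Q\<close> would fix \<open>y\<close> too by
  linearity.\<close>

lemma rotation_moves_open:
  fixes Q :: "real^3^3"
  assumes "Q \<noteq> mat 1" "openin (top_of_set S2) U" "U \<noteq> {}"
  shows "\<exists>x\<in>U. Q *v x \<noteq> x"
proof (rule ccontr)
  assume "\<not> ?thesis"
  then have fixes_U: "\<And>x. x \<in> U \<Longrightarrow> Q *v x = x" by blast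
  obtain V where V: "open V" "U = S2 \<inter> V" using assms(2) unfolding openin_open by blast
  obtain x where x: "x \<in> U" using assms(3) by blast
  have "Q *v y = y" for y
  proof -
    define f where "f t = (x + t *\<^sub>R y) /\<^sub>R norm (x + t *\<^sub>R y)" for t :: real
    have "norm x = 1" "f 0 = x" using x V by (auto simp: f_def)
    then have "(f \<longlongrightarrow> x) (at 0)"
      unfolding f_def by (auto intro!: tendsto_eq_intros)
    then have "\<forall>\<^sub>F t in at 0. f t \<in> V"
      using V x by (auto intro: topological_tendstoD)
    moreover have "\<forall>\<^sub>F t in at 0. norm (x + t *\<^sub>R y) \<noteq> 0"
    proof -
      have "((\<lambda>t. norm (x + t *\<^sub>R y)) \<longlongrightarrow> 1) (at 0)"
        using \<open>norm x = 1\<close> by (auto intro!: tendsto_eq_intros)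
      then show ?thesis by (rule tendsto_imp_eventually_ne) simp
    qed
    moreover have "\<forall>\<^sub>F t in at (0::real). t \<noteq> 0" by (simp add: eventually_at_filter)
    ultimately have "\<forall>\<^sub>F t in at 0. f t \<in> V \<and> norm (x + t *\<^sub>R y) \<noteq> 0 \<and> t \<noteq> 0"
      by eventually_elim simp
    then obtain t where t: "f t \<in> V" "norm (x + t *\<^sub>R y) \<noteq> 0" "t \<noteq> 0"
      using eventually_happens'[of "at (0::real)"] by auto
    then have "f t \<in> U" using V by (simp add: f_def)
    then have "Q *v (x + t *\<^sub>R y) = x + t *\<^sub>R y"
      using fixes_U[of "f t"] t(2) by (simp add: f_def matrix_vector_mult_scaleR)
    then have "t *\<^sub>R (Q *v y) = t *\<^sub>R y"
      using fixes_U[OF x] by (simp add: matrix_vector_right_distrib matrix_vector_mult_scaleR)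
    then show ?thesis using t(3) by simp
  qed
  then have "Q = mat 1"
    by (metis matrix_eq matrix_vector_mul_lid)
  then show False using assms(1) by simp
qed

section \<open>Recurrence of the powers of a rotation\<close>

lemma rotation_funpow: "rotation_matrix Q \<Longrightarrow> \<exists>R. rotation_matrix R \<and> ((*v) Q ^^ n) = (*v) R"
  for Q :: "real^'n^'n"
proof (induction n)
  case 0
  then show ?case using rotation_matrix_one by (intro exI[of _ "mat 1"]) (auto simp: fun_eq_iff)
next
  case (Suc n)
  then obtain R where "rotation_matrix R" "((*v) Q ^^ n) = (*v) R" by blast
  then show ?case using Suc.prems rotation_matrix_mult
    by (intro exI[of _ "Q ** R"]) (auto simp: fun_eq_iff matrix_vector_mul_assoc)
qed

text \<open>By compactness two powers of \<open>Q\<close> send \<open>x\<close> to nearby points;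
  applying the inverse of the smaller power, an isometry, leaves a positive power.\<close>

lemma rotation_recurrence:
  fixes Q :: "real^3^3"
  assumes Q: "rotation_matrix Q" and x: "x \<in> S2" and "e > 0"
  obtains j where "j \<ge> 1" "dist (((*v) Q ^^ j) x) x < e"
proof -
  let ?f = "\<lambda>n. ((*v) Q ^^ n) x"
  have "?f n \<in> S2" for n
    using rotation_funpow[OF Q, of n] rotation_sphere x by metis
  then have "range ?f \<subseteq> S2" by auto
  then obtain l r where r: "strict_mono (r :: nat \<Rightarrow> nat)" "(?f \<circ> r) \<longlonglongrightarrow> l"
    using compact_sphere[of "0::real^3" 1] unfolding compact_def by (metis range_subsetD)
  then have "Cauchy (?f \<circ> r)" by (meson LIMSEQ_imp_Cauchy)
  then obtain M where M: "\<And>m n. m \<ge> M \<Longrightarrow> n \<ge> M \<Longrightarrow> dist ((?f \<circ> r) m) ((?f \<circ> r) n) < e"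
    using \<open>e > 0\<close> unfolding Cauchy_def by blast
  define i where "i = r M"
  define j where "j = r (Suc M) - r M"
  have lt: "r M < r (Suc M)" using r(1) by (simp add: strict_mono_Suc_iff)
  obtain R where R: "rotation_matrix R" "((*v) Q ^^ i) = (*v) R" using rotation_funpow[OF Q] by metis
  have "?f (r (Suc M)) = ((*v) Q ^^ i) (((*v) Q ^^ j) x)"
    using lt by (simp add: i_def j_def flip: funpow_add comp_apply[of "(*v) Q ^^ _" "(*v) Q ^^ _"])
  then have "dist (?f (r (Suc M))) (?f (r M)) = dist (((*v) Q ^^ j) x) x"
    using R by (simp add: dist_rotation i_def)
  then have "dist (((*v) Q ^^ j) x) x < e" using M[of "Suc M" M] by simp
  then show thesis using that[of j] lt by (simp add: j_def)
qed

lemma rotation_axis: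
  fixes Q :: "real^3^3"
  assumes "rotation_matrix Q"
  obtains v where "norm v = 1" "Q *v v = v"
proof -
  \<comment> \<open>in odd dimension, \<open>det (Q - 1) = det (Q (1 - Q\<^sup>T)) = det (1 - Q) = - det (Q - 1)\<close>\<close>
  have neg: "det (- A) = - det A" for A :: "real^3^3" by (simp add: det_3)
  have "transpose (mat 1 - Q) = mat 1 - transpose Q"
    by (auto simp: vec_eq_iff transpose_def mat_def)
  then have "Q ** transpose (mat 1 - Q) = Q - mat 1"
    by (simp add: matrix_eq matrix_vector_mult_diff_rdistrib matrix_vector_mult_diff_distrib
        rotation_matrix_cancel[OF assms] flip: matrix_vector_mul_assoc)
  then have "det (Q - mat 1) = det Q * det (mat 1 - Q)"
    by (metis det_mul det_transpose)
  also have "\<dots> = - det (Q - mat 1)"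
    using assms neg[of "Q - mat 1"] by (simp add: rotation_matrix_def)
  finally have "det (Q - mat 1) = 0" by simp
  then have "\<not> invertible (Q - mat 1)" by (simp add: invertible_det_nz)
  then obtain v where v: "v \<noteq> 0" "(Q - mat 1) *v v = 0"
    by (metis invertible_left_inverse matrix_left_invertible_ker)
  then have "Q *v v = v" by (simp add: matrix_vector_mult_diff_rdistrib)
  then have "Q *v (v /\<^sub>R norm v) = v /\<^sub>R norm v" "norm (v /\<^sub>R norm v) = 1"
    using v by (simp_all add: matrix_vector_mult_scaleR)
  then show thesis using that by blast
qed

text \<open>Let \<open>Q\<close> turn by \<open>2 * pi * s\<close>. Infinite order makes
  \<open>2 * s\<close> irrational, so some positive multiple \<open>k * (2 * s)\<close> is close to
  \<open>s\<close> modulo integers. Then \<open>(2 * k - 1) * s\<close> is nearly an integer, with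
  an odd factor. A half turn shows why other rotations of finite order must be excluded.\<close>

lemma odd_rotation_recurrence:
  fixes Q :: "real^3^3"
  assumes Q: "rotation_matrix Q" and order: "Q = mat 1 \<or> (\<forall>n\<ge>1. ((*v) Q ^^ n) \<noteq> id)" and "e > 0"
  obtains j where "odd j" "dist (((*v) Q ^^ j) x) x < e"
proof (cases "Q = mat 1")
  case True
  then show thesis using that[of 1] \<open>e > 0\<close> by simp
next
  case False
  obtain v where v: "norm v = 1" "Q *v v = v" using rotation_axis[OF Q] by blast
  obtain P t where P: "rotation_matrix P" and Qt: "Q = P ** rot_z t ** transpose P"
    using rotation_about[OF v(1)] Q v(2) by metis
  have Qn: "((*v) Q ^^ n) y = P *v (rot_z (real n * t) *v (transpose P *v y))" for n y
  proof (induction n)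
    case 0
    then show ?case by (simp add: rot_z_0 rotation_matrix_cancel[OF P])
  next
    case (Suc n)
    have "((*v) Q ^^ Suc n) y
        = P *v (rot_z t *v (transpose P *v (P *v (rot_z (real n * t) *v (transpose P *v y)))))"
      using Suc by (simp add: Qt matrix_vector_mul_assoc matrix_mul_assoc)
    also have "\<dots> = P *v (rot_z (t + real n * t) *v (transpose P *v y))"
      by (simp add: rotation_matrix_cancel(3)[OF P]) (simp add: matrix_vector_mul_assoc rot_z_mult matrix_mul_assoc flip: rot_z_mult)
    finally show ?case by (simp add: algebra_simps)
  qed
  define s where "s = t / (2 * pi)"
  have "2 * s \<notin> \<rat>"
  proof
    assume "2 * s \<in> \<rat>"
    then obtain m :: int and n where n: "n > 0" "2 * s = of_int m / of_int n"
      by (metis Rats_cases')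
    then have eq: "real (nat (2 * n)) * t = 2 * pi * of_int m"
      by (simp add: s_def field_simps)
    have "rot_z (real (nat (2 * n)) * t) = mat 1"
      unfolding eq by (simp add: vec_eq_iff forall_3 mat_def cos_int_2pin sin_int_2pin)
    then have "((*v) Q ^^ nat (2 * n)) = id"
      by (auto simp: fun_eq_iff Qn rotation_matrix_cancel[OF P])
    then show False using order False n(1) by auto
  qed
  define g where "g u = P *v (rot_z (2 * pi * u) *v (transpose P *v x))" for u
  have "isCont g 0"
    unfolding g_def rot_z_def matrix_vector_mult_def isCont_def
    by (rule vec_tendstoI, simp add: sum_3 vector_3) (auto intro!: tendsto_eq_intros)
  moreover have "g 0 = x" by (simp add: g_def rot_z_0 rotation_matrix_cancel[OF P])
  ultimately obtain d where d: "d > 0" "\<And>u. \<bar>u\<bar> < d \<Longrightarrow> dist (g u) x < e"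
    using \<open>e > 0\<close> unfolding continuous_at_eps_delta by (metis diff_zero dist_real_def)
  obtain h k :: int where hk: "k > 0" "\<bar>of_int k * (2 * s) - of_int h - s\<bar> < d"
    using sequence_of_fractional_parts_is_dense[OF \<open>2 * s \<notin> \<rat>\<close> d(1)] by blast
  define j where "j = nat (2 * k - 1)"
  have "odd j" using hk(1) by (simp add: j_def even_nat_iff)
  have "real j * t = 2 * pi * (of_int k * (2 * s) - of_int h - s) + 2 * pi * of_int h"
    using hk(1) by (simp add: j_def s_def field_simps)
  then have "rot_z (real j * t) = rot_z (2 * pi * (of_int k * (2 * s) - of_int h - s))"
    by (simp add: vec_eq_iff forall_3 cos_add sin_add cos_int_2pin sin_int_2pin)
  then have "((*v) Q ^^ j) x = g (of_int k * (2 * s) - of_int h - s)"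
    by (simp add: Qn g_def)
  then show thesis using that[OF \<open>odd j\<close>] d(2)[OF hk(2)] by simp
qed

section \<open>Free groups of rotations\<close>

definition letter_mat :: "('a \<Rightarrow> real^3^3) \<Rightarrow> 'a \<times> bool \<Rightarrow> real^3^3" where
  "letter_mat \<rho> l = (if snd l then \<rho> (fst l) else transpose (\<rho> (fst l)))"

primrec word_mat :: "('a \<Rightarrow> real^3^3) \<Rightarrow> ('a \<times> bool) list \<Rightarrow> real^3^3" where
  "word_mat \<rho> [] = mat 1"
| "word_mat \<rho> (l # w) = letter_mat \<rho> l ** word_mat \<rho> w"

lemma word_mat_append: "word_mat \<rho> (v @ w) = word_mat \<rho> v ** word_mat \<rho> w"
  by (induction v) (simp_all add: matrix_mul_assoc)

lemma rotation_letter_mat: "(\<And>j. rotation_matrix (\<rho> j)) \<Longrightarrow> rotation_matrix (letter_mat \<rho> l)"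
  by (simp add: letter_mat_def rotation_matrix_transpose)

lemma rotation_word_mat: "(\<And>j. rotation_matrix (\<rho> j)) \<Longrightarrow> rotation_matrix (word_mat \<rho> w)"
  by (induction w) (simp_all add: rotation_matrix_one rotation_matrix_mult rotation_letter_mat)

lemma letter_mat_linv: "(\<And>j. rotation_matrix (\<rho> j)) \<Longrightarrow> letter_mat \<rho> l ** letter_mat \<rho> (linv l) = mat 1"
  by (simp add: letter_mat_def rotation_matrix_cancel)

section \<open>Two free rotations, by reduction modulo 5\<close>

definition base_rot :: "bool \<Rightarrow> real^3^3" where
  "base_rot z = (if z then vector [vector [3/5, -4/5, 0], vector [4/5, 3/5, 0], vector [0, 0, 1]]
    else vector [vector [1, 0, 0], vector [0, 3/5, -4/5], vector [0, 4/5, 3/5]])"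

lemma rotation_base: "rotation_matrix (base_rot z)"
  unfolding rotation_matrix_def orthogonal_matrix
  by (auto simp: base_rot_def det_3 vector_3 vec_eq_iff forall_3 matrix_matrix_mult_def sum_3
      transpose_def mat_def)

text \<open>Five times the matrices with cosine 3/5 and sine 4/5, so that words act on integer
  vectors and can be followed modulo 5.\<close>

fun scaled_step :: "bool \<times> bool \<Rightarrow> int \<times> int \<times> int \<Rightarrow> int \<times> int \<times> int" where
  "scaled_step (True, True) (x, y, z) = (3 * x - 4 * y, 4 * x + 3 * y, 5 * z)"
| "scaled_step (True, False) (x, y, z) = (3 * x + 4 * y, 3 * y - 4 * x, 5 * z)"
| "scaled_step (False, True) (x, y, z) = (5 * x, 3 * y - 4 * z, 4 * y + 3 * z)"
| "scaled_step (False, False) (x, y, z) = (5 * x, 3 * y + 4 * z, 3 * z - 4 * y)"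

text \<open>Modulo 5, the matrix of each letter, scaled by 5, has rank one; \<open>image_class l\<close> is its image
  without zero. It is killed only by the inverse letter.\<close>

fun image_class :: "bool \<times> bool \<Rightarrow> int \<times> int \<times> int \<Rightarrow> bool" where
  "image_class (True, True) (x, y, z) \<longleftrightarrow> 5 dvd y - 3 * x \<and> 5 dvd z \<and> \<not> 5 dvd x"
| "image_class (True, False) (x, y, z) \<longleftrightarrow> 5 dvd y - 2 * x \<and> 5 dvd z \<and> \<not> 5 dvd x"
| "image_class (False, True) (x, y, z) \<longleftrightarrow> 5 dvd z - 3 * y \<and> 5 dvd x \<and> \<not> 5 dvd y"
| "image_class (False, False) (x, y, z) \<longleftrightarrow> 5 dvd z - 2 * y \<and> 5 dvd x \<and> \<not> 5 dvd y"

text \<open>Modulo 5, the two numbers supposed divisible combine to \<open>x\<close>; the arguments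
  of \<open>comb\<close> are the coefficients of such a combination and the leftover multiple of
  5.\<close>

lemma not_dvd_5_combination:
  fixes x y :: int
  assumes "\<not> 5 dvd x"
  shows "5 dvd y - 3 * x \<Longrightarrow> \<not> 5 dvd 3 * x - 4 * y" "5 dvd y - 2 * x \<Longrightarrow> \<not> 5 dvd 3 * x + 4 * y"
    "5 dvd y \<Longrightarrow> \<not> 5 dvd 3 * y - 4 * x" "5 dvd y \<Longrightarrow> \<not> 5 dvd 3 * y + 4 * x"
    "5 dvd y \<Longrightarrow> \<not> 5 dvd 3 * x - 4 * y" "5 dvd y \<Longrightarrow> \<not> 5 dvd 3 * x + 4 * y"
    "5 dvd y - 3 * x \<Longrightarrow> \<not> 5 dvd y" "5 dvd y - 2 * x \<Longrightarrow> \<not> 5 dvd y"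
proof -
  have comb: False if "5 dvd u" "5 dvd v" "x = a * u + b * v + 5 * c" for u v a b c
    using assms that by (metis dvd_add dvd_mult dvd_triv_left)
  show "5 dvd y - 3 * x \<Longrightarrow> \<not> 5 dvd 3 * x - 4 * y"
    using comb[of "3 * x - 4 * y" "y - 3 * x" 1 4 "2 * x"] by auto
  show "5 dvd y - 2 * x \<Longrightarrow> \<not> 5 dvd 3 * x + 4 * y"
    using comb[of "3 * x + 4 * y" "y - 2 * x" 1 "-4" "- 2 * x"] by auto
  show "5 dvd y \<Longrightarrow> \<not> 5 dvd 3 * y - 4 * x"
    using comb[of "3 * y - 4 * x" y 1 "-3" x] by auto
  show "5 dvd y \<Longrightarrow> \<not> 5 dvd 3 * y + 4 * x"
    using comb[of "3 * y + 4 * x" y "-1" 3 x] by auto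
  show "5 dvd y \<Longrightarrow> \<not> 5 dvd 3 * x - 4 * y"
    using comb[of "3 * x - 4 * y" y 2 8 "- x"] by auto
  show "5 dvd y \<Longrightarrow> \<not> 5 dvd 3 * x + 4 * y"
    using comb[of "3 * x + 4 * y" y 2 "-8" "- x"] by auto
  show "5 dvd y - 3 * x \<Longrightarrow> \<not> 5 dvd y"
    using comb[of y "y - 3 * x" 2 "-2" "- x"] by auto
  show "5 dvd y - 2 * x \<Longrightarrow> \<not> 5 dvd y"
    using comb[of y "y - 2 * x" 3 "-3" "- x"] by auto
qed

lemma dvd_5_images:
  fixes x y :: int
  shows "5 dvd (4 * x + 3 * y) - 3 * (3 * x - 4 * y)" "5 dvd (3 * y - 4 * x) - 2 * (3 * x + 4 * y)"
proof -
  have "(4 * x + 3 * y) - 3 * (3 * x - 4 * y) = 5 * (3 * y - x)"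
    "(3 * y - 4 * x) - 2 * (3 * x + 4 * y) = 5 * (- y - 2 * x)" by simp_all
  then show "5 dvd (4 * x + 3 * y) - 3 * (3 * x - 4 * y)" "5 dvd (3 * y - 4 * x) - 2 * (3 * x + 4 * y)"
    by (metis dvd_triv_left)+
qed

lemma image_class_step:
  assumes "image_class l v" "m \<noteq> linv l"
  shows "image_class m (scaled_step m v)"
proof -
  obtain x y z where v: "v = (x, y, z)" by (cases v)
  obtain a b where l: "l = (a, b)" by (cases l)
  obtain c d where m: "m = (c, d)" by (cases m)
  show ?thesis
    using assms unfolding v l m linv_def
    by (cases a; cases b; cases c; cases d;
        simp only: image_class.simps scaled_step.simps prod.inject fst_conv snd_conv
          not_True_eq_False not_False_eq_True simp_thms dvd_triv_left dvd_5_images;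
        metis not_dvd_5_combination)
qed

definition real_vec :: "int \<times> int \<times> int \<Rightarrow> real^3" where
  "real_vec v = vector [of_int (fst v), of_int (fst (snd v)), of_int (snd (snd v))]"

lemma real_vec_step: "5 *\<^sub>R (letter_mat base_rot l *v real_vec v) = real_vec (scaled_step l v)"
proof -
  obtain x y z where v: "v = (x, y, z)" by (cases v)
  obtain a b where l: "l = (a, b)" by (cases l)
  show ?thesis
    unfolding v l
    by (cases a; cases b)
      (simp_all add: letter_mat_def base_rot_def real_vec_def vec_eq_iff forall_3 vector_3
        matrix_vector_mult_def transpose_def sum_3)
qed

lemma base_word_mat:
  "5 ^ length w *\<^sub>R (word_mat base_rot w *v real_vec v) = real_vec (foldr scaled_step w v)"
proof (induction w)
  case (Cons l w)
  have "5 ^ length (l # w) *\<^sub>R (word_mat base_rot (l # w) *v real_vec v)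
      = 5 *\<^sub>R (letter_mat base_rot l *v (5 ^ length w *\<^sub>R (word_mat base_rot w *v real_vec v)))"
    by (simp add: matrix_vector_mult_scaleR matrix_vector_mul_assoc)
  then show ?case by (simp only: Cons real_vec_step) simp
qed simp

text \<open>The vector (0, 1, 0) is on neither axis: the letter acting first puts it into an image
  class, and each further letter moves it on to its own class. The identity would give a vector that
  vanishes modulo 5 and so lies in no class.\<close>

lemma base_free:
  assumes "reduced_word w" "w \<noteq> []"
  shows "word_mat base_rot w \<noteq> mat 1"
proof
  assume *: "word_mat base_rot w = mat 1"
  have "image_class (hd w) (foldr scaled_step w (0, 1, 0))"
    using assms
  proof (induction w)
    case (Cons l w)
    show ?case
    proof (cases "w = []")
      case True
      obtain a b where "l = (a, b)" by (cases l)
      then show ?thesis using True by (cases a; cases b) simp_all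
    next
      case False
      then show ?thesis
        using Cons image_class_step[of "hd w" _ l] by (auto simp: reduced_word_Cons linv_eq_iff)
    qed
  qed simp
  moreover have "real_vec (foldr scaled_step w (0, 1, 0)) = 5 ^ length w *\<^sub>R real_vec (0, 1, 0)"
    using base_word_mat[of w "(0, 1, 0)"] * by simp
  then have "foldr scaled_step w (0, 1, 0) = (0, 5 ^ length w, 0)"
  proof -
    obtain x y z where f: "foldr scaled_step w (0, 1, 0) = (x, y, z)" by (metis prod_cases3)
    assume "real_vec (foldr scaled_step w (0, 1, 0)) = 5 ^ length w *\<^sub>R real_vec (0, 1, 0)"
    then have "real_of_int x = 0 \<and> real_of_int y = real_of_int (5 ^ length w) \<and> real_of_int z = 0"
      unfolding f by (simp add: real_vec_def vec_eq_iff forall_3 vector_3)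
    then show ?thesis unfolding f of_int_eq_iff by simp
  qed
  moreover have "(5::int) dvd 5 ^ length w" using assms(2) by (cases w) auto
  moreover obtain a b where "hd w = (a, b)" by (cases "hd w")
  ultimately show False by (cases a; cases b) auto
qed

section \<open>Free rotations of any finite number\<close>

definition conj_word :: "nat \<Rightarrow> bool \<Rightarrow> (bool \<times> bool) list" where
  "conj_word i s = replicate i (True, True) @ [(False, s)] @ replicate i (True, False)"

text \<open>In a free group of rank two, the conjugates of one generator by the powers of the other
  are themselves free.\<close>

definition conj_rot :: "nat \<Rightarrow> real^3^3" where
  "conj_rot i = word_mat base_rot (conj_word i True)"

lemma rotation_conj: "rotation_matrix (conj_rot i)"
  unfolding conj_rot_def by (intro rotation_word_mat rotation_base)

lemma replicate_cancel:
  "word_mat base_rot (replicate n (True, s)) ** word_mat base_rot (replicate n (True, \<not> s)) = mat 1"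
proof (induction n)
  case (Suc n)
  have r: "replicate (Suc n) (True, \<not> s) = replicate n (True, \<not> s) @ [(True, \<not> s)]"
    by (simp add: replicate_append_same)
  have "word_mat base_rot (replicate (Suc n) (True, s)) ** word_mat base_rot (replicate (Suc n) (True, \<not> s))
     = letter_mat base_rot (True, s) ** (word_mat base_rot (replicate n (True, s)) **
       word_mat base_rot (replicate n (True, \<not> s))) ** letter_mat base_rot (True, \<not> s)"
    unfolding r word_mat_append by (simp add: matrix_mul_assoc)
  then show ?case
    using Suc letter_mat_linv[where \<rho> = base_rot and l = "(True, s)", OF rotation_base] by (simp add: linv_def)
qed simp

lemma letter_mat_conj: "letter_mat conj_rot (i, s) = word_mat base_rot (conj_word i s)"
proof (cases s)
  case True
  then show ?thesis by (simp add: letter_mat_def conj_rot_def)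
next
  case False
  let ?P = "word_mat base_rot (replicate i (True, True))" and ?M = "word_mat base_rot (replicate i (True, False))"
  let ?b = "letter_mat base_rot (False, True)" and ?b' = "letter_mat base_rot (False, False)"
  have inverse: "?b ** ?b' = mat 1" "?P ** ?M = mat 1" "?M ** ?P = mat 1"
    using letter_mat_linv[where \<rho> = base_rot and l = "(False, True)", OF rotation_base]
      replicate_cancel[of i True] replicate_cancel[of i False] by (simp_all add: linv_def)
  have "conj_rot i ** word_mat base_rot (conj_word i False) = ?P ** (?b ** (?M ** ?P) ** ?b') ** ?M"
    unfolding conj_rot_def conj_word_def by (simp add: word_mat_append matrix_mul_assoc)
  then have "conj_rot i ** word_mat base_rot (conj_word i False) = mat 1"
    unfolding inverse(3) by (simp add: inverse)
  then have "transpose (conj_rot i) ** (conj_rot i ** word_mat base_rot (conj_word i False)) = transpose (conj_rot i)"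
    by simp
  then show ?thesis
    using False rotation_matrix_cancel(1)[OF rotation_conj[of i]]
    by (simp add: letter_mat_def matrix_mul_assoc)
qed

lemma reduced_replicate: "reduced_word (replicate n l)"
  by (induction n) (auto simp: reduced_word_Cons hd_replicate)

text \<open>Between consecutive conjugates only powers of the first rotation cancel. If they vanish
  entirely (\<open>i = j\<close>), then \<open>s = t\<close> because \<open>g\<close> is reduced, so
  the letters of the second rotation all survive. The exact initial block is recorded for the
  induction.\<close>

lemma conj_word_normal_form:
  assumes "reduced_word g" "g \<noteq> []"
  shows "\<exists>w. reduced_word (replicate (fst (hd g)) (True, True) @ (False, snd (hd g)) # w) \<and>
    word_mat conj_rot g = word_mat base_rot (replicate (fst (hd g)) (True, True) @ (False, snd (hd g)) # w)"
  using assms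
proof (induction g)
  case (Cons l g)
  obtain i s where l: "l = (i, s)" by (cases l)
  show ?case
  proof (cases "g = []")
    case True
    have "reduced_word (conj_word i s)"
      unfolding conj_word_def
      by (auto simp: reduced_word_append reduced_word_Cons reduced_replicate linv_def hd_replicate hd_append)
    then show ?thesis
      using True l letter_mat_conj[of i s]
      by (intro exI[of _ "replicate i (True, False)"]) (simp add: conj_word_def)
  next
    case False
    obtain j t where h: "hd g = (j, t)" by (cases "hd g")
    then have ne: "i \<noteq> j \<or> s = t"
      using Cons.prems(1) False l by (auto simp: reduced_word_Cons linv_def)
    obtain w where w: "reduced_word (replicate j (True, True) @ (False, t) # w)"
      "word_mat conj_rot g = word_mat base_rot (replicate j (True, True) @ (False, t) # w)"
      using Cons False h by (auto simp: reduced_word_Cons)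
    define m where "m = (if i \<le> j then replicate (j - i) (True, True) else replicate (i - j) (True, False))"
    have m: "word_mat base_rot (replicate i (True, False)) ** word_mat base_rot (replicate j (True, True))
        = word_mat base_rot m"
    proof (cases "i \<le> j")
      case True
      then have "replicate j (True, True) = replicate i (True, True) @ replicate (j - i) (True, True)"
        by (simp flip: replicate_add)
      then show ?thesis
        using replicate_cancel[of i False] True by (simp add: m_def word_mat_append matrix_mul_assoc)
    next
      case False
      then have "replicate i (True, False) = replicate (i - j) (True, False) @ replicate j (True, False)"
        by (simp flip: replicate_add)
      then show ?thesis
        using replicate_cancel[of j False] False
        by (simp add: m_def word_mat_append flip: matrix_mul_assoc)
    qed
    have "word_mat conj_rot (l # g) = word_mat base_rot (replicate i (True, True)) **
        letter_mat base_rot (False, s) ** (word_mat base_rot (replicate i (True, False)) **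
        word_mat base_rot (replicate j (True, True))) ** word_mat base_rot ((False, t) # w)"
      using w(2) letter_mat_conj[of i s] l
      by (simp add: conj_word_def word_mat_append matrix_mul_assoc)
    also have "\<dots> = word_mat base_rot (replicate i (True, True) @ (False, s) # m @ (False, t) # w)"
      unfolding m by (simp add: word_mat_append matrix_mul_assoc)
    finally have eq: "word_mat conj_rot (l # g)
        = word_mat base_rot (replicate i (True, True) @ (False, s) # m @ (False, t) # w)" .
    have "reduced_word ((False, t) # w)" using w(1) by (simp add: reduced_word_append)
    moreover have "reduced_word m" by (simp add: m_def reduced_replicate)
    moreover have "m = [] \<longleftrightarrow> i = j" by (auto simp: m_def)
    moreover have "m \<noteq> [] \<Longrightarrow> fst (hd m) \<and> fst (last m)" by (auto simp: m_def split: if_splits)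
    ultimately have "reduced_word (m @ (False, t) # w)" "hd (m @ (False, t) # w) \<noteq> linv (False, s)"
      using ne by (auto simp: reduced_word_append linv_def hd_append prod_eq_iff)
    then have "reduced_word (replicate i (True, True) @ (False, s) # m @ (False, t) # w)"
      by (auto simp: reduced_word_append reduced_word_Cons reduced_replicate linv_def)
    then show ?thesis using eq l by auto
  qed
qed simp

lemma conj_free: "reduced_word g \<Longrightarrow> g \<noteq> [] \<Longrightarrow> word_mat conj_rot g \<noteq> mat 1"
  by (metis append_is_Nil_conv base_free conj_word_normal_form list.distinct(1))

lemma reduced_word_map:
  assumes "inj_on f A" "reduced_word w" "fst ` set w \<subseteq> A"
  shows "reduced_word (map (\<lambda>l. (f (fst l), snd l)) w)"
  using assms(2,3)
proof (induction w)
  case (Cons l w)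
  have "(f (fst (hd w)), snd (hd w)) \<noteq> linv (f (fst l), snd l)" if "w \<noteq> []" "hd w \<noteq> linv l"
  proof
    assume "(f (fst (hd w)), snd (hd w)) = linv (f (fst l), snd l)"
    moreover have "fst (hd w) \<in> A" "fst l \<in> A" using Cons.prems(2) that(1) by auto
    ultimately have "hd w = linv l"
      using assms(1) by (auto simp: linv_def prod_eq_iff dest: inj_onD)
    then show False using that by simp
  qed
  then show ?case using Cons by (auto simp: reduced_word_Cons hd_map)
qed simp

lemma free_rotations:
  assumes "finite J"
  obtains \<rho> :: "'a \<Rightarrow> real^3^3" where "\<And>j. rotation_matrix (\<rho> j)" "inj_on \<rho> J"
    "\<And>w. reduced_word w \<Longrightarrow> w \<noteq> [] \<Longrightarrow> fst ` set w \<subseteq> J \<Longrightarrow> word_mat \<rho> w \<noteq> mat 1"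
proof -
  obtain f :: "'a \<Rightarrow> nat" where f: "inj_on f J"
    using finite_imp_inj_to_nat_seg[OF assms] by blast
  define \<rho> where "\<rho> j = conj_rot (f j)" for j
  have rot: "rotation_matrix (\<rho> j)" for j by (simp add: \<rho>_def rotation_conj)
  have free: "word_mat \<rho> w \<noteq> mat 1" if w: "reduced_word w" "w \<noteq> []" "fst ` set w \<subseteq> J" for w
  proof -
    define v where "v = map (\<lambda>l. (f (fst l), snd l)) w"
    have "word_mat \<rho> w = word_mat conj_rot v"
      unfolding v_def by (induction w) (simp_all add: letter_mat_def \<rho>_def)
    moreover have "reduced_word v"
      unfolding v_def by (rule reduced_word_map[OF f w(1,3)])
    ultimately show ?thesis using conj_free[of v] w(2) by (simp add: v_def)
  qed
  have "inj_on \<rho> J"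
  proof (rule inj_onI, rule ccontr)
    fix j k assume *: "j \<in> J" "k \<in> J" "\<rho> j = \<rho> k" "j \<noteq> k"
    have "reduced_word [(j, True), (k, False)]" using *(4) by (simp add: reduced_word_Cons linv_def)
    then have "word_mat \<rho> [(j, True), (k, False)] \<noteq> mat 1" by (rule free) (use * in auto)
    then show False
      using *(3) rotation_matrix_cancel(2)[OF rot[of k]] by (simp add: letter_mat_def)
  qed
  show thesis by (rule that[of \<rho>, OF rot \<open>inj_on \<rho> J\<close> free])
qed

text \<open>Freeness is given for words in indices, while \<open>free_basis\<close> speaks of words
  in matrices; injectivity of \<rho> translates reduced words into reduced words.\<close>

lemma free_group_of_rotations:
  assumes rot: "\<And>j. rotation_matrix (\<rho> j)" and inj: "inj_on \<rho> J"
    and free: "\<And>w. reduced_word w \<Longrightarrow> w \<noteq> [] \<Longrightarrow> fst ` set w \<subseteq> J \<Longrightarrow> word_mat \<rho> w \<noteq> mat 1"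
  shows "subgroup (generate SO3 (\<rho> ` J)) SO3"
    and "free_group (SO3\<lparr>carrier := generate SO3 (\<rho> ` J)\<rparr>)"
proof -
  interpret SO3: group SO3 by (rule group_SO3)
  let ?X = "\<rho> ` J" and ?H = "generate SO3 (\<rho> ` J)"
  have X: "?X \<subseteq> carrier SO3" using rot by auto
  show sub: "subgroup ?H SO3" by (rule SO3.generate_is_subgroup[OF X])
  have XH: "?X \<subseteq> ?H" by (blast intro: generate.incl)
  let ?G = "SO3\<lparr>carrier := ?H\<rparr>"
  have "free_basis ?G ?X"
    unfolding free_basis_def
  proof (intro conjI allI impI)
    show "?X \<subseteq> carrier ?G" using XH by simp
    show "generate ?G ?X = carrier ?G" using SO3.generate_consistent[OF XH sub] by simp
    fix w :: "((real^3^3) \<times> bool) list" assume w: "reduced_word w \<and> w \<noteq> [] \<and> fst ` set w \<subseteq> ?X"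
    define h where "h = the_inv_into J \<rho>"
    have h: "\<rho> (h x) = x" "h x \<in> J" if "x \<in> ?X" for x
      using that f_the_inv_into_f[OF inj] the_inv_into_into[OF inj] by (auto simp: h_def)
    define v where "v = map (\<lambda>l. (h (fst l), snd l)) w"
    have "inj_on h ?X" using h(1) by (rule inj_on_inverseI)
    then have "reduced_word v"
      unfolding v_def using w by (intro reduced_word_map) auto
    moreover have "eval_word ?G w = word_mat \<rho> v"
    proof -
      have "fst ` set w \<subseteq> ?X" using w by blast
      then show ?thesis
        unfolding v_def
      proof (induction w)
        case (Cons l w)
        have l: "fst l \<in> ?X" using Cons.prems by simp
        have "inv\<^bsub>?G\<^esub> (fst l) = inv\<^bsub>SO3\<^esub> (fst l)"
          by (rule SO3.m_inv_consistent[OF sub]) (use l XH in blast)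
        also have "\<dots> = transpose (fst l)" using l rot by (intro inv_SO3) auto
        finally have "inv\<^bsub>?G\<^esub> (fst l) = transpose (fst l)" .
        moreover have "eval_word ?G w = word_mat \<rho> (map (\<lambda>l. (h (fst l), snd l)) w)"
          using Cons by simp
        ultimately show ?case using h(1)[OF l] by (simp add: letter_mat_def)
      qed simp
    qed
    ultimately show "eval_word ?G w \<noteq> \<one>\<^bsub>?G\<^esub>"
      using free[of v] w h(2) by (simp add: v_def image_subset_iff)
  qed
  moreover have "group ?G" using SO3.subgroup_imp_group[OF sub] .
  ultimately show "free_group ?G" unfolding free_group_def by blast
qed

section \<open>Weak and consistent systems\<close>

locale weak_consistent =
  fixes I :: "nat set" and C :: "congruence list"
  assumes finite_I: "finite I" and I_ne: "I \<noteq> {}" and system: "congruence_system I C"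
    and weak: "weak_system I C" and consistent: "consistent_system I C"
begin

lemma C_subset: "(L, R) \<in> set C \<Longrightarrow> L \<subseteq> I \<and> R \<subseteq> I"
  using system by (auto simp: congruence_system_def)

lemma deducible_subset: "deducible I C L R \<Longrightarrow> L \<subseteq> I \<and> R \<subseteq> I"
  by (induction rule: deducible.induct) (auto dest: C_subset)

lemma deducible_sym: "deducible I C L R \<Longrightarrow> deducible I C R L"
  by (induction rule: deducible.induct) (auto intro: deducible.intros)

lemma deducible_preceq:
  assumes "deducible I C L R"
  shows "cong_preceq I C L R \<and> cong_preceq I C (I - L) (I - R)"
  using assms
proof (induction rule: deducible.induct)
  case (compl L R)
  then have "I - (I - L) = L" "I - (I - R) = R" using deducible_subset by blast+
  then show ?case using compl by simp
qed (auto intro: cong_preceq.intros)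

text \<open>Reflexivity is added because \<open>deducible\<close> does not provide it; for an empty
  system, for example, nothing is deducible.\<close>

definition eqv :: "nat set \<Rightarrow> nat set \<Rightarrow> bool" where
  "eqv L R \<longleftrightarrow> L \<subseteq> I \<and> R \<subseteq> I \<and> (L = R \<or> deducible I C L R)"

lemma eqv_refl: "L \<subseteq> I \<Longrightarrow> eqv L L"
  by (simp add: eqv_def)

lemma eqv_sym: "eqv L R \<Longrightarrow> eqv R L"
  by (auto simp: eqv_def deducible_sym)

lemma eqv_trans: "eqv L M \<Longrightarrow> eqv M R \<Longrightarrow> eqv L R"
  by (auto simp: eqv_def intro: deducible.trans)

lemma eqv_compl: "eqv L R \<Longrightarrow> eqv (I - L) (I - R)"
  by (auto simp: eqv_def intro: deducible.compl)

text \<open>The reflexive case \<open>L = I - L\<close> is excluded by \<open>I_ne\<close>, the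
  other by weakness.\<close>

lemma not_eqv_compl: "\<not> eqv L (I - L)"
  using weak I_ne by (auto simp: eqv_def weak_system_def)

lemma eqv_preceq: "eqv L R \<Longrightarrow> cong_preceq I C L R"
  using deducible_preceq by (auto simp: eqv_def intro: cong_preceq.subset)

lemma no_return: "V \<subset> W \<Longrightarrow> W \<subseteq> I \<Longrightarrow> \<not> cong_preceq I C W V"
  using consistent by (auto simp: consistent_system_def)

lemma eqv_empty: "eqv L {} \<Longrightarrow> L = {}"
  using no_return[of "{}" L] eqv_preceq[of L "{}"] by (auto simp: eqv_def)

lemma eqv_full: "eqv L I \<Longrightarrow> L = I"
  using no_return[of L I] eqv_preceq[of I L] eqv_sym[of L I] by (auto simp: eqv_def)

text \<open>The predicate is the same for all sets equivalent to \<open>L\<close> or to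
  \<open>I - L\<close>, so \<open>SOME\<close> returns one set for the whole pair of
  classes.\<close>

definition mid :: "nat set \<Rightarrow> nat set" where
  "mid L = (SOME M. eqv M L \<or> eqv M (I - L))"

text \<open>The classes of \<open>eqv\<close> come in pairs, exchanged by complementation, and by weakness no class is
  paired with itself. So representatives can be chosen compatibly with complements.\<close>

definition rep :: "nat set \<Rightarrow> nat set" where
  "rep L = (if eqv (mid L) L then mid L else I - mid L)"

text \<open>Only the class that contains \<open>mid L\<close> gets generators. The complements of
  its members are moved by the same rotations, as \<open>rep_compl\<close> allows.\<close>

definition gens :: "nat set set" where
  "gens = {L. eqv (mid L) L \<and> L \<noteq> mid L}"

lemma mid: "L \<subseteq> I \<Longrightarrow> eqv (mid L) L \<or> eqv (mid L) (I - L)"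
  unfolding mid_def by (rule someI[of _ L]) (simp add: eqv_refl)

lemma mid_compl: "L \<subseteq> I \<Longrightarrow> mid (I - L) = mid L"
  by (simp add: mid_def double_diff disj_commute)

lemma mid_cong: "eqv L R \<Longrightarrow> mid L = mid R"
  unfolding mid_def
  by (rule arg_cong[where f = Eps]) (metis eqv_compl eqv_sym eqv_trans)

lemma eqv_mid_iff: "L \<subseteq> I \<Longrightarrow> eqv (mid L) (I - L) \<longleftrightarrow> \<not> eqv (mid L) L"
  using mid eqv_trans[OF eqv_sym[of "mid L" L], of "I - L"] not_eqv_compl by blast

lemma rep_eqv: "L \<subseteq> I \<Longrightarrow> eqv (rep L) L"
proof (cases "eqv (mid L) L")
  case False
  assume L: "L \<subseteq> I"
  then have "eqv (mid L) (I - L)" using False eqv_mid_iff by blast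
  then have "eqv (I - mid L) (I - (I - L))" by (rule eqv_compl)
  then show ?thesis using False L by (simp add: rep_def double_diff)
qed (simp add: rep_def)

lemma rep_subset: "L \<subseteq> I \<Longrightarrow> rep L \<subseteq> I"
  using rep_eqv by (auto simp: eqv_def)

lemma rep_cong: "eqv L R \<Longrightarrow> rep L = rep R"
  unfolding rep_def using mid_cong eqv_trans eqv_sym by metis

lemma rep_compl: "L \<subseteq> I \<Longrightarrow> rep (I - L) = I - rep L"
proof -
  assume L: "L \<subseteq> I"
  have "mid L \<subseteq> I" using mid[OF L] by (auto simp: eqv_def)
  then show ?thesis
    using mid_compl[OF L] eqv_mid_iff[OF L] by (auto simp: rep_def)
qed

lemma rep_rep: "L \<subseteq> I \<Longrightarrow> rep (rep L) = rep L"
  using rep_cong[OF rep_eqv] by simp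

lemma gens_subset: "L \<in> gens \<Longrightarrow> L \<subseteq> I"
  by (auto simp: gens_def eqv_def)

lemma rep_gens: "L \<in> gens \<Longrightarrow> rep L = mid L" "L \<in> gens \<Longrightarrow> rep L \<noteq> L"
  by (auto simp: gens_def rep_def)

lemma gens_compl: "L \<in> gens \<Longrightarrow> I - L \<notin> gens"
  using mid_compl[OF gens_subset] eqv_mid_iff[OF gens_subset] by (auto simp: gens_def)

lemma finite_gens: "finite gens"
  using gens_subset finite_I by (meson Pow_iff finite_Pow_iff finite_subset subsetI)

lemma rep_cases:
  assumes "L \<subseteq> I"
  obtains "rep L = L" | "L \<in> gens" | "I - L \<in> gens"
proof (cases "eqv (mid L) L")
  case True
  then show thesis using that by (auto simp: gens_def rep_def)
next
  case False
  then have "eqv (mid (I - L)) (I - L)" using mid_compl eqv_mid_iff assms by simp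
  moreover have "rep L = L" if "I - L = mid (I - L)"
    using that mid_compl[OF assms] False assms by (metis double_diff order_refl rep_def)
  ultimately show thesis using that by (auto simp: gens_def)
qed

text \<open>By consistency \<open>{}\<close> and \<open>I\<close> are equivalent only to themselves.
  So a letter has colours on both of its sides, which gives \<open>E_total\<close>.\<close>

lemma gens_proper:
  assumes "L \<in> gens"
  shows "L \<noteq> {}" "L \<noteq> I" "rep L \<noteq> {}" "rep L \<noteq> I"
  using eqv_empty[of "rep L"] eqv_empty[of L] eqv_full[of "rep L"] eqv_full[of L]
    rep_eqv[OF gens_subset[OF assms]] eqv_sym rep_gens(2)[OF assms] by metis+

section \<open>Letters as edges of stars\<close>

definition src :: "nat set \<times> bool \<Rightarrow> nat set" where
  "src l = (if snd l then rep (fst l) else fst l)"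

text \<open>A letter sees a colour only through the block it lies in: compatible colours are those
  in equally named blocks of \<open>l\<close> and \<open>linv l\<close>.\<close>

definition side :: "nat set \<times> bool \<Rightarrow> bool \<Rightarrow> nat set" where
  "side l s = (if s then src l else I - src l)"

text \<open>If \<open>A k\<close> is the set of points of colour \<open>k\<close>, compatibility along \<open>(X, True)\<close> means that the
  generator attached to \<open>X\<close> maps the union of the \<open>A k\<close> with \<open>k \<in> rep X\<close> onto that of the \<open>A k\<close>
  with \<open>k \<in> X\<close>.\<close>

definition compat :: "nat set \<times> bool \<Rightarrow> nat \<Rightarrow> nat \<Rightarrow> bool" where
  "compat l a b \<longleftrightarrow> (a \<in> src l \<longleftrightarrow> b \<in> src (linv l))"

lemma src_subset: "fst l \<in> gens \<Longrightarrow> src l \<subseteq> I"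
  using gens_subset rep_subset by (auto simp: src_def)

lemma side_subset: "fst l \<in> gens \<Longrightarrow> side l s \<subseteq> I"
  using src_subset by (auto simp: side_def)

lemma side_proper: "fst l \<in> gens \<Longrightarrow> side l s \<noteq> {} \<and> side l s \<noteq> I"
  using gens_proper[of "fst l"] src_subset[of l] by (auto simp: side_def src_def)

lemma side_eqv: "fst l \<in> gens \<Longrightarrow> eqv (side l s) (side (linv l) s)"
  using rep_eqv[OF gens_subset[of "fst l"]] eqv_sym eqv_compl by (auto simp: side_def src_def)

text \<open>One more than \<open>2 * 2 ^ card I + 2\<close>, the length to which
  \<open>reach_length\<close> limits a path that does not allow all colours at its end.\<close>

definition bound :: nat where
  "bound = 2 * 2 ^ card I + 3"

end

locale star_action = weak_consistent I C + word_action gens T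
  for I C and T :: "nat set \<times> bool \<Rightarrow> 'p \<Rightarrow> 'p"

sublocale star_action \<subseteq> colouring_action gens T I compat bound
proof
  show "compat (linv l) b a \<longleftrightarrow> compat l a b" for l a b
    by (auto simp: compat_def)
  show "\<exists>b\<in>I. compat l a b" if "fst l \<in> gens" "a \<in> I" for l a
    using side_proper[of "linv l" True] side_proper[of "linv l" False] src_subset[of "linv l"] that
    by (auto simp: compat_def side_def)
qed (auto simp: I_ne bound_def)

section \<open>Colours reachable along a reduced path\<close>

context star_action
begin

definition reach :: "(nat set \<times> bool) list \<Rightarrow> nat \<Rightarrow> nat set" where
  "reach w a = {b \<in> I. joins w a b}"

lemma reach_Cons: "reach (l # w) a = {b \<in> I. \<exists>e\<in>reach w a. compat l e b}"
  by (auto simp: reach_def)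

lemma reach_nonempty:
  assumes "fst ` set w \<subseteq> gens" "a \<in> I"
  shows "reach w a \<noteq> {}"
  using assms(1)
proof (induction w)
  case (Cons l w)
  then obtain e where "e \<in> I" "e \<in> reach w a" by (auto simp: reach_def)
  moreover obtain b where "b \<in> I" "compat l e b"
    using E_total[of l e] Cons.prems \<open>e \<in> I\<close> by auto
  ultimately show ?case by (auto simp: reach_Cons)
qed (use assms(2) in \<open>auto simp: reach_def\<close>)

text \<open>If the colours allowed so far met both blocks of \<open>l\<close>, both blocks of
  \<open>linv l\<close> would be allowed, that is, all of \<open>I\<close>. So restricted colours
  always fill exactly one block.\<close>

lemma reach_step:
  assumes "fst ` set (l # w) \<subseteq> gens" "a \<in> I" "reach (l # w) a \<noteq> I"
  obtains s where "reach w a \<subseteq> side l s" "reach (l # w) a = side (linv l) s"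
proof -
  have ne: "reach w a \<noteq> {}" using reach_nonempty assms by simp
  have sub: "reach w a \<subseteq> I" by (auto simp: reach_def)
  have "reach w a \<subseteq> side l True \<or> reach w a \<subseteq> side l False"
  proof (rule ccontr)
    assume "\<not> ?thesis"
    then obtain d e where "d \<in> reach w a" "d \<notin> src l" "e \<in> reach w a" "e \<in> src l"
      using sub by (auto simp: side_def)
    then have "reach (l # w) a = I" by (auto simp: reach_Cons compat_def)
    then show False using assms(3) by simp
  qed
  then obtain s where s: "reach w a \<subseteq> side l s" by blast
  then have "reach (l # w) a = side (linv l) s"
    using ne sub src_subset[of "linv l"] assms(1)
    by (cases s) (auto simp: reach_Cons compat_def side_def)
  with s show thesis by (rule that)
qed

text \<open>A counter for moving up in \<preceq>: by consistency its size drops strictly whenever a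
  set is properly enlarged on the way.\<close>

definition upper :: "nat set \<Rightarrow> nat set set" where
  "upper V = {W. W \<subseteq> I \<and> cong_preceq I C V W}"

lemma upper_finite: "finite (upper V)"
  using finite_I by (auto simp: upper_def intro: finite_subset[of _ "Pow I"])

lemma upper_card_le: "cong_preceq I C V W \<Longrightarrow> card (upper W) \<le> card (upper V)"
  by (intro card_mono upper_finite) (auto simp: upper_def intro: cong_preceq.trans)

lemma upper_card_less:
  assumes "V \<subset> W" "W \<subseteq> I" "cong_preceq I C W X"
  shows "card (upper X) < card (upper V)"
proof (rule psubset_card_mono)
  have VW: "cong_preceq I C V W" using assms by (auto intro: cong_preceq.subset)
  have "V \<in> upper V" using assms by (auto simp: upper_def intro: cong_preceq.subset)
  moreover have "V \<notin> upper X"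
    using no_return[OF assms(1,2)] assms(3) cong_preceq.trans by (auto simp: upper_def)
  moreover have "upper X \<subseteq> upper V"
    using cong_preceq.trans[OF cong_preceq.trans[OF VW assms(3)]] by (auto simp: upper_def)
  ultimately show "upper X \<subset> upper V" by blast
qed (rule upper_finite)

text \<open>Being its own representative distinguishes the blocks at centres of stars from those at
  leaves. If the block reached by \<open>m\<close> is a block of \<open>l\<close>, both are of one
  kind. Coinciding leaves would give \<open>m = linv l\<close>, since complementary sets are not
  both in \<open>gens\<close>; so \<open>m\<close> runs from a leaf to the centre and
  \<open>l\<close> from the centre to a leaf.\<close>

lemma equal_step:
  assumes "l # m # w \<in> words" "side (linv m) s = side l t"
  shows "snd l \<and> \<not> snd m"
proof -
  have g: "fst l \<in> gens" "fst m \<in> gens" using assms(1) by (auto simp: words_def)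
  have red: "m \<noteq> linv l" using assms(1) by (auto simp: words_def reduced_word_Cons)
  have fixed: "rep (side k u) = side k u" if "fst k \<in> gens" "snd k" for k u
    using that gens_subset[of "fst k"] rep_subset[of "fst k"] rep_compl[of "rep (fst k)"]
    by (auto simp: side_def src_def rep_rep)
  have moved: "rep (side k u) \<noteq> side k u" if k: "fst k \<in> gens" "\<not> snd k" for k u
  proof
    assume *: "rep (side k u) = side k u"
    have sub: "fst k \<subseteq> I" "rep (fst k) \<subseteq> I" using gens_subset[OF k(1)] rep_subset by auto
    have "rep (fst k) = fst k"
      using * k sub rep_compl[OF sub(1)] double_diff[OF sub(1), of I] double_diff[OF sub(2), of I]
      by (cases u) (auto simp: side_def src_def)
    then show False using rep_gens(2)[OF k(1)] by simp
  qed
  have "snd l = snd (linv m)"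
    using fixed[OF g(1)] moved[OF g(1)] fixed[of "linv m"] moved[of "linv m"] g assms(2)
    by (metis linv_simps(2))
  moreover have "\<not> snd m"
  proof
    assume "snd m"
    then have lm: "\<not> snd l" "\<not> snd (linv m)" using calculation by auto
    then have eq: "(if s then fst m else I - fst m) = (if t then fst l else I - fst l)"
    proof -
      have "src l = fst l" "src (linv m) = fst m" using lm by (simp_all add: src_def)
      then show ?thesis using assms(2) by (cases s; cases t) (simp_all add: side_def)
    qed
    have "fst m = fst l \<or> fst m = I - fst l"
    proof -
      have "X = Y \<or> X = I - Y"
        if "(if s then X else I - X) = (if t then Y else I - Y)" "X \<subseteq> I" "Y \<subseteq> I" for X Y :: "nat set"
        using that by (cases s; cases t) (simp_all, blast+)
      then show ?thesis using eq gens_subset[OF g(1)] gens_subset[OF g(2)] by blast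
    qed
    then show False
      using gens_compl[OF g(1)] g(2) red lm \<open>snd m\<close> by (auto simp: linv_def prod_eq_iff)
  qed
  ultimately show ?thesis by simp
qed

text \<open>A potential argument. A step with enlargement lowers the cardinality and frees two
  units, enough for one letter and the change of the last summand from 2 to 1. A step without
  enlargement is paid for by the change from 1 to 2, by \<open>equal_step\<close>.\<close>

lemma reach_length:
  assumes "w \<in> words" "w \<noteq> []" "a \<in> I" "reach w a \<noteq> I"
  shows "length w + 2 * card (upper (reach w a)) \<le> 2 * 2 ^ card I + (if snd (hd w) then 2 else 1)"
  using assms
proof (induction w)
  case (Cons l w)
  have gens: "fst ` set (l # w) \<subseteq> gens" "fst l \<in> gens" using Cons.prems by (auto simp: words_def)
  obtain s where s: "reach w a \<subseteq> side l s" "reach (l # w) a = side (linv l) s"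
    using reach_step[OF gens(1)] Cons.prems by metis
  have up: "cong_preceq I C (side l s) (reach (l # w) a)"
    unfolding s(2) by (rule eqv_preceq[OF side_eqv[OF gens(2)]])
  show ?case
  proof (cases w)
    case Nil
    have "card (upper (reach (l # w) a)) \<le> card (Pow I)"
      using finite_I by (intro card_mono) (auto simp: upper_def)
    then show ?thesis using Nil finite_I by (simp add: card_Pow)
  next
    case (Cons m v)
    have w: "w \<in> words" "fst ` set (m # v) \<subseteq> gens" using Cons.prems(1) words_ConsD gens Cons by auto
    have "reach w a \<noteq> I"
      using s(1) side_proper[OF gens(2)] side_subset[OF gens(2)] by blast
    then have IH: "length w + 2 * card (upper (reach w a)) \<le> 2 * 2 ^ card I + (if snd m then 2 else 1)"
      using Cons.IH w Cons.prems Cons by simp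
    obtain t where t: "reach w a = side (linv m) t"
      using reach_step[OF w(2) \<open>a \<in> I\<close>] \<open>reach w a \<noteq> I\<close> Cons by metis
    show ?thesis
    proof (cases "reach w a = side l s")
      case True
      then have "snd l \<and> \<not> snd m" using equal_step[of l m v t s] t Cons.prems(1) Cons by simp
      moreover have "card (upper (reach (l # w) a)) \<le> card (upper (reach w a))"
        using up True by (intro upper_card_le) simp
      ultimately show ?thesis using IH by simp
    next
      case False
      then have "card (upper (reach (l # w) a)) < card (upper (reach w a))"
        using s(1) side_subset[OF gens(2)] up by (intro upper_card_less[of _ "side l s"]) auto
      then show ?thesis using IH by (simp split: if_splits)
    qed
  qed
qed simp

lemma mixing: mixing
  unfolding mixing_def
proof (intro ballI impI)
  fix w a b assume w: "w \<in> words" "bound \<le> length w" and ab: "a \<in> I" "b \<in> I"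
  have "w \<noteq> []" using w(2) by (auto simp: bound_def)
  then have "reach w a = I"
    using reach_length[OF w(1) _ ab(1)] w(2) by (fastforce simp: bound_def split: if_splits)
  then show "joins w a b" using ab by (auto simp: reach_def)
qed

text \<open>Besides the relation itself, this records whether the chain ever enlarged a set
  properly; if it never did, its ends are equivalent. This alternative is what lets
  \<open>loops\<close> use weakness.\<close>

lemma reach_chain:
  assumes "w \<in> words" "w \<noteq> []" "a \<in> side (last w) s" "reach w a \<noteq> I"
  shows "cong_preceq I C (side (last w) s) (reach w a) \<and> (eqv (side (last w) s) (reach w a) \<or>
    (\<exists>V W. V \<subset> W \<and> W \<subseteq> I \<and> cong_preceq I C (side (last w) s) V \<and> cong_preceq I C W (reach w a)))"
  using assms
proof (induction w)
  case (Cons l w)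
  have gens: "fst ` set (l # w) \<subseteq> gens" "fst l \<in> gens" "fst (last (l # w)) \<in> gens"
    using Cons.prems(1) last_in_set[of "l # w"] by (auto simp: words_def)
  have aI: "a \<in> I" using Cons.prems(3) side_subset[OF gens(3)] by blast
  obtain t where t: "reach w a \<subseteq> side l t" "reach (l # w) a = side (linv l) t"
    using reach_step[OF gens(1) aI Cons.prems(4)] by blast
  have eqv: "eqv (side l t) (reach (l # w) a)"
    unfolding t(2) by (rule side_eqv[OF gens(2)])
  show ?case
  proof (cases "w = []")
    case True
    then have "a \<in> side l t" using t(1) aI by (auto simp: reach_def)
    then have "t = s" using Cons.prems(3) True by (auto simp: side_def split: if_splits)
    then show ?thesis using True eqv eqv_preceq by auto
  next
    case False
    have "reach w a \<noteq> I" using t(1) side_proper[OF gens(2)] side_subset[OF gens(2)] by blast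
    then have IH: "cong_preceq I C (side (last w) s) (reach w a)"
      "eqv (side (last w) s) (reach w a) \<or> (\<exists>V W. V \<subset> W \<and> W \<subseteq> I \<and>
        cong_preceq I C (side (last w) s) V \<and> cong_preceq I C W (reach w a))"
      using Cons.IH[OF words_ConsD[OF Cons.prems(1)] False] Cons.prems(3) False by auto
    have last: "last (l # w) = last w" using False by simp
    have pre: "cong_preceq I C (reach w a) (reach (l # w) a)"
      using cong_preceq.trans[OF cong_preceq.subset[OF t(1) side_subset[OF gens(2)]] eqv_preceq[OF eqv]] .
    show ?thesis
    proof (cases "reach w a = side l t")
      case True
      have "cong_preceq I C (side (last w) s) (reach (l # w) a)"
        using cong_preceq.trans[OF IH(1) pre] .
      moreover have "eqv (side (last w) s) (reach (l # w) a)" if "eqv (side (last w) s) (reach w a)"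
        using eqv_trans[OF that] eqv True by simp
      moreover have "cong_preceq I C W (reach (l # w) a)" if "cong_preceq I C W (reach w a)" for W
        using cong_preceq.trans[OF that pre] .
      ultimately show ?thesis
        unfolding last using IH(2) by blast
    next
      case False
      then have "reach w a \<subset> side l t" using t(1) by blast
      moreover have "cong_preceq I C (side (last w) s) (reach (l # w) a)"
        using cong_preceq.trans[OF IH(1) pre] .
      ultimately show ?thesis
        unfolding last using IH(1) eqv_preceq[OF eqv] side_subset[OF gens(2)] by blast
    qed
  qed
qed simp

text \<open>If no colour could close the path, then starting in one block of \<open>last w\<close>,
  the letter acting first, would always lead into the other. Two rounds give a \<preceq>-cycle
  through both blocks, along which consistency forbids proper enlargement. The block would then be
  equivalent to its complement, against weakness.\<close>

lemma loops:
  assumes w: "w \<in> words" "w \<noteq> []"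
  shows "\<exists>a\<in>I. joins w a a"
proof (rule ccontr)
  assume "\<not> ?thesis"
  then have none: "a \<notin> reach w a" for a by (auto simp: reach_def)
  define l where "l = last w"
  have l: "fst l \<in> gens" using w last_in_set[of w] by (auto simp: words_def l_def)
  obtain v where v: "w = v @ [l]" using w(2) by (metis append_butlast_last_id l_def)
  have same: "reach w a = reach w b" if "a \<in> side l s" "b \<in> side l s" for a b s
  proof -
    have "a \<in> I" "b \<in> I" "a \<in> src l \<longleftrightarrow> b \<in> src l"
      using that side_subset[OF l, of s] by (auto simp: side_def split: if_splits)
    then have "joins w a x \<longleftrightarrow> joins w b x" if "x \<in> I" for x
      using that unfolding v by (simp add: joins_snoc compat_def)
    then show ?thesis by (auto simp: reach_def)
  qed
  have "\<exists>X. cong_preceq I C (side l s) X \<and> X \<subseteq> side l (\<not> s) \<and> (eqv (side l s) X \<or>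
      (\<exists>V W. V \<subset> W \<and> W \<subseteq> I \<and> cong_preceq I C (side l s) V \<and> cong_preceq I C W X))" for s
  proof -
    obtain a where a: "a \<in> side l s" using side_proper[OF l] by blast
    then have "a \<in> I" using side_subset[OF l] by blast
    then have "reach w a \<noteq> I" using none by blast
    moreover have "reach w a \<subseteq> side l (\<not> s)"
    proof
      fix b assume b: "b \<in> reach w a"
      then have "b \<notin> side l s" using same[OF a] none by blast
      then show "b \<in> side l (\<not> s)" using b by (auto simp: reach_def side_def split: if_splits)
    qed
    ultimately show ?thesis using reach_chain[OF w, of a s] a unfolding l_def by blast
  qed
  then obtain F where F: "\<And>s. cong_preceq I C (side l s) (F s)" "\<And>s. F s \<subseteq> side l (\<not> s)"
    "\<And>s. eqv (side l s) (F s) \<or> (\<exists>V W. V \<subset> W \<and> W \<subseteq> I \<and> cong_preceq I C (side l s) V \<and> cong_preceq I C W (F s))"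
    by metis
  have up: "cong_preceq I C (F s) (side l (\<not> s))" for s
    using F(2) side_subset[OF l] by (intro cong_preceq.subset)
  have return: "cong_preceq I C (side l False) (side l True)"
    using cong_preceq.trans[OF F(1)[of False] up[of False]] by simp
  have "F True = side l False"
  proof (rule ccontr)
    assume "F True \<noteq> side l False"
    then have "F True \<subset> side l False" using F(2)[of True] by auto
    moreover have "cong_preceq I C (side l False) (F True)"
      using cong_preceq.trans[OF return F(1)[of True]] .
    ultimately show False using no_return side_subset[OF l] by blast
  qed
  then have "\<not> eqv (side l True) (F True)"
    using not_eqv_compl[of "side l True"] by (simp add: side_def)
  then obtain V W where VW: "V \<subset> W" "W \<subseteq> I" "cong_preceq I C (side l True) V" "cong_preceq I C W (F True)"
    using F(3)[of True] by blast
  have "cong_preceq I C W (side l False)" using VW(4) \<open>F True = side l False\<close> by simp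
  then have "cong_preceq I C W V"
    by (rule cong_preceq.trans[OF cong_preceq.trans[OF _ return] VW(3)])
  then show False using no_return VW by blast
qed

end

section \<open>Free groups are torsion free\<close>

context group
begin

definition letter :: "'a \<times> bool \<Rightarrow> 'a" where
  "letter l = (if snd l then fst l else inv (fst l))"

lemma letter_closed: "fst l \<in> carrier G \<Longrightarrow> letter l \<in> carrier G"
  by (simp add: letter_def)

lemma letter_linv: "fst l \<in> carrier G \<Longrightarrow> letter (linv l) = inv (letter l)"
  by (simp add: letter_def)

lemma eval_word_Cons: "eval_word G (l # w) = letter l \<otimes> eval_word G w"
  by (simp add: letter_def)

lemma eval_word_closed: "fst ` set w \<subseteq> carrier G \<Longrightarrow> eval_word G w \<in> carrier G"
  by (induction w) auto

lemma eval_word_append: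
  "fst ` set (v @ w) \<subseteq> carrier G \<Longrightarrow> eval_word G (v @ w) = eval_word G v \<otimes> eval_word G w"
proof (induction v)
  case (Cons l v)
  then show ?case
    using eval_word_closed[of v] eval_word_closed[of w] letter_closed[of l]
    unfolding append_Cons eval_word_Cons by (simp add: m_assoc image_Un)
qed (simp add: eval_word_closed)

lemma eval_word_concat_replicate:
  "fst ` set w \<subseteq> carrier G \<Longrightarrow> eval_word G (concat (replicate n w)) = eval_word G w [^] n"
proof (induction n)
  case (Suc n)
  have "fst ` set (w @ concat (replicate n w)) \<subseteq> carrier G" using Suc.prems by force
  then show ?case
    using Suc eval_word_append nat_pow_Suc2 eval_word_closed by simp
qed simp

lemma reduced_concat_replicate:
  assumes "reduced_word w" "hd w \<noteq> linv (last w)"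
  shows "reduced_word (concat (replicate n w))"
proof (cases "w = []")
  case False
  have "reduced_word (concat (replicate n w)) \<and> (n > 0 \<longrightarrow> hd (concat (replicate n w)) = hd w)"
    using assms False by (induction n) (auto simp: reduced_word_append hd_append)
  then show ?thesis ..
qed simp

lemma generate_eval_word:
  assumes "X \<subseteq> carrier G" "x \<in> generate G X"
  shows "\<exists>w. fst ` set w \<subseteq> X \<and> eval_word G w = x"
  using assms(2)
proof (induction rule: generate.induct)
  case one
  show ?case by (intro exI[of _ "[]"]) simp
next
  case (incl h)
  then show ?case using assms(1) by (intro exI[of _ "[(h, True)]"]) auto
next
  case (inv h)
  then show ?case using assms(1) by (intro exI[of _ "[(h, False)]"]) auto
next
  case (eng h1 h2)
  then obtain v w where "fst ` set v \<subseteq> X" "eval_word G v = h1" "fst ` set w \<subseteq> X" "eval_word G w = h2"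
    by blast
  then show ?case
    using eval_word_append[of v w] assms(1) by (intro exI[of _ "v @ w"]) auto
qed

text \<open>Powers of a cyclically reduced word are reduced. Any other reduced word is a conjugate
  of a shorter one by its last letter, and conjugation preserves the order.\<close>

lemma free_basis_torsion_free:
  assumes basis: "free_basis G X" and x: "x \<in> carrier G" "x \<noteq> \<one>" and "n \<ge> 1"
  shows "x [^] (n :: nat) \<noteq> \<one>"
proof -
  have X: "X \<subseteq> carrier G" "generate G X = carrier G"
    and free: "\<And>w. reduced_word w \<Longrightarrow> w \<noteq> [] \<Longrightarrow> fst ` set w \<subseteq> X \<Longrightarrow> eval_word G w \<noteq> \<one>"
    using basis by (auto simp: free_basis_def)
  have power: "eval_word G w [^] n \<noteq> \<one>" if "reduced_word w" "w \<noteq> []" "fst ` set w \<subseteq> X" for w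
    using that
  proof (induction "length w" arbitrary: w rule: less_induct)
    case less
    have wG: "fst ` set w \<subseteq> carrier G" using less.prems X by blast
    show ?case
    proof (cases "hd w = linv (last w)")
      case False
      have "eval_word G (concat (replicate n w)) \<noteq> \<one>"
      proof (rule free)
        show "reduced_word (concat (replicate n w))"
          using reduced_concat_replicate less.prems False by blast
        show "concat (replicate n w) \<noteq> []" using less.prems \<open>n \<ge> 1\<close> by (cases n) auto
        show "fst ` set (concat (replicate n w)) \<subseteq> X" using less.prems(3) by force
      qed
      then show ?thesis using eval_word_concat_replicate[OF wG] by simp
    next
      case True
      define l where "l = last w"
      have "tl w \<noteq> []" using True less.prems(2) by (cases w) auto
      then obtain v where v: "w = linv l # v @ [l]"
        using True less.prems(2) unfolding l_def by (metis append_butlast_last_id last_tl list.collapse)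
      have "v \<noteq> []" using less.prems(1) by (auto simp: v reduced_word_Cons)
      have "reduced_word v" "fst ` set v \<subseteq> X" "length v < length w"
        using less.prems by (auto simp: v reduced_word_Cons reduced_word_append)
      then have IH: "eval_word G v [^] n \<noteq> \<one>" using less.hyps \<open>v \<noteq> []\<close> by blast
      have l: "fst l \<in> carrier G" and vG: "eval_word G v \<in> carrier G"
        using wG v eval_word_closed[of v] by auto
      let ?a = "letter l" and ?e = "eval_word G v"
      have a: "?a \<in> carrier G" using l by (rule letter_closed)
      have "eval_word G (v @ [l]) = ?e \<otimes> ?a"
        using eval_word_append[of v "[l]"] wG a unfolding v by (auto simp: letter_def)
      then have w: "eval_word G w = inv ?a \<otimes> (?e \<otimes> ?a)"
        unfolding v eval_word_Cons by (simp add: letter_linv[OF l])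
      have pow: "eval_word G w [^] k = inv ?a \<otimes> (?e [^] k \<otimes> ?a)" for k :: nat
      proof (induction k)
        case (Suc k)
        have "eval_word G w [^] Suc k = inv ?a \<otimes> (?e [^] k \<otimes> ?a) \<otimes> (inv ?a \<otimes> (?e \<otimes> ?a))"
          using Suc w by simp
        also have "\<dots> = inv ?a \<otimes> (?e [^] k \<otimes> (?a \<otimes> (inv ?a \<otimes> (?e \<otimes> ?a))))"
          using a vG by (simp add: m_assoc)
        also have "?a \<otimes> (inv ?a \<otimes> (?e \<otimes> ?a)) = ?e \<otimes> ?a"
          using a vG by (simp flip: m_assoc)
        finally show ?case using a vG by (simp add: m_assoc)
      qed (use a in simp)
      show ?thesis
      proof
        assume "eval_word G w [^] n = \<one>"
        then have "?a \<otimes> (inv ?a \<otimes> (?e [^] n \<otimes> ?a)) = ?a" using pow a by simp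
        then have "?e [^] n \<otimes> ?a = \<one> \<otimes> ?a" using a vG by (simp flip: m_assoc)
        then show False using IH a vG by (metis nat_pow_closed one_closed right_cancel)
      qed
    qed
  qed
  obtain w where w: "fst ` set w \<subseteq> X" "eval_word G w = x"
    using generate_eval_word[OF X(1)] X(2) x(1) by metis
  have "eval_word G (p @ l # linv l # q) = eval_word G (p @ q)"
    if "fst l \<in> X" "fst ` set (p @ q) \<subseteq> X" for p l q
  proof -
    have l: "letter l \<in> carrier G" "fst l \<in> carrier G" using that(1) X(1) letter_closed[of l] by auto
    have pq: "fst ` set p \<subseteq> carrier G" "fst ` set q \<subseteq> carrier G" using that X by auto
    have "eval_word G (l # linv l # q) = eval_word G q"
      unfolding eval_word_Cons letter_linv[OF l(2)]
      using l eval_word_closed[OF pq(2)] by (simp flip: m_assoc)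
    moreover have "fst ` set (p @ l # linv l # q) \<subseteq> carrier G" "fst ` set (p @ q) \<subseteq> carrier G"
      using l pq by auto
    ultimately show ?thesis using eval_word_append by simp
  qed
  then obtain v where v: "reduced_word v" "eval_word G v = x" "fst ` set v \<subseteq> X"
    using reduce_word[of X "eval_word G" w] w by metis
  have "v \<noteq> []" using v(2) x(2) by auto
  then show ?thesis using power v by blast
qed

end

lemma free_rotation_group_order:
  assumes sub: "subgroup H SO3" and free: "free_group (SO3\<lparr>carrier := H\<rparr>)" and Q: "Q \<in> H"
  shows "Q = mat 1 \<or> (\<forall>n\<ge>1. ((*v) Q ^^ n) \<noteq> id)"
proof (rule disjCI, rule ccontr)
  assume "\<not> (\<forall>n\<ge>1. ((*v) Q ^^ n) \<noteq> id)" "\<not> Q = mat 1"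
  then obtain n where n: "n \<ge> 1" "((*v) Q ^^ n) = id" by blast
  interpret H: group "SO3\<lparr>carrier := H\<rparr>" using free by (simp add: free_group_def)
  obtain X where "free_basis (SO3\<lparr>carrier := H\<rparr>) X" using free by (auto simp: free_group_def)
  then have "Q [^]\<^bsub>SO3\<lparr>carrier := H\<rparr>\<^esub> n \<noteq> mat 1"
    using H.free_basis_torsion_free[of X Q n] Q n \<open>\<not> Q = mat 1\<close> by simp
  moreover have "(Q [^]\<^bsub>SO3\<lparr>carrier := H\<rparr>\<^esub> k) *v x = ((*v) Q ^^ k) x" for k x
  proof (induction k arbitrary: x)
    case (Suc k)
    have "(Q [^]\<^bsub>SO3\<lparr>carrier := H\<rparr>\<^esub> Suc k) *v x = (Q [^]\<^bsub>SO3\<lparr>carrier := H\<rparr>\<^esub> k) *v (Q *v x)"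
      by (simp add: matrix_vector_mul_assoc)
    then show ?case using Suc by (simp add: funpow_swap1)
  qed simp
  ultimately show False using n(2) by (simp add: matrix_eq)
qed

section \<open>Solutions give weak and consistent subsystems\<close>

abbreviation meager_S2 :: "(real^3) set \<Rightarrow> bool" where
  "meager_S2 \<equiv> meager_in (top_of_set S2)"

lemma meager_rotation_image: "rotation_matrix Q \<Longrightarrow> meager_S2 S \<Longrightarrow> meager_S2 ((*v) Q ` S)"
  using meager_in_homeomorphic_image homeomorphic_map_rotation by blast

text \<open>\<open>B\<close> is comeager in a nonempty open set \<open>U\<close>. A rotation that
  moves a point \<open>x\<close> of \<open>U\<close> only slightly makes \<open>U\<close> meet its
  image in a nonempty open set, which is not meager.\<close>

lemma nonmeager_recurrence:
  assumes "baire_property_in (top_of_set S2) B" "\<not> meager_S2 B"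
  obtains x e where "x \<in> S2" "e > 0"
    "\<And>Q. rotation_matrix Q \<Longrightarrow> dist (Q *v x) x < e \<Longrightarrow> \<not> meager_S2 ((*v) Q ` B \<inter> B)"
proof -
  obtain U where U: "openin (top_of_set S2) U" "meager_S2 ((B - U) \<union> (U - B))"
    using assms(1) unfolding baire_property_in_def by blast
  have "U \<noteq> {}" using U(2) assms(2) by auto
  then obtain x where x: "x \<in> U" by blast
  then obtain e where e: "e > 0" "ball x e \<inter> S2 \<subseteq> U"
    using U(1) unfolding openin_contains_ball by blast
  have xS: "x \<in> S2" using x U(1) openin_imp_subset by blast
  have "\<not> meager_S2 ((*v) Q ` B \<inter> B)" if Q: "rotation_matrix Q" "dist (Q *v x) x < e" for Q
  proof
    assume m: "meager_S2 ((*v) Q ` B \<inter> B)"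
    have UB: "meager_S2 (U - B)" using U(2) meager_in_subset by blast
    have "openin (top_of_set S2) ((*v) Q ` U \<inter> U)"
      using homeomorphic_map_rotation[OF Q(1)] U(1)
      by (intro openin_Int) (auto simp: homeomorphic_imp_open_map open_map_def dest: homeomorphic_imp_open_map)
    moreover have "Q *v x \<in> (*v) Q ` U \<inter> U"
      using x e(2) Q(2) rotation_sphere[OF Q(1), of x] xS by (auto simp: dist_commute)
    moreover have "meager_S2 ((*v) Q ` U \<inter> U)"
    proof (rule meager_in_subset)
      show "meager_S2 (((*v) Q ` B \<inter> B) \<union> ((*v) Q ` (U - B) \<union> (U - B)))"
        by (intro meager_in_Un m UB meager_rotation_image Q(1))
      show "(*v) Q ` U \<inter> U \<subseteq> ((*v) Q ` B \<inter> B) \<union> ((*v) Q ` (U - B) \<union> (U - B))" by blast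
    qed
    ultimately show False
      using not_meager_in_open[of S2 "(*v) Q ` U \<inter> U"] by auto
  qed
  with xS e(1) show thesis by (rule that)
qed

lemma solution_imp_subsystem:
  assumes I: "finite I" "I \<noteq> {}" and sys: "congruence_system I C"
    and H: "subgroup H SO3" and free: "free_group (SO3\<lparr>carrier := H\<rparr>)"
    and sol: "sphere_solution I C H A"
    and baire: "\<And>k. k \<in> I \<Longrightarrow> baire_property_in (top_of_set S2) (A k)"
  shows "\<exists>D. D \<subset> I \<and> weak_system (I - D) (delete_sets D C) \<and> consistent_system (I - D) (delete_sets D C)"
proof -
  define D where "D = {k \<in> I. meager_S2 (A k)}"
  define J where "J = I - D"
  define U where "U L = (\<Union>k\<in>L. A k)" for L
  have disj: "A j \<inter> A k = {}" if "j \<in> I" "k \<in> I" "j \<noteq> k" for j k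
    using sol that by (auto simp: sphere_solution_def disjoint_family_on_def)
  have cover: "U I = S2" using sol by (simp add: sphere_solution_def U_def)
  have rot: "rotation_matrix Q" if "Q \<in> H" for Q using subgroup.subset[OF H] that by auto
  have U_disj: "U L \<inter> U R = {}" if "L \<subseteq> I" "R \<subseteq> I" "L \<inter> R = {}" for L R
    using disj that unfolding U_def by blast
  have finD: "finite D" using I by (simp add: D_def)
  have UD: "meager_S2 (U D)"
    unfolding U_def using finD by (intro meager_in_countable_UN) (auto simp: D_def countable_finite)
  have "D \<noteq> I"
  proof
    assume "D = I"
    then have "meager_S2 S2" using UD cover by simp
    moreover have "openin (top_of_set S2) S2" "S2 \<noteq> ({} :: (real^3) set)" by auto
    ultimately show False using not_meager_in_open[of S2 S2] by auto
  qed
  then have D: "D \<subset> I" by (auto simp: D_def)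
  have U_split: "x \<in> U L \<or> x \<in> U (J - L) \<or> x \<in> U D" if "x \<in> S2" for x L
    using that cover unfolding U_def J_def by blast
  define le where "le Q L R \<longleftrightarrow> meager_S2 ((*v) Q ` U L - U R)" for Q L R
  have le_trans: "le (Q' ** Q) L R" if "le Q L M" "le Q' M R" "Q' \<in> H" for Q Q' L M R
    unfolding le_def
  proof (rule meager_in_subset)
    show "meager_S2 ((*v) Q' ` ((*v) Q ` U L - U M) \<union> ((*v) Q' ` U M - U R))"
      using that rot by (intro meager_in_Un meager_rotation_image) (auto simp: le_def)
    show "(*v) (Q' ** Q) ` U L - U R \<subseteq> (*v) Q' ` ((*v) Q ` U L - U M) \<union> ((*v) Q' ` U M - U R)"
      by (auto simp flip: matrix_vector_mul_assoc)
  qed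
  \<comment> \<open>\<open>U (J - L)\<close> and \<open>U L\<close> fill the sphere only up to
    \<open>U D\<close>, which is meager.\<close>
  have le_compl: "le Q (J - L) (J - R)" if "le (transpose Q) R L" "Q \<in> H" "L \<subseteq> J" "R \<subseteq> J" for Q L R
    unfolding le_def
  proof (rule meager_in_subset)
    show "meager_S2 ((*v) Q ` ((*v) (transpose Q) ` U R - U L) \<union> U D)"
      using that rot UD by (intro meager_in_Un meager_rotation_image) (auto simp: le_def)
    show "(*v) Q ` U (J - L) - U (J - R) \<subseteq> (*v) Q ` ((*v) (transpose Q) ` U R - U L) \<union> U D"
    proof
      fix x assume x: "x \<in> (*v) Q ` U (J - L) - U (J - R)"
      then obtain y where y: "x = Q *v y" "y \<in> U (J - L)" by blast
      have "y \<in> U I" using y(2) by (auto simp: U_def J_def)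
      then have "x \<in> S2" using rotation_sphere[OF rot[OF that(2)], of y] cover y(1) by simp
      then have "x \<in> U R \<or> x \<in> U D" using U_split[of x R] x by blast
      moreover have "y \<notin> U L" using U_disj[of "J - L" L] y(2) that(3) by (auto simp: J_def)
      moreover have "y = transpose Q *v x" using y(1) rotation_matrix_cancel(3)[OF rot[OF that(2)]] by simp
      ultimately show "x \<in> (*v) Q ` ((*v) (transpose Q) ` U R - U L) \<union> U D" using y(1) by blast
    qed
  qed
  have H_transpose: "transpose Q \<in> H" if "Q \<in> H" for Q
    using subgroup.m_inv_closed[OF H that] inv_SO3[OF rot[OF that]] by simp
  have H_mult: "Q ** R \<in> H" if "Q \<in> H" "R \<in> H" for Q R
    using subgroup.m_closed[OF H that] by simp
  define eq where "eq Q L R \<longleftrightarrow> Q \<in> H \<and> L \<subseteq> J \<and> R \<subseteq> J \<and> le Q L R \<and> le (transpose Q) R L" for Q L R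
  have eq_sym: "eq (transpose Q) R L" if "eq Q L R" for Q L R
    using that H_transpose by (auto simp: eq_def)
  have eq_compl: "eq Q (J - L) (J - R)" if "eq Q L R" for Q L R
    using that le_compl[of Q R L] le_compl[of "transpose Q" L R] H_transpose by (auto simp: eq_def)
  have eq_trans: "eq (Q' ** Q) L R" if "eq Q L M" "eq Q' M R" for Q Q' L M R
    using that le_trans[of Q L M Q' R] le_trans[of "transpose Q'" R M "transpose Q" L] H_mult H_transpose
    by (auto simp: eq_def matrix_transpose_mul)
  have eq_base: "\<exists>Q. eq Q L R" if LR: "(L, R) \<in> set (delete_sets D C)" for L R
  proof -
    obtain L0 R0 where LR0: "(L0, R0) \<in> set C" "L = L0 - D" "R = R0 - D"
      using LR by (auto simp: delete_sets_def)
    then obtain Q where Q: "Q \<in> H" "(*v) Q ` U L0 = U R0"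
      using sol by (force simp: sphere_solution_def U_def)
    have "L0 \<subseteq> I" "R0 \<subseteq> I" using sys LR0(1) by (auto simp: congruence_system_def)
    then have sub: "L \<subseteq> J" "R \<subseteq> J" using LR0 by (auto simp: J_def)
    have "(*v) (transpose Q) ` U R0 = U L0"
      unfolding Q(2)[symmetric] using rotation_matrix_cancel(3)[OF rot[OF Q(1)]] by (auto simp: image_image)
    moreover have "U L \<subseteq> U L0" "U R \<subseteq> U R0" "U L0 \<subseteq> U L \<union> U D" "U R0 \<subseteq> U R \<union> U D"
      using LR0 by (auto simp: U_def)
    ultimately have "(*v) Q ` U L - U R \<subseteq> U D" "(*v) (transpose Q) ` U R - U L \<subseteq> U D"
      using Q(2) by blast+
    then have "eq Q L R"
      using Q(1) sub meager_in_subset[OF UD] by (simp add: eq_def le_def)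
    then show ?thesis by blast
  qed
  have ded: "\<exists>Q. eq Q L R" if "deducible J (delete_sets D C) L R" for L R
    using that by (induction rule: deducible.induct) (use eq_base eq_sym eq_compl eq_trans in blast)+
  have eq_le: "R \<subseteq> J \<and> (\<exists>Q\<in>H. le Q L R)" if "eq Q L R" for Q L R
    using that by (auto simp: eq_def)
  have pre: "R \<subseteq> J \<and> (\<exists>Q\<in>H. le Q L R)" if "cong_preceq J (delete_sets D C) L R" for L R
    using that
  proof (induction rule: cong_preceq.induct)
    case (subset L R)
    then have "(*v) (mat 1) ` U L - U R = {}" by (auto simp: U_def)
    then have "le (mat 1) L R" by (simp only: le_def meager_in_empty)
    moreover have "mat 1 \<in> H" using subgroup.one_closed[OF H] by simp
    ultimately show ?case using subset by blast
  next
    case (trans L M R)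
    then show ?case using le_trans H_mult by blast
  next
    case (base L R)
    then show ?case using eq_base eq_le by blast
  next
    case (base_sym L R)
    then show ?case using eq_base eq_le eq_sym by blast
  next
    case (compl L R)
    then show ?case using eq_base eq_le eq_compl by blast
  next
    case (compl_sym L R)
    then obtain Q where "eq Q L R" using eq_base by blast
    then show ?case using eq_le[OF eq_compl[OF eq_sym]] by blast
  qed
  have funpow_rot: "\<exists>R. rotation_matrix R \<and> ((*v) Q ^^ j) = (*v) R" if "Q \<in> H" for Q j
    using rotation_funpow rot that by blast
  \<comment> \<open>The contradiction common to both halves: some admissible power brings a
    nonmeager part of \<open>A k\<close> back into \<open>A k\<close>, while it maps
    \<open>A k\<close>, as part of \<open>U L\<close>, into \<open>U R\<close> up to a meager
    set.\<close>
  have recur: False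
    if k: "k \<in> J" "k \<in> L" and LJ: "R \<subseteq> J" "k \<notin> R" and Q: "Q \<in> H" and P: "\<And>x e. e > 0 \<Longrightarrow> x \<in> S2 \<Longrightarrow> \<exists>j. P j \<and> dist (((*v) Q ^^ j) x) x < e"
      and m: "\<And>j. P j \<Longrightarrow> meager_S2 (((*v) Q ^^ j) ` U L - U R)" for k L R Q and P :: "nat \<Rightarrow> bool"
  proof -
    have kI: "k \<in> I" "\<not> meager_S2 (A k)" using k by (auto simp: J_def D_def)
    obtain x e where xe: "x \<in> S2" "e > 0"
      "\<And>Q. rotation_matrix Q \<Longrightarrow> dist (Q *v x) x < e \<Longrightarrow> \<not> meager_S2 ((*v) Q ` A k \<inter> A k)"
      using nonmeager_recurrence[OF baire[OF kI(1)] kI(2)] by metis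
    obtain j where j: "P j" "dist (((*v) Q ^^ j) x) x < e" using P xe by blast
    obtain S where S: "rotation_matrix S" "((*v) Q ^^ j) = (*v) S" using funpow_rot[OF Q] by blast
    have "A k \<inter> U R = {}" using U_disj[of "{k}" R] kI(1) LJ by (auto simp: U_def J_def)
    then have sub: "(*v) S ` A k \<inter> A k \<subseteq> (*v) S ` U L - U R" using k(2) by (auto simp: U_def)
    have "meager_S2 ((*v) S ` U L - U R)" using m[OF j(1)] unfolding S(2) .
    then have "meager_S2 ((*v) S ` A k \<inter> A k)" using sub by (rule meager_in_subset)
    then show False using xe(3)[OF S(1)] j(2) unfolding S(2) by blast
  qed
  have step: "meager_S2 (((*v) Q ^^ Suc j) ` U L - U R)"
    if "meager_S2 (((*v) Q ^^ j) ` U L - U M)" "le Q M R" "Q \<in> H" for Q j L M R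
  proof (rule meager_in_subset)
    show "meager_S2 ((*v) Q ` (((*v) Q ^^ j) ` U L - U M) \<union> ((*v) Q ` U M - U R))"
      using that rot by (intro meager_in_Un meager_rotation_image) (auto simp: le_def)
    show "((*v) Q ^^ Suc j) ` U L - U R \<subseteq> (*v) Q ` (((*v) Q ^^ j) ` U L - U M) \<union> ((*v) Q ` U M - U R)"
      by auto
  qed
  have "consistent_system J (delete_sets D C)"
    unfolding consistent_system_def
  proof (intro notI, elim exE conjE)
    fix L R assume LR: "L \<subseteq> J" "R \<subset> L" "cong_preceq J (delete_sets D C) L R"
    then obtain Q where Q: "Q \<in> H" "le Q L R" using pre by blast
    obtain k where k: "k \<in> L" "k \<notin> R" using LR by blast
    \<comment> \<open>As \<open>R \<subset> L\<close>, the rotation maps \<open>U R\<close> into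
      \<open>U R\<close> too, up to a meager set; hence every positive power takes
      \<open>U L\<close> there.\<close>
    have RR: "le Q R R"
      using Q(2) LR(2) unfolding le_def by (rule_tac meager_in_subset) (auto simp: U_def)
    have "meager_S2 (((*v) Q ^^ Suc j) ` U L - U R)" for j
    proof (induction j)
      case 0
      then show ?case using Q(2) by (simp add: le_def)
    next
      case (Suc j)
      then show ?case using step[OF Suc RR Q(1)] by simp
    qed
    then have m: "meager_S2 (((*v) Q ^^ j) ` U L - U R)" if "j \<ge> 1" for j
      using that by (cases j) auto
    show False
    proof (rule recur[of k L R Q "\<lambda>j. j \<ge> 1"])
      show "\<exists>j. j \<ge> 1 \<and> dist (((*v) Q ^^ j) x) x < e" if "e > 0" "x \<in> S2" for x e
        using rotation_recurrence[OF rot[OF Q(1)] that(2,1)] by metis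
    qed (use LR k Q m in auto)
  qed
  moreover have "weak_system J (delete_sets D C)"
    unfolding weak_system_def
  proof (intro notI, elim exE conjE)
    fix L assume LJ: "L \<subseteq> J" and "deducible J (delete_sets D C) L (J - L)"
    then obtain Q where eq: "eq Q L (J - L)" using ded by blast
    then have Q: "Q \<in> H" "le Q L (J - L)" by (auto simp: eq_def)
    have "eq Q (J - L) L" using eq_compl[OF eq] LJ by (simp add: double_diff)
    then have Q': "le Q (J - L) L" by (simp add: eq_def)
    \<comment> \<open>Every application of \<open>Q\<close> exchanges the two sides, so odd powers
      exchange them as well.\<close>
    have m: "meager_S2 (((*v) Q ^^ j) ` U L - U (if odd j then J - L else L)) \<and>
        meager_S2 (((*v) Q ^^ j) ` U (J - L) - U (if odd j then L else J - L))" for j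
    proof (induction j)
      case (Suc j)
      then show ?case
        using step[where Q = Q and j = j and L = L and M = "if odd j then J - L else L"
            and R = "if odd j then L else J - L"]
          step[where Q = Q and j = j and L = "J - L" and M = "if odd j then L else J - L"
            and R = "if odd j then J - L else L"] Q Q'
        by (cases "odd j") auto
    qed simp
    have m_odd: "meager_S2 (((*v) Q ^^ j) ` U L - U (J - L))" "meager_S2 (((*v) Q ^^ j) ` U (J - L) - U L)"
      if "odd j" for j
      using m[of j] that by simp_all
    have odd: "\<exists>j. odd j \<and> dist (((*v) Q ^^ j) x) x < e" if "e > 0" for x e
      using odd_rotation_recurrence[OF rot[OF Q(1)] free_rotation_group_order[OF H free Q(1)] that]
      by metis
    obtain k where k: "k \<in> J" using D by (auto simp: J_def)
    show False
    proof (cases "k \<in> L")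
      case True
      show ?thesis
        by (rule recur[of k L "J - L" Q odd]) (use k True Q odd m_odd in auto)
    next
      case False
      show ?thesis
        by (rule recur[of k "J - L" L Q odd]) (use k False Q LJ odd m_odd in auto)
    qed
  qed
  ultimately show ?thesis using D unfolding J_def by blast
qed

section \<open>Weak and consistent systems have solutions\<close>


lemma weak_consistent_imp_solution:
  assumes "weak_consistent J C"
  shows "\<exists>G A. subgroup G SO3 \<and> free_group (SO3\<lparr>carrier := G\<rparr>) \<and> sphere_solution J C G A \<and>
    (\<forall>k\<in>J. baire_property_in (top_of_set S2) (A k))"
proof -
  interpret weak_consistent J C by (rule assms)
  obtain \<rho> :: "nat set \<Rightarrow> real^3^3" where rot: "\<And>j. rotation_matrix (\<rho> j)" and inj: "inj_on \<rho> gens"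
    and free: "\<And>w. reduced_word w \<Longrightarrow> w \<noteq> [] \<Longrightarrow> fst ` set w \<subseteq> gens \<Longrightarrow> word_mat \<rho> w \<noteq> mat 1"
    using free_rotations[OF finite_gens] by blast
  define T where "T l x = letter_mat \<rho> l *v x" for l x
  have T_linv: "T (linv l) (T l x) = x" for l x
    using letter_mat_linv[where \<rho> = \<rho> and l = "linv l", OF rot] by (simp add: T_def matrix_vector_mul_assoc)
  interpret star_action J C T
    by unfold_locales (simp_all add: finite_gens T_linv)
  have act: "act w x = word_mat \<rho> w *v x" for w x
  proof (induction w)
    case (Cons l w)
    have "act (l # w) x = letter_mat \<rho> l *v (word_mat \<rho> w *v x)"
      unfolding act_simps Cons by (rule T_def)
    then show ?case by (simp add: matrix_vector_mul_assoc)
  qed simp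
  have free': "word_mat \<rho> w \<noteq> mat 1" if "w \<in> words" "w \<noteq> []" for w
    using free that by (auto simp: words_def)
  have T_S2: "T l x \<in> S2" if "x \<in> S2" for l x
    using that rotation_sphere[OF rotation_letter_mat[where \<rho> = \<rho> and l = l, OF rot], of x] by (simp add: T_def)
  interpret generic_action gens T J compat bound S2
  proof
    show mixing by (rule mixing)
    show "continuous_on S2 (T l)" for l
      unfolding T_def
      by (intro linear_continuous_on linear_conv_bounded_linear[THEN iffD1] matrix_vector_mul_linear)
    show "\<exists>x\<in>U. act w x \<noteq> x"
      if "w \<in> words" "w \<noteq> []" "openin (top_of_set S2) U" "U \<noteq> {}" for w U
      unfolding act using rotation_moves_open[OF free'[OF that(1,2)] that(3,4)] .
  qed (simp, rule T_S2)
  show ?thesis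
  proof (rule generic_colouring)
    fix Y c U assume Y: "Y \<subseteq> S2" "meager_S2 (S2 - Y)" "\<And>x l. x \<in> Y \<Longrightarrow> fst l \<in> gens \<Longrightarrow> T l x \<in> Y"
      and c: "\<And>x. x \<in> Y \<Longrightarrow> c x \<in> J" "\<And>x l. x \<in> Y \<Longrightarrow> fst l \<in> gens \<Longrightarrow> compat l (c x) (c (T l x))"
      and U: "\<And>a. openin (top_of_set S2) (U a)" "\<And>a. {x \<in> Y. c x = a} = Y \<inter> U a"
    obtain c' where c': "\<And>x. x \<in> S2 \<Longrightarrow> c' x \<in> J"
      "\<And>x l. x \<in> S2 \<Longrightarrow> fst l \<in> gens \<Longrightarrow> compat l (c' x) (c' (T l x))"
    proof (rule total_colouring[of S2])
      show "w = []" if w: "w \<in> words" "\<And>z. act w z = z" for w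
        using free'[OF w(1)] w(2) unfolding act by (metis matrix_eq matrix_vector_mul_lid)
      show "T l x \<in> S2" if "x \<in> S2" for l x by (rule T_S2[OF that])
      show "act (v @ w) z = act (w @ v) z"
        if "x \<in> S2" "v \<in> words" "w \<in> words" "act v x = x" "act w x = x" for v w x z
        using rotations_fixing_point_commute[of x "word_mat \<rho> v" "word_mat \<rho> w"]
          rotation_word_mat[where \<rho> = \<rho>, OF rot] that
        by (simp add: act word_mat_append del: act_simps)
      show "\<exists>a\<in>J. joins w a a" if "w \<in> words" "w \<noteq> []" for w by (rule loops[OF that])
    qed blast
    \<comment> \<open>\<open>Y\<close> is invariant under letters and their inverses, so no edge
      joins it to its complement and the two colourings fit together.\<close>
    define d where "d x = (if x \<in> Y then c x else c' x)" for x
    have d_J: "d x \<in> J" if "x \<in> S2" for x using that c(1) c'(1) by (simp add: d_def)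
    have d: "compat l (d x) (d (T l x))" if "x \<in> S2" "fst l \<in> gens" for x l
    proof (cases "x \<in> Y")
      case True
      then show ?thesis using Y(3) c(2) that by (simp add: d_def)
    next
      case False
      then have "T l x \<notin> Y" using Y(3)[of "T l x" "linv l"] T_linv that by auto
      then show ?thesis using False c'(2) that by (simp add: d_def)
    qed
    define A where "A k = {x \<in> S2. d x = k}" for k
    define V where "V L = {x \<in> S2. d x \<in> L}" for L
    have VA: "(\<Union>k\<in>L. A k) = V L" for L by (auto simp: A_def V_def)
    define G where "G = generate SO3 (\<rho> ` gens)"
    have G: "subgroup G SO3" "free_group (SO3\<lparr>carrier := G\<rparr>)"
      unfolding G_def using free_group_of_rotations[OF rot inj free] by blast+
    have G_rot: "rotation_matrix Q" if "Q \<in> G" for Q using subgroup.subset[OF G(1)] that by auto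
    have \<rho>G: "\<rho> X \<in> G" if "X \<in> gens" for X using that by (auto simp: G_def intro: generate.incl)
    have gen: "x \<in> V (rep X) \<longleftrightarrow> \<rho> X *v x \<in> V X" if "X \<in> gens" for X x
      using d[of x "(X, True)"] that rotation_sphere[OF rot, of X x]
      by (auto simp: V_def compat_def src_def T_def letter_mat_def)
    \<comment> \<open>Two sets of one class are then congruent through their common representative.
      If the complement of \<open>X\<close> carries the generator, the same rotation works for
      \<open>X\<close>.\<close>
    have witness: "\<exists>Q\<in>G. (*v) Q ` V (rep X) = V X" if X: "X \<subseteq> J" for X
      using X
    proof (cases rule: rep_cases)
      case 1
      have "mat 1 \<in> G" using subgroup.one_closed[OF G(1)] by simp
      then show ?thesis using 1 by (intro bexI[of _ "mat 1"]) auto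
    next
      case 2
      then show ?thesis using rotation_image_eqI[OF rot gen] \<rho>G by blast
    next
      case 3
      have compl: "x \<in> V (J - L) \<longleftrightarrow> x \<in> S2 \<and> x \<notin> V L" for x L using d_J by (auto simp: V_def)
      have "x \<in> V (rep X) \<longleftrightarrow> \<rho> (J - X) *v x \<in> V X" for x
        using gen[OF 3, of x] rotation_sphere[OF rot, of "J - X" x]
        unfolding rep_compl[OF X] compl by (auto simp: V_def)
      then show ?thesis using rotation_image_eqI[OF rot] \<rho>G[OF 3] by blast
    qed
    have "sphere_solution J C G A"
      unfolding sphere_solution_def VA
    proof (intro conjI)
      show "disjoint_family_on A J" by (auto simp: disjoint_family_on_def A_def)
      show "V J = S2" using d_J by (auto simp: V_def)
      show "\<forall>(L, R)\<in>set C. \<exists>\<sigma>\<in>G. (*v) \<sigma> ` V L = V R"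
      proof (clarify)
        fix L R assume LR: "(L, R) \<in> set C"
        then have sub: "L \<subseteq> J" "R \<subseteq> J" using C_subset by blast+
        have "eqv L R" using LR sub by (auto simp: eqv_def intro: deducible.base)
        then have "rep L = rep R" by (rule rep_cong)
        then obtain P Q where PQ: "P \<in> G" "(*v) P ` V (rep L) = V L" "Q \<in> G" "(*v) Q ` V (rep L) = V R"
          using witness[OF sub(1)] witness[OF sub(2)] by metis
        have "transpose P \<in> G"
          using subgroup.m_inv_closed[OF G(1) PQ(1)] inv_SO3[OF G_rot[OF PQ(1)]] by simp
        then have "Q ** transpose P \<in> G" using subgroup.m_closed[OF G(1) PQ(3)] by simp
        moreover have "(*v) (Q ** transpose P) ` V L = V R"
          unfolding PQ(2)[symmetric] PQ(4)[symmetric]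
          by (simp add: image_image rotation_matrix_cancel[OF G_rot[OF PQ(1)]] flip: matrix_vector_mul_assoc)
        ultimately show "\<exists>\<sigma>\<in>G. (*v) \<sigma> ` V L = V R" by blast
      qed
    qed
    moreover have "baire_property_in (top_of_set S2) (A k)" for k
      unfolding baire_property_in_def
    proof (intro conjI exI[of _ "U k"] U)
      show "A k \<subseteq> topspace (top_of_set S2)" by (auto simp: A_def)
      have "(A k - U k) \<union> (U k - A k) \<subseteq> S2 - Y"
        using U(2)[of k] openin_imp_subset[OF U(1)[of k]] by (auto simp: A_def d_def)
      then show "meager_S2 ((A k - U k) \<union> (U k - A k))" by (rule meager_in_subset[OF Y(2)])
    qed
    ultimately show ?thesis using G by blast
  qed
qed

theorem mainTheorem6:
  fixes r :: nat and C :: "congruence list"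
  assumes "r \<ge> 1" and "congruence_system {1..r} C"
  shows "(\<exists>G A. subgroup G SO3 \<and> free_group (SO3\<lparr>carrier := G\<rparr>) \<and>
             sphere_solution {1..r} C G A \<and>
             (\<forall>k\<in>{1..r}. baire_property_in (top_of_set S2) (A k)))
         \<longleftrightarrow>
         (\<exists>D. D \<subset> {1..r} \<and>
             weak_system ({1..r} - D) (delete_sets D C) \<and>
             consistent_system ({1..r} - D) (delete_sets D C))"
proof
  assume "\<exists>G A. subgroup G SO3 \<and> free_group (SO3\<lparr>carrier := G\<rparr>) \<and> sphere_solution {1..r} C G A \<and>
    (\<forall>k\<in>{1..r}. baire_property_in (top_of_set S2) (A k))"
  then obtain G A where "subgroup G SO3" "free_group (SO3\<lparr>carrier := G\<rparr>)" "sphere_solution {1..r} C G A"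
    "\<forall>k\<in>{1..r}. baire_property_in (top_of_set S2) (A k)"
    by blast
  then show "\<exists>D. D \<subset> {1..r} \<and> weak_system ({1..r} - D) (delete_sets D C) \<and>
      consistent_system ({1..r} - D) (delete_sets D C)"
    using assms by (intro solution_imp_subsystem[of "{1..r}" C G A]) auto
next
  assume "\<exists>D. D \<subset> {1..r} \<and> weak_system ({1..r} - D) (delete_sets D C) \<and>
      consistent_system ({1..r} - D) (delete_sets D C)"
  then obtain D where D: "D \<subset> {1..r}" "weak_system ({1..r} - D) (delete_sets D C)"
    "consistent_system ({1..r} - D) (delete_sets D C)"
    by blast
  let ?J = "{1..r} - D" and ?C = "delete_sets D C"
  have "weak_consistent ?J ?C"
    using D assms(2) by unfold_locales (auto simp: congruence_system_def delete_sets_def)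
  then obtain G A where G: "subgroup G SO3" "free_group (SO3\<lparr>carrier := G\<rparr>)"
    and sol: "sphere_solution ?J ?C G A" and baire: "\<forall>k\<in>?J. baire_property_in (top_of_set S2) (A k)"
    using weak_consistent_imp_solution by blast
  \<comment> \<open>Deleted indices get empty pieces, which leave all unions unchanged and have the
    property of Baire.\<close>
  define A' where "A' k = (if k \<in> D then {} else A k)" for k
  have union: "(\<Union>k\<in>L. A' k) = (\<Union>k\<in>L - D. A k)" for L by (auto simp: A'_def)
  have "sphere_solution {1..r} C G A'"
    unfolding sphere_solution_def union
  proof (intro conjI)
    show "disjoint_family_on A' {1..r}"
      using sol by (auto simp: sphere_solution_def disjoint_family_on_def A'_def)
    show "(\<Union>k\<in>?J. A k) = S2" using sol by (simp add: sphere_solution_def)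
    show "\<forall>(L, R)\<in>set C. \<exists>\<sigma>\<in>G. (*v) \<sigma> ` (\<Union>k\<in>L - D. A k) = (\<Union>k\<in>R - D. A k)"
      using sol by (fastforce simp: sphere_solution_def delete_sets_def)
  qed
  moreover have "baire_property_in (top_of_set S2) (A' k)" if "k \<in> {1..r}" for k
  proof (cases "k \<in> D")
    case True
    then show ?thesis by (auto simp: A'_def baire_property_in_def intro: exI[of _ "{}"])
  next
    case False
    then show ?thesis using baire that by (simp add: A'_def)
  qed
  ultimately show "\<exists>G A. subgroup G SO3 \<and> free_group (SO3\<lparr>carrier := G\<rparr>) \<and> sphere_solution {1..r} C G A \<and>
    (\<forall>k\<in>{1..r}. baire_property_in (top_of_set S2) (A k))"
    using G by blast
qed

end
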